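(* Let $p>6000$ be a prime number. Then $\mathrm{Ol}(\mathbb{Z}_p\oplus\mathbb{Z}_p)=p-1+\mathrm{Ol}(\mathbb{Z}_p)$.
   Context: For a finite additive abelian group $G$, a subset $S\subseteq G$ is a zero-sum set if the sum of all its elements is $0$. The Olson constant $\mathrm{Ol}(G)$ is the smallest integer $k$ such that every set of $k$ (distinct) elements of $G$ contains a non-empty zero-sum subset. *)

theory Defs
  imports "HOL-Algebra.Elementary_Groups" "HOL-Algebra.FiniteProduct" "HOL-Computational_Algebra.Primes"
begin

text \<open>Zero-sum set: the (group-)sum of all elements of S is the neutral element.
  The group is written multiplicatively in HOL-Algebra, so the sum is finprod.\<close>
definition zero_sum_set :: "('a, 'b) monoid_scheme \<Rightarrow> 'a set \<Rightarrow> bool" where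
  "zero_sum_set G S \<longleftrightarrow> finprod G (\<lambda>x. x) S = \<one>\<^bsub>G\<^esub>"

definition olson :: "('a, 'b) monoid_scheme \<Rightarrow> nat" where
  "olson G = (LEAST k. \<forall>S. S \<subseteq> carrier G \<and> finite S \<and> card S = k \<longrightarrow>
       (\<exists>T. T \<subseteq> S \<and> T \<noteq> {} \<and> zero_sum_set G T))"

end

theory Submission
  imports Defs "HOL-Library.Set_Algebras" "Jordan_Normal_Form.Determinant" Complex_Main
begin

text \<open>
  Let \<open>S\<close> be a zero-sum free set of \<open>p - 1 + Ol(Z_p)\<close> elements. Expanding the number of zero-sum
  subsets into characters shows that some Fourier coefficient is large, so there is a linear form
  \<open>c\<close> on the group whose values on \<open>S\<close> are concentrated near \<open>0\<close> in mean square. The level sets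
  (rows) of \<open>c\<close> are then long, at least \<open>p\<close> elements lie outside row \<open>0\<close>, and a second linear form
  \<open>x\<close> is injective on each row.

  By the Dias da Silva--Hamidoune inequality the sums of \<open>k\<close> elements of a row of length \<open>n\<close> take at
  least \<open>k (n - k) + 1\<close> values of \<open>x\<close>. If these gains add up to \<open>p - 1\<close>, the Cauchy--Davenport
  inequality yields every \<open>x\<close>-sum, whatever the numbers \<open>k\<close> are within suitable ranges; the freedom
  in choosing them is used to make the \<open>c\<close>-sum vanish. When all rows are shorter than \<open>p / 11\<close>, about
  a quarter of each row provides the gain and quadruples of elements with distinct \<open>|c|\<close> provide the
  freedom. When one row is longer, a few of its elements provide the gain, so almost all elements of
  \<open>S\<close> outside row \<open>0\<close> must have the same \<open>c\<close> up to sign, and the few remaining configurations are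
  excluded directly.
\<close>

section \<open>Residues and the Cauchy--Davenport inequality\<close>

text \<open>Gain and freedom compete for the same elements. Reserving a quarter of a row at either
  end of the range of \<open>k\<close> leaves half of it free, so about \<open>p / 2\<close>
  elements must produce all \<open>p\<close> residues as \<open>c\<close>-sums. Single elements give
  one new sum each and pairs \<open>3 / 2\<close> per element, which is too little; a quadruple with
  distinct nonzero |c| gives ten new sums, \<open>5 / 2\<close> per element. Forming
  \<open>p / 10\<close> such quadruples requires that no value of |c| occurs more than about
  \<open>p / 10\<close> times, hence the threshold \<open>p / 11\<close> for rows. A longer row is
  full of \<open>x\<close>-sums as soon as 40 elements are kept at either end, so there the gain is
  almost free. The bound 6000 comes from the analytic step: from there on
  \<open>ln p \<le> 3 * p / 2000\<close>, so the squares of \<open>c\<close> sum to at most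
  \<open>3 * p ^ 3 / 4000\<close>, and \<open>p\<close> elements with so small a second moment must
  form rows long enough for the gain. About Ol(Z_p) two facts are used for the upper bound: row
  \<open>0\<close> has fewer than Ol(Z_p) elements, and Ol(Z_p) is at least 11.\<close>

locale prime_modulus =
  fixes p :: nat
  assumes prime_p: "prime p"
begin

text \<open>The sets stay in the integers, so that sums of elements and of sets need no reduction;
  only sizes are taken modulo \<open>p\<close>.\<close>

definition card_mod :: "int set \<Rightarrow> nat" where
  "card_mod A = card ((\<lambda>x. x mod int p) ` A)"

lemma p_pos: "0 < int p" and p_gt_1: "1 < p"
  using prime_p prime_gt_0_nat prime_gt_1_nat by auto

lemma prime_int_p: "prime (int p)"
  using prime_p by simp

lemma mod_eq_iff_dvd: "a mod int p = b mod int p \<longleftrightarrow> int p dvd a - b"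
  by (simp add: mod_eq_dvd_iff)

lemma finite_residues: "finite ((\<lambda>x. x mod int p) ` A)"
  by (rule finite_subset[of _ "{0..<int p}"]) (use p_pos in auto)

lemma card_mod_le: "card_mod A \<le> p"
proof -
  have "card ((\<lambda>x. x mod int p) ` A) \<le> card {0..<int p}"
    by (rule card_mono) (use p_pos in auto)
  then show ?thesis by (simp add: card_mod_def)
qed

lemma card_mod_mono: "A \<subseteq> B \<Longrightarrow> card_mod A \<le> card_mod B"
  unfolding card_mod_def by (rule card_mono[OF finite_residues]) auto

lemma card_mod_pos: "A \<noteq> {} \<Longrightarrow> 0 < card_mod A"
  unfolding card_mod_def by (simp add: card_gt_0_iff finite_residues)

lemma card_mod_ge_card:
  assumes "B \<subseteq> A" "finite B" "\<And>x y. x \<in> B \<Longrightarrow> y \<in> B \<Longrightarrow> int p dvd x - y \<Longrightarrow> x = y"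
  shows "card B \<le> card_mod A"
proof -
  have "inj_on (\<lambda>x. x mod int p) B"
    using assms(3) by (auto simp: inj_on_def mod_eq_iff_dvd)
  then have "card B = card_mod B" by (simp add: card_mod_def card_image)
  with card_mod_mono[OF assms(1)] show ?thesis by simp
qed

lemma card_mod_full:
  assumes "card_mod A \<ge> p"
  obtains x where "x \<in> A" "int p dvd x - r"
proof -
  have "(\<lambda>x. x mod int p) ` A \<subseteq> {0..<int p}" using p_pos by auto
  moreover have "card ((\<lambda>x. x mod int p) ` A) \<ge> card {0..<int p}"
    using assms by (simp add: card_mod_def)
  ultimately have "(\<lambda>x. x mod int p) ` A = {0..<int p}"
    by (intro card_seteq) auto
  moreover have "r mod int p \<in> {0..<int p}" using p_pos by auto
  ultimately obtain x where "x \<in> A" "r mod int p = x mod int p" by blast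
  then show ?thesis using that mod_eq_iff_dvd by metis
qed

lemma residues_plus:
  "(\<lambda>x. x mod int p) ` (A + B)
     = (\<lambda>x. x mod int p) ` ((\<lambda>x. x mod int p) ` A + (\<lambda>x. x mod int p) ` B)"
  by (fastforce simp: set_plus_def image_iff mod_simps)

lemma card_image_eq_kernel:
  assumes "\<And>x y. x \<in> A \<Longrightarrow> y \<in> A \<Longrightarrow> f x = f y \<longleftrightarrow> g x = g y"
  shows "card (f ` A) = card (g ` A)"
proof (rule bij_betw_same_card)
  define h where "h = (\<lambda>r. g (inv_into A f r))"
  have h: "h (f x) = g x" if "x \<in> A" for x
    using that assms[of "inv_into A f (f x)" x]
    by (simp add: h_def inv_into_into f_inv_into_f)
  show "bij_betw h (f ` A) (g ` A)"
    unfolding bij_betw_def inj_on_def using h assms by (auto simp: image_image)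
qed

lemma card_mod_image:
  assumes "\<And>x y. x \<in> A \<Longrightarrow> y \<in> A \<Longrightarrow> int p dvd f x - f y \<longleftrightarrow> int p dvd x - y"
  shows "card_mod (f ` A) = card_mod A"
  unfolding card_mod_def image_image
  by (rule card_image_eq_kernel) (use assms in \<open>simp add: mod_eq_iff_dvd\<close>)

lemma card_mod_shift: "card_mod ((\<lambda>x. x + t) ` A) = card_mod A"
  by (rule card_mod_image) simp

lemma card_mod_neg: "card_mod ((\<lambda>x. t - x) ` A) = card_mod A"
  by (rule card_mod_image) (simp add: dvd_diff_commute)

lemma residue_eqI:
  assumes "int p dvd x - y" "x \<in> {0..<int p}" "y \<in> {0..<int p}"
  shows "x = y"
proof -
  have "x mod int p = y mod int p" using assms(1) mod_eq_iff_dvd by blast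
  then show ?thesis using assms(2,3) by simp
qed

lemma inverse_exists:
  assumes "\<not> int p dvd d"
  obtains e where "int p dvd d * e - 1"
proof -
  have "coprime d (int p)"
    using prime_imp_coprime[OF prime_int_p assms] by (simp add: coprime_commute)
  then have "gcd d (int p) = 1" by simp
  then obtain e u where "e * d + u * int p = 1" using bezout_int[of d "int p"] by auto
  then have "d * e - 1 = int p * (- u)" by (simp add: algebra_simps)
  then show ?thesis using that dvdI by blast
qed

text \<open>Since \<open>d\<close> is invertible, its multiples run through all residues, so the
  orbit of one element of \<open>A\<close> is everything.\<close>

lemma shift_closed_full:
  assumes A: "A \<subseteq> {0..<int p}" "A \<noteq> {}" and d: "\<not> int p dvd d"
    and cl: "\<And>a. a \<in> A \<Longrightarrow> (a + d) mod int p \<in> A"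
  shows "A = {0..<int p}"
proof
  obtain a where a: "a \<in> A" using A by auto
  have k: "(a + int k * d) mod int p \<in> A" for k
  proof (induction k)
    case 0
    have "a mod int p = a" using a A by auto
    then show ?case using a by simp
  next
    case (Suc k)
    from cl[OF this] show ?case by (simp add: mod_simps algebra_simps)
  qed
  obtain e where e: "int p dvd d * e - 1" using inverse_exists[OF d] .
  show "{0..<int p} \<subseteq> A"
  proof
    fix z assume z: "z \<in> {0..<int p}"
    define k where "k = nat ((e * (z - a)) mod int p)"
    have "int k = (e * (z - a)) mod int p" using p_pos by (simp add: k_def)
    then have "int k mod int p = (e * (z - a)) mod int p" by simp
    then have "int p dvd int k - e * (z - a)" using mod_eq_iff_dvd by blast
    then have "int p dvd (int k - e * (z - a)) * d + (d * e - 1) * (z - a)"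
      using e by (intro dvd_add dvd_mult2)
    moreover have "(int k - e * (z - a)) * d + (d * e - 1) * (z - a) = a + int k * d - z"
      by (simp add: algebra_simps)
    ultimately have "(a + int k * d) mod int p = z mod int p"
      using mod_eq_iff_dvd by metis
    also have "\<dots> = z" using z by auto
    finally show "z \<in> A" using k[of k] by simp
  qed
qed (use A in auto)

text \<open>Davenport's transform: move the part of \<open>e + B\<close> outside \<open>A\<close> from \<open>B\<close> to \<open>A\<close>.\<close>

lemma cauchy_davenport_aux:
  assumes "A \<subseteq> {0..<int p}" "B \<subseteq> {0..<int p}" "A \<noteq> {}" "B \<noteq> {}" "card A + card B \<le> p + 1"
  shows "card A + card B \<le> card_mod (A + B) + 1"
  using assms
proof (induction "card B" arbitrary: A B rule: less_induct)
  case less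
  note A = less.prems(1) and B = less.prems(2)
  have fA: "finite A" and fB: "finite B" using A B finite_subset by auto
  obtain b0 where b0: "b0 \<in> B" using less.prems by auto
  have cmA: "card_mod A = card A" using A by (simp add: card_mod_def subset_iff cong: image_cong)
  show ?case
  proof (cases "card B = 1")
    case True
    then have "B = {b0}" using b0 by (metis card_1_singletonE singletonD)
    then have "A + B = (\<lambda>x. x + b0) ` A" by (auto simp: set_plus_def)
    then show ?thesis using True card_mod_shift cmA by simp
  next
    case False
    then have "B \<noteq> {b0}" by auto
    then obtain b1 where b1: "b1 \<in> B" "b1 \<noteq> b0" using b0 by blast
    \<comment> \<open>Translating \<open>B\<close> so that it contains \<open>0\<close> changes no
      size and ensures that the transform never empties the second set.\<close>
    define C where "C = (\<lambda>b. (b - b0) mod int p) ` B"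
    have injC: "inj_on (\<lambda>b. (b - b0) mod int p) B"
    proof (rule inj_onI)
      fix x y assume "x \<in> B" "y \<in> B" "(x - b0) mod int p = (y - b0) mod int p"
      then have "int p dvd x - y" by (simp add: mod_eq_iff_dvd)
      then show "x = y" using \<open>x \<in> B\<close> \<open>y \<in> B\<close> B residue_eqI by blast
    qed
    have cardC: "card C = card B" using injC by (simp add: C_def card_image)
    have C: "C \<subseteq> {0..<int p}" using p_pos by (auto simp: C_def)
    have fC: "finite C" using C finite_subset by auto
    have C0: "0 \<in> C" using b0 by (force simp: C_def)
    define d where "d = (b1 - b0) mod int p"
    have dC: "d \<in> C" using b1 by (auto simp: C_def d_def)
    have "\<not> int p dvd b1 - b0"
    proof
      assume "int p dvd b1 - b0"
      then show False using b0 b1 B residue_eqI by blast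
    qed
    then have d: "\<not> int p dvd d" by (simp add: d_def dvd_mod_iff)
    have cmAC: "card_mod (A + C) = card_mod (A + B)"
    proof -
      have "(\<lambda>x. x mod int p) ` (A + C) = (\<lambda>x. x mod int p) ` ((\<lambda>x. x + (- b0)) ` (A + B))"
        by (fastforce simp: set_plus_def C_def image_iff mod_simps algebra_simps)
      then show ?thesis using card_mod_shift[of "- b0" "A + B"] by (simp add: card_mod_def)
    qed
    \<comment> \<open>If \<open>A\<close> were closed under adding \<open>d\<close>, it would be
      everything, and \<open>card B \<ge> 2\<close> would break the size hypothesis. Hence the
      transform at \<open>e\<close> really removes \<open>d\<close> from the second set.\<close>
    have "\<exists>e\<in>A. (e + d) mod int p \<notin> A"
    proof (rule ccontr)
      assume "\<not> ?thesis"
      then have "A = {0..<int p}" using shift_closed_full[OF A less.prems(3) d] by blast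
      then have "card A = p" by simp
      then show False using less.prems(5) False less.prems(4) fB by (simp add: card_gt_0_iff le_Suc_eq)
    qed
    then obtain e where e: "e \<in> A" "(e + d) mod int p \<notin> A" by blast
    define B' where "B' = {b \<in> C. (e + b) mod int p \<in> A}"
    define D where "D = (\<lambda>b. (e + b) mod int p) ` (C - B')"
    have injD: "inj_on (\<lambda>b. (e + b) mod int p) (C - B')"
    proof (rule inj_onI)
      fix x y assume xy: "x \<in> C - B'" "y \<in> C - B'" "(e + x) mod int p = (e + y) mod int p"
      then have "int p dvd x - y" by (simp add: mod_eq_iff_dvd)
      then show "x = y" using xy C residue_eqI by blast
    qed
    have disj: "A \<inter> D = {}" by (auto simp: D_def B'_def)
    have cardD: "card D = card C - card B'"
      using injD fC by (simp add: D_def card_image card_Diff_subset B'_def)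
    have B'C: "card B' \<le> card C" by (rule card_mono[OF fC]) (auto simp: B'_def)
    have "0 \<in> B'" using C0 e A by (auto simp: B'_def)
    have "d \<notin> B'" using e by (simp add: B'_def)
    then have "card B' < card B" unfolding cardC[symmetric]
      by (intro psubset_card_mono fC) (use dC in \<open>auto simp: B'_def\<close>)
    moreover have D: "D \<subseteq> {0..<int p}" using p_pos by (auto simp: D_def)
    have fD: "finite D" using D finite_subset by auto
    have cA': "card (A \<union> D) + card B' = card A + card B"
      using card_Un_disjoint[OF fA fD disj] cardD B'C cardC by simp
    moreover have "B' \<subseteq> {0..<int p}" "B' \<noteq> {}" "A \<union> D \<subseteq> {0..<int p}" "A \<union> D \<noteq> {}"
      using A D C \<open>0 \<in> B'\<close> less.prems(3) by (auto simp: B'_def)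
    ultimately have "card (A \<union> D) + card B' \<le> card_mod ((A \<union> D) + B') + 1"
      using less.hyps[of B' "A \<union> D"] less.prems(5) by simp
    \<comment> \<open>The sumset does not grow: for a new element \<open>a = e + c\<close> the sum
      \<open>a + b\<close> is \<open>(e + b) + c\<close>, and \<open>e + b\<close> lies in
      \<open>A\<close> because \<open>b\<close> was kept in \<open>B'\<close>.\<close>
    moreover have "card_mod ((A \<union> D) + B') \<le> card_mod (A + C)"
    proof -
      have "(\<lambda>x. x mod int p) ` ((A \<union> D) + B') \<subseteq> (\<lambda>x. x mod int p) ` (A + C)"
      proof
        fix y assume "y \<in> (\<lambda>x. x mod int p) ` ((A \<union> D) + B')"
        then obtain a b where ab: "a \<in> A \<union> D" "b \<in> B'" "y = (a + b) mod int p"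
          by (auto simp: set_plus_def)
        show "y \<in> (\<lambda>x. x mod int p) ` (A + C)"
        proof (cases "a \<in> A")
          case True
          then show ?thesis using ab by (auto simp: set_plus_def B'_def)
        next
          case False
          then obtain c where c: "c \<in> C" "a = (e + c) mod int p" using ab by (auto simp: D_def)
          have "y = ((e + b) mod int p + c) mod int p" using ab c by (simp add: mod_simps algebra_simps)
          moreover have "(e + b) mod int p \<in> A" using ab by (simp add: B'_def)
          ultimately show ?thesis using c by blast
        qed
      qed
      then show ?thesis unfolding card_mod_def by (rule card_mono[OF finite_residues])
    qed
    ultimately show ?thesis using cA' cmAC by simp
  qed
qed

lemma cauchy_davenport:
  assumes "A \<noteq> {}" "B \<noteq> {}"
  shows "min p (card_mod A + card_mod B - 1) \<le> card_mod (A + B)"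
proof -
  define A' where "A' = (\<lambda>x. x mod int p) ` A"
  define B1 where "B1 = (\<lambda>x. x mod int p) ` B"
  have cA: "card A' = card_mod A" "card B1 = card_mod B" by (simp_all add: A'_def B1_def card_mod_def)
  have pos: "0 < card_mod A" "0 < card_mod B" using assms card_mod_pos by auto
  \<comment> \<open>The induction needs sizes adding up to at most \<open>p + 1\<close>; surplus
    residues of \<open>B\<close> are dropped, which is what produces the minimum with
    \<open>p\<close>.\<close>
  have "min (card_mod B) (p + 1 - card_mod A) \<le> card B1" using cA by simp
  then obtain B' where B': "B' \<subseteq> B1" "card B' = min (card_mod B) (p + 1 - card_mod A)"
    by (meson obtain_subset_with_card_n)
  have "card B' > 0" using B' pos card_mod_le[of A] by simp
  then have ne: "B' \<noteq> {}" by auto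
  have "card A' + card B' \<le> card_mod (A' + B') + 1"
    by (rule cauchy_davenport_aux)
       (use B' cA p_pos assms ne card_mod_le[of A] in \<open>auto simp: A'_def B1_def\<close>)
  moreover have "card_mod (A' + B') \<le> card_mod (A' + B1)"
    using B' by (intro card_mod_mono set_plus_mono2) auto
  moreover have "card_mod (A' + B1) = card_mod (A + B)"
    unfolding card_mod_def A'_def B1_def by (subst (2) residues_plus) simp
  ultimately show ?thesis using B' cA by auto
qed

lemma cauchy_davenport_sum:
  assumes "finite I" "\<And>i. i \<in> I \<Longrightarrow> F i \<noteq> {}"
  shows "min p (1 + (\<Sum>i\<in>I. card_mod (F i) - 1)) \<le> card_mod (sum F I)" "sum F I \<noteq> {}"
proof -
  have "min p (1 + (\<Sum>i\<in>I. card_mod (F i) - 1)) \<le> card_mod (sum F I) \<and> sum F I \<noteq> {}"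
    using assms
  proof (induction I rule: finite_induct)
    case empty
    then show ?case using card_mod_pos[of "{0}"] by (simp add: set_zero)
  next
    case (insert i I)
    have "F i + sum F I \<noteq> {}" using insert by (auto simp: set_plus_def)
    moreover have "min p (card_mod (F i) + card_mod (sum F I) - 1) \<le> card_mod (F i + sum F I)"
      using insert by (intro cauchy_davenport) auto
    moreover have "card_mod (F i) > 0" using insert card_mod_pos by auto
    moreover have "card_mod (sum F I) > 0" using insert card_mod_pos by auto
    ultimately show ?case using insert by auto
  qed
  then show "min p (1 + (\<Sum>i\<in>I. card_mod (F i) - 1)) \<le> card_mod (sum F I)" "sum F I \<noteq> {}" by auto
qed

end

section \<open>The Dias da Silva--Hamidoune inequality\<close>

text \<open>An alternating polynomial in \<open>a\<close> of degree at most
  \<open>(\<Sum>j<n. m j) + length es\<close>; it vanishes below the degree of the Vandermonde determinant and is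
  a constant multiple of it in that degree.\<close>

definition alt_sum :: "nat \<Rightarrow> nat \<Rightarrow> (nat \<Rightarrow> int) \<Rightarrow> (nat \<Rightarrow> nat) \<Rightarrow> int list \<Rightarrow> int" where
  "alt_sum n k a m es = (\<Sum>\<sigma> | \<sigma> permutes {..<n}.
     sign \<sigma> * ((\<Prod>e\<leftarrow>es. (\<Sum>j<k. a (\<sigma> j)) - e) * (\<Prod>j<n. a (\<sigma> j) ^ m j)))"

definition vandermonde :: "nat \<Rightarrow> (nat \<Rightarrow> int) \<Rightarrow> int" where
  "vandermonde n a = (\<Sum>\<sigma> | \<sigma> permutes {..<n}. sign \<sigma> * (\<Prod>j<n. a (\<sigma> j) ^ j))"

text \<open>Expanding one linear factor: each \<open>a (\<sigma> j)\<close> with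
  \<open>j < k\<close> raises the exponent \<open>m j\<close> by one, while \<open>e\<close> leaves
  an alternating sum of lower degree.\<close>

lemma alt_sum_Cons:
  assumes "k \<le> n"
  shows "alt_sum n k a m (e # es)
    = (\<Sum>j<k. alt_sum n k a (m(j := Suc (m j))) es) - e * alt_sum n k a m es"
proof -
  have inc: "(\<Prod>i<n. a (\<sigma> i) ^ (m(j := Suc (m j))) i) = a (\<sigma> j) * (\<Prod>i<n. a (\<sigma> i) ^ m i)"
    if "j < k" for j and \<sigma> :: "nat \<Rightarrow> nat"
  proof -
    have j: "j \<in> {..<n}" using that assms by simp
    have "(\<Prod>i\<in>{..<n} - {j}. a (\<sigma> i) ^ (m(j := Suc (m j))) i)
        = (\<Prod>i\<in>{..<n} - {j}. a (\<sigma> i) ^ m i)"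
      by (intro prod.cong) auto
    then show ?thesis using j by (simp add: prod.remove[OF _ j])
  qed
  have "(\<Sum>j<k. alt_sum n k a (m(j := Suc (m j))) es)
      = (\<Sum>\<sigma> | \<sigma> permutes {..<n}. \<Sum>j<k. sign \<sigma> * ((\<Prod>e\<leftarrow>es. (\<Sum>j<k. a (\<sigma> j)) - e)
          * (\<Prod>i<n. a (\<sigma> i) ^ (m(j := Suc (m j))) i)))"
    unfolding alt_sum_def by (rule sum.swap)
  also have "\<dots> = (\<Sum>\<sigma> | \<sigma> permutes {..<n}. \<Sum>j<k. a (\<sigma> j) * (sign \<sigma> *
      ((\<Prod>e\<leftarrow>es. (\<Sum>j<k. a (\<sigma> j)) - e) * (\<Prod>i<n. a (\<sigma> i) ^ m i))))"
    by (intro sum.cong refl) (simp only: inc lessThan_iff mult_ac)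
  also have "\<dots> = (\<Sum>\<sigma> | \<sigma> permutes {..<n}. (\<Sum>j<k. a (\<sigma> j)) * (sign \<sigma> *
      ((\<Prod>e\<leftarrow>es. (\<Sum>j<k. a (\<sigma> j)) - e) * (\<Prod>i<n. a (\<sigma> i) ^ m i))))"
    by (simp add: sum_distrib_right)
  finally show ?thesis
    by (simp add: alt_sum_def sum_distrib_left sum_subtractf[symmetric] algebra_simps)
qed

text \<open>Composition with the transposition of \<open>i\<close> and \<open>j\<close> preserves
  every monomial and reverses every sign, so the sum equals its own negative.\<close>

lemma alt_sum_Nil_repeated:
  assumes "i < n" "j < n" "i \<noteq> j" "m i = m j"
  shows "alt_sum n k a m [] = 0"
proof -
  let ?t = "Transposition.transpose i j"
  have t: "?t permutes {..<n}" using assms by (intro permutes_swap_id) auto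
  have "alt_sum n k a m [] = (\<Sum>\<sigma> | \<sigma> permutes {..<n}. sign (\<sigma> \<circ> ?t) * (\<Prod>l<n. a ((\<sigma> \<circ> ?t) l) ^ m l))"
    unfolding alt_sum_def by (subst sum_permutations_compose_right[OF t]) simp
  also have "\<dots> = (\<Sum>\<sigma> | \<sigma> permutes {..<n}. - (sign \<sigma> * (\<Prod>l<n. a (\<sigma> l) ^ m l)))"
  proof (rule sum.cong[OF refl])
    fix \<sigma> assume "\<sigma> \<in> {\<sigma>. \<sigma> permutes {..<n}}"
    then have "permutation \<sigma>" using permutes_imp_permutation by blast
    moreover have "permutation ?t" using t permutes_imp_permutation by blast
    ultimately have "sign (\<sigma> \<circ> ?t) = - sign \<sigma>"
      using assms by (simp add: sign_compose sign_swap_id)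
    moreover have "(\<Prod>l<n. a ((\<sigma> \<circ> ?t) l) ^ m l) = (\<Prod>l<n. a (\<sigma> l) ^ m l)"
    proof -
      have "m (?t l) = m l" for l using assms by (simp add: transpose_def)
      then have "(\<Prod>l<n. a ((\<sigma> \<circ> ?t) l) ^ m l) = (\<Prod>l<n. a (\<sigma> (?t l)) ^ m (?t l))" by simp
      also have "\<dots> = (\<Prod>l<n. a (\<sigma> l) ^ m l)"
        using prod.permute[OF t, of "\<lambda>l. a (\<sigma> l) ^ m l"] by (simp add: comp_def)
      finally show ?thesis .
    qed
    ultimately show "sign (\<sigma> \<circ> ?t) * (\<Prod>l<n. a ((\<sigma> \<circ> ?t) l) ^ m l)
        = - (sign \<sigma> * (\<Prod>l<n. a (\<sigma> l) ^ m l))" by simp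
  qed
  also have "\<dots> = - alt_sum n k a m []" by (simp add: alt_sum_def sum_negf)
  finally show ?thesis by simp
qed

lemma alt_sum_Nil_permutes:
  assumes m: "m permutes {..<n}"
  shows "alt_sum n k a m [] = sign m * vandermonde n a"
proof -
  have "vandermonde n a = (\<Sum>\<sigma> | \<sigma> permutes {..<n}. sign (\<sigma> \<circ> Hilbert_Choice.inv m) * (\<Prod>j<n. a ((\<sigma> \<circ> Hilbert_Choice.inv m) j) ^ j))"
    unfolding vandermonde_def by (rule sum_permutations_compose_right[OF permutes_inv[OF m]])
  also have "\<dots> = (\<Sum>\<sigma> | \<sigma> permutes {..<n}. sign m * (sign \<sigma> * (\<Prod>j<n. a (\<sigma> j) ^ m j)))"
  proof (rule sum.cong[OF refl])
    fix \<sigma> assume "\<sigma> \<in> {\<sigma>. \<sigma> permutes {..<n}}"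
    then have "permutation \<sigma>" using permutes_imp_permutation by blast
    moreover have pm: "permutation m" using m permutes_imp_permutation by blast
    ultimately have "sign (\<sigma> \<circ> Hilbert_Choice.inv m) = sign m * sign \<sigma>"
      by (simp add: sign_compose permutation_inverse sign_inverse)
    moreover have "(\<Prod>j<n. a ((\<sigma> \<circ> Hilbert_Choice.inv m) j) ^ j) = (\<Prod>j<n. a (\<sigma> j) ^ m j)"
      using prod.permute[OF m, of "\<lambda>j. a (\<sigma> (Hilbert_Choice.inv m j)) ^ j"] permutes_inverses(2)[OF m]
      by (simp add: comp_def)
    ultimately show "sign (\<sigma> \<circ> Hilbert_Choice.inv m) * (\<Prod>j<n. a ((\<sigma> \<circ> Hilbert_Choice.inv m) j) ^ j)
        = sign m * (sign \<sigma> * (\<Prod>j<n. a (\<sigma> j) ^ m j))" by simp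
  qed
  also have "\<dots> = sign m * alt_sum n k a m []" by (simp add: alt_sum_def sum_distrib_left)
  finally show ?thesis by (simp add: mult.assoc[symmetric])
qed

text \<open>This pins down the surviving exponents: if \<open>n\<close> distinct exponents have a
  total of at most \<open>0 + ... + (n - 1)\<close>, they are a rearrangement of these
  numbers.\<close>

lemma sum_nat_set_ge:
  fixes A :: "nat set"
  assumes "finite A"
  shows "\<Sum>{..<card A} \<le> \<Sum>A \<and> (\<Sum>A \<le> \<Sum>{..<card A} \<longrightarrow> A = {..<card A})"
  using assms
proof (induction "card A" arbitrary: A)
  case 0
  then show ?case by simp
next
  case (Suc c)
  define x where "x = Max A"
  have A: "x \<in> A" "finite A" using Suc by (auto simp: x_def intro!: Max_in)
  have "A \<subseteq> {..x}" using A by (auto simp: x_def)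
  then have "card A \<le> Suc x" using card_mono[of "{..x}" A] by simp
  then have cx: "c \<le> x" using Suc by simp
  have c: "card (A - {x}) = c" using A Suc by simp
  have s: "\<Sum>A = x + \<Sum>(A - {x})" using A by (simp add: sum.remove)
  have IH: "\<Sum>{..<c} \<le> \<Sum>(A - {x})" "\<Sum>(A - {x}) \<le> \<Sum>{..<c} \<Longrightarrow> A - {x} = {..<c}"
    using Suc(1)[OF c[symmetric] finite_Diff[OF A(2)]] unfolding c by blast+
  have t: "\<Sum>{..<card A} = c + \<Sum>{..<c}" unfolding Suc(2)[symmetric] by simp
  show ?case
  proof (intro conjI impI)
    show "\<Sum>{..<card A} \<le> \<Sum>A" using s t IH cx by simp
  next
    assume "\<Sum>A \<le> \<Sum>{..<card A}"
    then have "x = c" "A - {x} = {..<c}" using s t IH cx by auto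
    then have "A = insert c {..<c}" using A by auto
    then show "A = {..<card A}" unfolding Suc(2)[symmetric] lessThan_Suc .
  qed
qed

text \<open>The order of the quantifiers is the point: \<open>K\<close> depends neither on
  \<open>a\<close> nor on \<open>es\<close>, so it can be studied at one convenient point and used
  at another. After full expansion only monomials with distinct exponents survive, and within the
  degree bound their exponents are those of the Vandermonde determinant.\<close>

lemma alt_sum_eq_const_mult_vandermonde:
  assumes "k \<le> n"
  shows "\<exists>K. \<forall>a es m. length es = r \<and> (\<Sum>j<n. m j) + r \<le> \<Sum>{..<n} \<longrightarrow>
    alt_sum n k a m es = (if (\<Sum>j<n. m j) + r = \<Sum>{..<n} then K m else 0) * vandermonde n a"
proof (induction r)
  case 0
  define K where "K = (\<lambda>m. let m' = (\<lambda>j. if j < n then m j else j) in if m' permutes {..<n} then sign m' else 0)"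
  have "alt_sum n k a m [] = (if (\<Sum>j<n. m j) = \<Sum>{..<n} then K m else 0) * vandermonde n a"
    if le: "(\<Sum>j<n. m j) \<le> \<Sum>{..<n}" for a and m :: "nat \<Rightarrow> nat"
  proof -
    define m' where "m' = (\<lambda>j. if j < n then m j else j)"
    have Pm: "alt_sum n k a m [] = alt_sum n k a m' []" by (simp add: alt_sum_def m'_def)
    show ?thesis
    proof (cases "inj_on m {..<n}")
      case True
      have s: "(\<Sum>j<n. m j) = \<Sum>(m ` {..<n})" using True by (simp add: sum.reindex)
      have c: "card (m ` {..<n}) = n" using True by (simp add: card_image)
      have img: "m ` {..<n} = {..<n}"
        using sum_nat_set_ge[of "m ` {..<n}"] s c le by auto
      have "bij_betw m' {..<n} {..<n}"
        using True img by (simp add: bij_betw_def m'_def inj_on_def image_def)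
      then have perm: "m' permutes {..<n}"
        by (intro bij_imp_permutes) (auto simp: m'_def)
      have "(\<Sum>j<n. m j) = \<Sum>{..<n}" using s img by simp
      moreover have "K m = sign m'" using perm by (simp add: K_def m'_def Let_def)
      ultimately show ?thesis using alt_sum_Nil_permutes[OF perm] Pm by simp
    next
      case False
      then obtain i j where ij: "i < n" "j < n" "i \<noteq> j" "m i = m j" by (auto simp: inj_on_def)
      then have "m' i = m' j" by (simp add: m'_def)
      then have "\<not> m' permutes {..<n}" using ij(3) permutes_inj[of m' "{..<n}"] injD by metis
      moreover have "alt_sum n k a m [] = 0" using ij by (rule alt_sum_Nil_repeated)
      ultimately show ?thesis by (simp add: K_def m'_def Let_def)
    qed
  qed
  then show ?case by (intro exI[of _ K]) auto
next
  case (Suc r)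
  then obtain K where K: "\<And>a es m. length es = r \<Longrightarrow> (\<Sum>j<n. m j) + r \<le> \<Sum>{..<n} \<Longrightarrow>
    alt_sum n k a m es = (if (\<Sum>j<n. m j) + r = \<Sum>{..<n} then K m else 0) * vandermonde n a" by blast
  have "alt_sum n k a m (e # es) = (if (\<Sum>j<n. m j) + Suc r = \<Sum>{..<n}
      then \<Sum>j<k. K (m(j := Suc (m j))) else 0) * vandermonde n a"
    if len: "length es = r" and le: "(\<Sum>j<n. m j) + Suc r \<le> \<Sum>{..<n}" for a e es m
  proof -
    have inc: "(\<Sum>i<n. (m(j := Suc (m j))) i) = Suc (\<Sum>i<n. m i)" if "j < k" for j
    proof -
      have j: "j \<in> {..<n}" using that assms by simp
      have "(\<Sum>i\<in>{..<n} - {j}. (m(j := Suc (m j))) i) = (\<Sum>i\<in>{..<n} - {j}. m i)"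
        by (intro sum.cong) auto
      then show ?thesis using j by (simp add: sum.remove[OF _ j])
    qed
    have "alt_sum n k a m es = 0" using K[OF len, of m a] le by simp
    moreover have "alt_sum n k a (m(j := Suc (m j))) es = (if (\<Sum>j<n. m j) + Suc r = \<Sum>{..<n}
      then K (m(j := Suc (m j))) else 0) * vandermonde n a" if "j < k" for j
      using K[OF len, of "m(j := Suc (m j))" a] le inc[OF that] by (simp only:) simp
    ultimately show ?thesis
      by (simp add: alt_sum_Cons[OF assms] sum_distrib_right)
  qed
  then have "\<forall>a es m. length es = Suc r \<and> (\<Sum>j<n. m j) + Suc r \<le> \<Sum>{..<n} \<longrightarrow>
    alt_sum n k a m es = (if (\<Sum>j<n. m j) + Suc r = \<Sum>{..<n}
      then \<Sum>j<k. K (m(j := Suc (m j))) else 0) * vandermonde n a"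
    by (auto simp: length_Suc_conv)
  then show ?case by (rule exI[of _ "\<lambda>m. \<Sum>j<k. K (m(j := Suc (m j)))"])
qed

section \<open>Vandermonde determinants modulo a prime\<close>

lemma vandermonde_det: "vandermonde n a = det (mat n n (\<lambda>(i, j). a i ^ j))"
proof -
  have "(\<Prod>j<n. mat n n (\<lambda>(i, j). a i ^ j) $$ (\<sigma> j, j)) = (\<Prod>j<n. a (\<sigma> j) ^ j)"
    if "\<sigma> permutes {..<n}" for \<sigma>
    using permutes_in_image[OF that] by (intro prod.cong) auto
  then show ?thesis
    unfolding vandermonde_def by (subst det_col[of _ n]) (auto simp: atLeast0LessThan intro: sum.cong)
qed

text \<open>The factor kills all permutations except those preserving \<open>{..<k}\<close>, so the
  sum becomes the determinant of a block diagonal matrix with two Vandermonde blocks.\<close>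

lemma alt_sum_block:
  assumes k: "k \<le> n"
    and es: "\<And>\<sigma>. \<sigma> permutes {..<n} \<Longrightarrow>
      (\<Prod>e\<leftarrow>es. (\<Sum>j<k. a (\<sigma> j)) - e) = (if \<sigma> ` {..<k} = {..<k} then c else 0)"
  shows "alt_sum n k a (\<lambda>j. if j < k then j else j - k) es
    = c * (vandermonde k a * vandermonde (n - k) (\<lambda>i. a (i + k)))"
proof -
  define M where "M = mat n n (\<lambda>(i, j). if i < k \<and> j < k then a i ^ j
    else if k \<le> i \<and> k \<le> j then a i ^ (j - k) else 0)"
  have M: "M = four_block_mat (mat k k (\<lambda>(i, j). a i ^ j)) (0\<^sub>m k (n - k)) (0\<^sub>m (n - k) k)
      (mat (n - k) (n - k) (\<lambda>(i, j). a (i + k) ^ j))"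
    using k by (intro eq_matI) (auto simp: M_def)
  have detM: "det M = vandermonde k a * vandermonde (n - k) (\<lambda>i. a (i + k))"
    unfolding M vandermonde_det by (rule det_four_block_mat_upper_right_zero) auto
  have "det M = (\<Sum>\<sigma> | \<sigma> permutes {..<n}. sign \<sigma> * (\<Prod>j<n. M $$ (\<sigma> j, j)))"
    by (subst det_col[of _ n]) (auto simp: M_def atLeast0LessThan)
  then have "c * det M = (\<Sum>\<sigma> | \<sigma> permutes {..<n}. c * (sign \<sigma> * (\<Prod>j<n. M $$ (\<sigma> j, j))))"
    by (simp add: sum_distrib_left)
  also have "\<dots> = alt_sum n k a (\<lambda>j. if j < k then j else j - k) es"
    unfolding alt_sum_def
  proof (rule sum.cong[OF refl])
    fix \<sigma> assume "\<sigma> \<in> {\<sigma>. \<sigma> permutes {..<n}}"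
    then have \<sigma>: "\<sigma> permutes {..<n}" by simp
    have in_n: "\<sigma> j < n" if "j < n" for j using permutes_in_image[OF \<sigma>, of j] that by simp
    show "c * (sign \<sigma> * (\<Prod>j<n. M $$ (\<sigma> j, j))) = sign \<sigma> * ((\<Prod>e\<leftarrow>es. (\<Sum>j<k. a (\<sigma> j)) - e) *
        (\<Prod>j<n. a (\<sigma> j) ^ (if j < k then j else j - k)))"
    proof (cases "\<sigma> ` {..<k} = {..<k}")
      case True
      have iff: "\<sigma> j < k \<longleftrightarrow> j < k" for j
      proof
        assume "\<sigma> j < k"
        then have "\<sigma> j \<in> \<sigma> ` {..<k}" using True by auto
        then show "j < k" using permutes_inj[OF \<sigma>] by (auto simp: inj_def)
      qed (use True in auto)
      have "M $$ (\<sigma> j, j) = a (\<sigma> j) ^ (if j < k then j else j - k)" if "j < n" for j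
        using that in_n[OF that] iff[of j] by (auto simp: M_def)
      then have "(\<Prod>j<n. M $$ (\<sigma> j, j)) = (\<Prod>j<n. a (\<sigma> j) ^ (if j < k then j else j - k))"
        by (intro prod.cong) auto
      then show ?thesis using es[OF \<sigma>] True by simp
    next
      case False
      have "\<exists>j<k. k \<le> \<sigma> j"
      proof (rule ccontr)
        assume "\<not> ?thesis"
        then have "\<sigma> ` {..<k} \<subseteq> {..<k}" by auto
        moreover have "inj_on \<sigma> {..<k}" using permutes_inj[OF \<sigma>] by (auto simp: inj_def inj_on_def)
        ultimately show False using False endo_inj_surj[of "{..<k}" \<sigma>] by auto
      qed
      then obtain j where j: "j < k" "k \<le> \<sigma> j" by blast
      then have "M $$ (\<sigma> j, j) = 0" using in_n[of j] k by (simp add: M_def)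
      then have z: "(\<Prod>j<n. M $$ (\<sigma> j, j)) = 0" using j k by (intro prod_zero) auto
      have "(\<Prod>e\<leftarrow>es. (\<Sum>j<k. a (\<sigma> j)) - e) = 0" using es[OF \<sigma>] False by presburger
      then show ?thesis unfolding z by (simp only: mult_zero_left mult_zero_right)
    qed
  qed
  finally show ?thesis using detM by simp
qed

lemma sum_block_exponents:
  fixes n k :: nat
  assumes "k \<le> n"
  shows "(\<Sum>j<n. if j < k then j else j - k) + k * (n - k) = \<Sum>{..<n}"
proof -
  have "{..<n} = {..<k} \<union> {k..<n}" using assms by auto
  then have "(\<Sum>j<n. f j) = (\<Sum>j<k. f j) + (\<Sum>j=k..<n. f j)" for f :: "nat \<Rightarrow> nat"
    by (simp add: sum.union_disjoint ivl_disj_int)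
  moreover have "(\<Sum>j=k..<n. j) = (\<Sum>j=k..<n. j - k) + (\<Sum>j=k..<n. k)"
    unfolding sum.distrib[symmetric] by (intro sum.cong) auto
  ultimately show ?thesis by (simp add: mult.commute)
qed

text \<open>Induction without the product formula: for \<open>k = 1\<close> and \<open>es\<close>
  listing all values but \<open>a 0\<close>, an integer multiple of the larger determinant equals
  the product of the differences \<open>a 0 - a (Suc i)\<close> times the smaller determinant. As
  \<open>P\<close> does not divide the right side, it does not divide the larger determinant; the
  multiplier need not be computed.\<close>

lemma vandermonde_not_dvd:
  assumes "prime P" and inj: "\<And>i j. i < n \<Longrightarrow> j < n \<Longrightarrow> P dvd a i - a j \<Longrightarrow> i = j"
  shows "\<not> P dvd vandermonde n (a :: nat \<Rightarrow> int)"
  using inj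
proof (induction n arbitrary: a)
  case 0
  have "{\<sigma>. \<sigma> permutes ({} :: nat set)} = {id}" by auto
  then show ?case using assms(1) by (auto simp: vandermonde_def sign_id dest: prime_gt_1_int)
next
  case (Suc n)
  define es where "es = map (\<lambda>i. a (Suc i)) [0..<n]"
  have prod_es: "(\<Prod>e\<leftarrow>es. x - e) = (\<Prod>i<n. x - a (Suc i))" for x
    by (simp add: es_def comp_def prod.distinct_set_conv_list[symmetric] atLeast0LessThan)
  define m where "m = (\<lambda>j :: nat. if j < 1 then j else j - 1)"
  have len: "length es = n" "(\<Sum>j<Suc n. m j) + n = \<Sum>{..<Suc n}"
    using sum_block_exponents[of 1 "Suc n"] by (auto simp: es_def m_def)
  obtain K where KK: "\<forall>a es m. length es = n \<and> (\<Sum>j<Suc n. m j) + n \<le> \<Sum>{..<Suc n} \<longrightarrow>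
    alt_sum (Suc n) 1 a m es = (if (\<Sum>j<Suc n. m j) + n = \<Sum>{..<Suc n} then K m else 0) * vandermonde (Suc n) a"
    using alt_sum_eq_const_mult_vandermonde[of 1 "Suc n" n] by auto
  have K: "alt_sum (Suc n) 1 a m es = K m * vandermonde (Suc n) a"
    using KK[rule_format, OF conjI[OF len(1) eq_imp_le[OF len(2)]], of a] len(2)
    by (simp only: simp_thms if_True)
  have "alt_sum (Suc n) 1 a m es
      = (\<Prod>i<n. a 0 - a (Suc i)) * (vandermonde 1 a * vandermonde (Suc n - 1) (\<lambda>i. a (i + 1)))"
    unfolding m_def
  proof (rule alt_sum_block[where es = es and a = a and c = "\<Prod>i<n. a 0 - a (Suc i)"])
    fix \<sigma> :: "nat \<Rightarrow> nat" assume \<sigma>: "\<sigma> permutes {..<Suc n}"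
    have "\<sigma> 0 \<in> {..<Suc n}" by (subst permutes_in_image[OF \<sigma>]) simp
    then have "\<sigma> 0 < Suc n" by blast
    show "(\<Prod>e\<leftarrow>es. (\<Sum>j<1. a (\<sigma> j)) - e)
        = (if \<sigma> ` {..<1} = {..<1} then (\<Prod>i<n. a 0 - a (Suc i)) else 0)"
    proof (cases "\<sigma> 0")
      case 0
      then show ?thesis by (simp add: prod_es lessThan_Suc)
    next
      case (Suc i)
      then have "i \<in> {..<n}" using \<open>\<sigma> 0 < Suc n\<close> by simp
      then have "(\<Prod>i<n. a (\<sigma> 0) - a (Suc i)) = 0" using Suc by (intro prod_zero) auto
      then show ?thesis using Suc by (simp add: prod_es lessThan_Suc)
    qed
  qed simp
  moreover have "\<not> P dvd vandermonde n (\<lambda>i. a (i + 1))"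
    by (rule Suc.IH) (use Suc.prems[of "Suc _" "Suc _"] in auto)
  moreover have "\<not> P dvd (\<Prod>i<n. a 0 - a (Suc i))"
    using Suc.prems[of 0 "Suc _"] by (simp add: prime_dvd_prod_iff assms(1)) fastforce
  moreover have "vandermonde 1 a = 1"
  proof -
    have "{\<sigma>. \<sigma> permutes {..<Suc 0}} = {id}"
      by (auto simp: lessThan_Suc permutes_sing)
    then show ?thesis by (simp add: vandermonde_def sign_id)
  qed
  ultimately have "\<not> P dvd K m * vandermonde (Suc n) a"
    unfolding K using assms(1) by (simp add: prime_dvd_mult_iff)
  then show ?case by (meson dvd_mult)
qed

section \<open>Sums of k-element subsets modulo p\<close>

definition k_sums :: "('a \<Rightarrow> int) \<Rightarrow> nat \<Rightarrow> 'a set \<Rightarrow> int set" where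
  "k_sums x k X = sum x ` {I. I \<subseteq> X \<and> card I = k}"

context prime_modulus
begin

definition inj_mod :: "('a \<Rightarrow> int) \<Rightarrow> 'a set \<Rightarrow> bool" where
  "inj_mod x X \<longleftrightarrow> (\<forall>u\<in>X. \<forall>v\<in>X. int p dvd x u - x v \<longrightarrow> u = v)"

lemma inj_mod_subset: "inj_mod x X \<Longrightarrow> Y \<subseteq> X \<Longrightarrow> inj_mod x Y"
  by (auto simp: inj_mod_def)

lemma inj_mod_card:
  assumes "finite X" "inj_mod x X"
  shows "card_mod (x ` X) = card X" "card X \<le> p"
proof -
  have "inj_on (\<lambda>u. x u mod int p) X"
    using assms by (auto simp: inj_on_def inj_mod_def mod_eq_iff_dvd)
  then show "card_mod (x ` X) = card X" by (simp add: card_mod_def image_image card_image)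
  then show "card X \<le> p" using card_mod_le by metis
qed

text \<open>The test point is \<open>a i = - i\<close>, where the \<open>k\<close>-sums lie among
  \<open>N + 1\<close> consecutive integers, \<open>N = k * (n - k)\<close>. The largest of them is
  attained only by \<open>{..<k}\<close>; letting \<open>es\<close> list the others leaves
  \<open>fact N\<close> times two Vandermonde determinants, which is prime to \<open>p\<close>
  because \<open>N < p\<close> and \<open>n \<le> p\<close>.\<close>

lemma alt_sum_const_not_dvd:
  assumes k: "k \<le> n" and np: "n \<le> p" and lt: "k * (n - k) < p"
    and K: "\<And>a es. length es = k * (n - k) \<Longrightarrow>
      alt_sum n k a (\<lambda>j. if j < k then j else j - k) es = K * vandermonde n a"
  shows "\<not> int p dvd K"
proof -
  define N where "N = k * (n - k)"
  define a where "a = (\<lambda>i :: nat. - int i)"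
  define top where "top = - int (\<Sum>{..<k})"
  define es where "es = map (\<lambda>i. top - 1 - int i) [0..<N]"
  have tot: "\<Sum>{..<k} + \<Sum>{..<n - k} + N = \<Sum>{..<n}"
  proof -
    have "(\<Sum>j<n. f j) = (\<Sum>j<k. f j) + (\<Sum>j=k..<n. f j)" for f :: "nat \<Rightarrow> nat"
      using k by (metis atLeast0LessThan le0 sum.atLeastLessThan_concat)
    moreover have "(\<Sum>j=k..<n. j - k) = \<Sum>{..<n - k}"
      using sum.shift_bounds_nat_ivl[of "\<lambda>j. j - k" 0 k "n - k"] k by (simp add: atLeast0LessThan)
    ultimately show ?thesis using sum_block_exponents[OF k] by (simp add: N_def)
  qed
  have "alt_sum n k a (\<lambda>j. if j < k then j else j - k) es
      = fact N * (vandermonde k a * vandermonde (n - k) (\<lambda>i. a (i + k)))"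
  proof (rule alt_sum_block[where es = es and a = a and c = "fact N"])
    fix \<sigma> :: "nat \<Rightarrow> nat" assume \<sigma>: "\<sigma> permutes {..<n}"
    have inj: "inj_on \<sigma> A" for A using permutes_inj[OF \<sigma>] by (auto simp: inj_def inj_on_def)
    define U where "U = \<Sum>(\<sigma> ` {..<k})"
    have s: "(\<Sum>j<k. a (\<sigma> j)) = - int U"
      by (simp add: a_def U_def sum.reindex inj sum_negf)
    have c: "card (\<sigma> ` {..<k}) = k" "card (\<sigma> ` {k..<n}) = n - k" by (simp_all add: card_image inj)
    have lo: "\<Sum>{..<k} \<le> U" "U \<le> \<Sum>{..<k} \<Longrightarrow> \<sigma> ` {..<k} = {..<k}"
      using sum_nat_set_ge[of "\<sigma> ` {..<k}"] by (auto simp: c U_def)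
    have "{..<n} = \<sigma> ` {..<k} \<union> \<sigma> ` {k..<n}"
      using permutes_image[OF \<sigma>] k by (metis image_Un ivl_disj_un_one(2))
    moreover have "\<sigma> ` {..<k} \<inter> \<sigma> ` {k..<n} = {}"
      by (auto dest!: injD[OF permutes_inj[OF \<sigma>]])
    ultimately have "\<Sum>{..<n} = U + \<Sum>(\<sigma> ` {k..<n})"
      unfolding U_def by (metis finite_atLeastLessThan finite_imageI finite_lessThan sum.union_disjoint)
    moreover have "\<Sum>{..<n - k} \<le> \<Sum>(\<sigma> ` {k..<n})"
      using sum_nat_set_ge[of "\<sigma> ` {k..<n}"] by (simp add: c)
    ultimately have hi: "U \<le> \<Sum>{..<k} + N" using tot by simp
    have prod_es: "(\<Prod>e\<leftarrow>es. y - e) = (\<Prod>i<N. y - (top - 1 - int i))" for y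
      by (simp add: es_def comp_def prod.distinct_set_conv_list[symmetric] atLeast0LessThan)
    show "(\<Prod>e\<leftarrow>es. (\<Sum>j<k. a (\<sigma> j)) - e) = (if \<sigma> ` {..<k} = {..<k} then fact N else 0)"
    proof (cases "\<sigma> ` {..<k} = {..<k}")
      case True
      then have "(\<Sum>j<k. a (\<sigma> j)) = top" unfolding s by (simp add: U_def top_def)
      then have "(\<Prod>e\<leftarrow>es. (\<Sum>j<k. a (\<sigma> j)) - e) = (\<Prod>i<N. 1 + int i)"
        by (simp only: prod_es) (intro prod.cong, auto)
      also have "\<dots> = fact N"
        by (simp add: fact_prod_Suc atLeast0LessThan)
      finally show ?thesis using True by simp
    next
      case False
      then have "U > \<Sum>{..<k}" using lo by force
      then obtain i where i: "U = Suc (\<Sum>{..<k} + i)" using less_iff_Suc_add by auto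
      then have "i \<in> {..<N}" using hi by simp
      moreover have "- int U - (top - 1 - int i) = 0" by (simp add: top_def i)
      ultimately have "(\<Prod>i<N. - int U - (top - 1 - int i)) = 0"
        by (intro prod_zero) auto
      then show ?thesis using False by (simp only: s prod_es if_False)
    qed
  qed (rule k)
  moreover have "alt_sum n k a (\<lambda>j. if j < k then j else j - k) es = K * vandermonde n a"
    by (rule K) (simp add: es_def N_def)
  moreover have "\<not> int p dvd fact N"
    using lt prime_p prime_dvd_fact_iff[of p N] int_dvd_int_iff[of p "fact N"]
    by (simp add: N_def)
  moreover have dist: "i = j" if "i < p" "j < p" "int p dvd a i - a j" for i j
    using that residue_eqI[of "int j" "int i"] by (auto simp: a_def)
  have "\<not> int p dvd vandermonde k a"
    by (rule vandermonde_not_dvd[OF prime_int_p]) (use dist k np in simp)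
  moreover have "\<not> int p dvd vandermonde (n - k) (\<lambda>i. a (i + k))"
    by (rule vandermonde_not_dvd[OF prime_int_p]) (use dist[of "_ + k" "_ + k"] k np in auto)
  ultimately show ?thesis
    using prime_int_p by (metis dvd_mult2 prime_dvd_mult_iff)
qed

text \<open>If there were at most \<open>k * (n - k)\<close> sums, \<open>alt_sum\<close> evaluated at the list of these sums would
  vanish modulo \<open>p\<close>.\<close>

theorem dias_da_silva_hamidoune:
  assumes fin: "finite X" and inj: "inj_mod x X"
    and k: "k \<le> card X" and lt: "k * (card X - k) < p"
  shows "k * (card X - k) + 1 \<le> card_mod (k_sums x k X)"
proof (rule ccontr)
  define n where "n = card X"
  define N where "N = k * (n - k)"
  assume "\<not> ?thesis"
  then have small: "card_mod (k_sums x k X) \<le> N" by (simp add: N_def n_def)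
  obtain h where h: "bij_betw h {..<n} X"
    using ex_bij_betw_nat_finite[OF fin] by (auto simp: n_def atLeast0LessThan)
  define R where "R = (\<lambda>y. y mod int p) ` k_sums x k X"
  have R: "finite R" "card R \<le> N"
    using small finite_residues by (simp_all add: R_def card_mod_def)
  \<comment> \<open>There may be fewer than \<open>N\<close> residues; padding with arbitrary
    factors brings the polynomial to exactly the degree in which \<open>K\<close> is known to be
    nonzero modulo \<open>p\<close>.\<close>
  define es where "es = sorted_list_of_set R @ replicate (N - card R) 0"
  have len: "length es = k * (n - k)" using R by (simp add: es_def N_def)
  have np: "n \<le> p" using inj_mod_card[OF fin inj] by (simp add: n_def)
  have kn: "k \<le> n" using k by (simp add: n_def)
  define m where "m = (\<lambda>j :: nat. if j < k then j else j - k)"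
  have sm: "(\<Sum>j<n. m j) + k * (n - k) = \<Sum>{..<n}"
    unfolding m_def by (rule sum_block_exponents[OF kn])
  obtain K where K: "\<forall>a es m. length es = k * (n - k) \<and> (\<Sum>j<n. m j) + k * (n - k) \<le> \<Sum>{..<n} \<longrightarrow>
    alt_sum n k a m es = (if (\<Sum>j<n. m j) + k * (n - k) = \<Sum>{..<n} then K m else 0) * vandermonde n a"
    using alt_sum_eq_const_mult_vandermonde[OF kn, of "k * (n - k)"] by blast
  have K': "alt_sum n k a m es = K m * vandermonde n a" if "length es = k * (n - k)" for a es
    using K[rule_format, OF conjI[OF that eq_imp_le[OF sm]], of a] sm by (simp only: simp_thms if_True)
  have "\<not> int p dvd K m"
    by (rule alt_sum_const_not_dvd[OF kn np]) (use lt K' in \<open>simp_all add: n_def m_def\<close>)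
  moreover have "\<not> int p dvd vandermonde n (x \<circ> h)"
  proof (rule vandermonde_not_dvd[OF prime_int_p])
    fix i j assume ij: "i < n" "j < n" "int p dvd (x \<circ> h) i - (x \<circ> h) j"
    then have "h i = h j" using inj bij_betwE[OF h] by (auto simp: inj_mod_def)
    then show "i = j" using h ij by (auto simp: bij_betw_def inj_on_def)
  qed
  moreover have "int p dvd alt_sum n k (x \<circ> h) m es"
    unfolding alt_sum_def
  proof (rule dvd_sum)
    fix \<sigma> assume "\<sigma> \<in> {\<sigma>. \<sigma> permutes {..<n}}"
    then have \<sigma>: "\<sigma> permutes {..<n}" by simp
    have "\<sigma> ` {..<k} \<subseteq> {..<n}" using permutes_image[OF \<sigma>] kn by (metis image_mono lessThan_subset_iff)
    moreover have "inj_on \<sigma> {..<k}" using permutes_inj[OF \<sigma>] by (auto simp: inj_def inj_on_def)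
    ultimately have inj2: "inj_on (h \<circ> \<sigma>) {..<k}" and sub: "(h \<circ> \<sigma>) ` {..<k} \<subseteq> X"
      using h by (auto simp: bij_betw_def intro!: comp_inj_on intro: inj_on_subset)
    define s where "s = (\<Sum>j<k. (x \<circ> h) (\<sigma> j))"
    have "s = sum x ((h \<circ> \<sigma>) ` {..<k})" 
      using sum.reindex[OF inj2, of x] by (simp add: s_def comp_def)
    moreover have "card ((h \<circ> \<sigma>) ` {..<k}) = k" using card_image[OF inj2] by simp
    ultimately have "s \<in> k_sums x k X" using sub by (auto simp: k_sums_def)
    then have "s mod int p \<in> set es" using R by (auto simp: es_def R_def)
    then have "s - s mod int p \<in> set (map (\<lambda>e. s - e) es)" by auto
    then have "s - s mod int p dvd (\<Prod>e\<leftarrow>es. s - e)" by (rule prod_list_dvd)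
    moreover have "int p dvd s - s mod int p" by simp
    ultimately have "int p dvd (\<Prod>e\<leftarrow>es. s - e)" using dvd_trans by blast
    then show "int p dvd sign \<sigma> * ((\<Prod>e\<leftarrow>es. (\<Sum>j<k. (x \<circ> h) (\<sigma> j)) - e)
        * (\<Prod>j<n. (x \<circ> h) (\<sigma> j) ^ m j))"
      unfolding s_def by (intro dvd_mult dvd_mult2)
  qed
  ultimately show False
    using K'[OF len, of "x \<circ> h"] prime_int_p by (metis prime_dvd_mult_iff)
qed

end

section \<open>Subset sums and rows\<close>

definition subset_sums :: "('a \<Rightarrow> int) \<Rightarrow> 'a set \<Rightarrow> int set" where
  "subset_sums c T = sum c ` Pow T"

lemma subset_sums_Un:
  assumes "finite A" "finite B" "A \<inter> B = {}"
  shows "subset_sums c (A \<union> B) = subset_sums c A + subset_sums c B"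
proof
  show "subset_sums c (A \<union> B) \<subseteq> subset_sums c A + subset_sums c B"
  proof
    fix y assume "y \<in> subset_sums c (A \<union> B)"
    then obtain Z where Z: "Z \<subseteq> A \<union> B" "y = sum c Z" by (auto simp: subset_sums_def)
    have "Z = (Z \<inter> A) \<union> (Z \<inter> B)" using Z by auto
    then have "y = sum c (Z \<inter> A) + sum c (Z \<inter> B)"
      using Z(2) assms by (metis finite_Int inf_bot_right inf_left_commute inf_sup_aci(1) sum.union_disjoint inf_assoc)
    then show "y \<in> subset_sums c A + subset_sums c B" by (auto simp: subset_sums_def)
  qed
  show "subset_sums c A + subset_sums c B \<subseteq> subset_sums c (A \<union> B)"
  proof
    fix y assume "y \<in> subset_sums c A + subset_sums c B"
    then obtain U V where UV: "U \<subseteq> A" "V \<subseteq> B" "y = sum c U + sum c V"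
      by (auto simp: subset_sums_def set_plus_def)
    then have "y = sum c (U \<union> V)"
      using assms by (subst sum.union_disjoint) (auto dest: finite_subset)
    then show "y \<in> subset_sums c (A \<union> B)" using UV by (auto simp: subset_sums_def)
  qed
qed

lemma k_sums_plus_subset:
  assumes "finite A" "finite B" "A \<inter> B = {}"
  shows "k_sums x k A + k_sums x l B \<subseteq> k_sums x (k + l) (A \<union> B)"
proof
  fix y assume "y \<in> k_sums x k A + k_sums x l B"
  then obtain U V where UV: "U \<subseteq> A" "V \<subseteq> B" "y = sum x U + sum x V" "card U = k" "card V = l"
    by (auto simp: k_sums_def set_plus_def)
  then have "finite U" "finite V" "U \<inter> V = {}" using assms by (auto dest: finite_subset)
  then have "y = sum x (U \<union> V)" "card (U \<union> V) = k + l"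
    using UV by (simp_all add: sum.union_disjoint card_Un_disjoint)
  then show "y \<in> k_sums x (k + l) (A \<union> B)" using UV by (auto simp: k_sums_def)
qed

lemma k_sums_nonempty:
  assumes "finite A" "k \<le> card A"
  shows "k_sums x k A \<noteq> {}"
  using obtain_subset_with_card_n[OF assms(2)] by (force simp: k_sums_def)

lemma k_sums_mono: "A \<subseteq> B \<Longrightarrow> k_sums x k A \<subseteq> k_sums x k B"
  by (auto simp: k_sums_def)

lemma k_sums_compl:
  assumes "finite A" "k \<le> card A"
  shows "k_sums x (card A - k) A = (\<lambda>y. sum x A - y) ` k_sums x k A"
proof -
  have sub: "(\<lambda>y. sum x A - y) ` k_sums x k A \<subseteq> k_sums x (card A - k) A" for k
  proof
    fix z assume "z \<in> (\<lambda>y. sum x A - y) ` k_sums x k A"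
    then obtain I where I: "I \<subseteq> A" "card I = k" "z = sum x A - sum x I" by (auto simp: k_sums_def)
    then have "z = sum x (A - I)" "card (A - I) = card A - k"
      using assms finite_subset[OF I(1)] by (simp_all add: sum_diff card_Diff_subset)
    then show "z \<in> k_sums x (card A - k) A" by (auto simp: k_sums_def)
  qed
  show ?thesis
  proof
    show "k_sums x (card A - k) A \<subseteq> (\<lambda>y. sum x A - y) ` k_sums x k A"
    proof
      fix z assume z: "z \<in> k_sums x (card A - k) A"
      have "sum x A - z \<in> (\<lambda>y. sum x A - y) ` k_sums x (card A - k) A" using z by blast
      with sub[of "card A - k"] have "sum x A - z \<in> k_sums x k A" using assms by auto
      then show "z \<in> (\<lambda>y. sum x A - y) ` k_sums x k A" by (force simp: image_iff)
    qed
  qed (rule sub)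
qed

section \<open>Lower bounds for the number of subset sums and k-sums\<close>

context prime_modulus
begin

lemma card_mod_subset_sums_Un:
  assumes "finite A" "finite B" "A \<inter> B = {}"
  shows "min p (card_mod (subset_sums c A) + card_mod (subset_sums c B) - 1) \<le> card_mod (subset_sums c (A \<union> B))"
  unfolding subset_sums_Un[OF assms] by (rule cauchy_davenport) (auto simp: subset_sums_def)

lemma card_mod_subset_sums_pos: "0 < card_mod (subset_sums c A)"
  by (rule card_mod_pos) (auto simp: subset_sums_def)

lemma card_mod_subset_sums_singleton:
  assumes "\<not> int p dvd c s"
  shows "2 \<le> card_mod (subset_sums c {s})"
proof -
  have "card {0, c s} \<le> card_mod (subset_sums c {s})"
    by (rule card_mod_ge_card) (use assms in \<open>auto simp: subset_sums_def Pow_insert\<close>)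
  moreover have "c s \<noteq> 0" using assms by auto
  ultimately show ?thesis by simp
qed

lemma card_mod_subset_sums_pair:
  assumes "\<not> int p dvd c s" "\<not> int p dvd c t" "\<not> int p dvd c s - c t" "\<not> int p dvd c s + c t"
  shows "4 \<le> card_mod (subset_sums c {s, t})"
proof -
  have st: "s \<noteq> t" using assms by auto
  have "card {0, c s, c t, c s + c t} \<le> card_mod (subset_sums c {s, t})"
  proof (rule card_mod_ge_card)
    show "{0, c s, c t, c s + c t} \<subseteq> subset_sums c {s, t}"
      using st by (auto simp: subset_sums_def Pow_insert)
    fix x y assume "x \<in> {0, c s, c t, c s + c t}" "y \<in> {0, c s, c t, c s + c t}" "int p dvd x - y"
    moreover have "int p dvd c t - c s \<longleftrightarrow> int p dvd c s - c t" by (rule dvd_diff_commute)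
    moreover have "int p dvd - c s - c t \<longleftrightarrow> int p dvd c s + c t"
      using dvd_minus_iff[of "int p" "c s + c t"] by (simp add: algebra_simps)
    ultimately show "x = y" using assms by auto
  qed simp
  moreover have "c s \<noteq> 0" "c t \<noteq> 0" "c s \<noteq> c t" "c s + c t \<noteq> 0" using assms by auto
  then have "card {0, c s, c t, c s + c t} = 4" by auto
  ultimately show ?thesis by simp
qed

lemma card_mod_subset_sums_ge:
  assumes "finite T" "\<And>s. s \<in> T \<Longrightarrow> \<not> int p dvd c s"
  shows "min p (card T + 1) \<le> card_mod (subset_sums c T)"
  using assms
proof (induction T rule: finite_induct)
  case empty
  then show ?case using card_mod_subset_sums_pos[of c "{}"] by simp
next
  case (insert s T)
  have "min p (card_mod (subset_sums c {s}) + card_mod (subset_sums c T) - 1) \<le> card_mod (subset_sums c ({s} \<union> T))"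
    by (rule card_mod_subset_sums_Un) (use insert in auto)
  moreover have "2 \<le> card_mod (subset_sums c {s})" by (rule card_mod_subset_sums_singleton) (use insert in auto)
  ultimately show ?case using insert by auto
qed

text \<open>Two elements which do not agree up to sign contribute three new sums instead of two, so
  either there are \<open>t\<close> disjoint such pairs or almost all elements agree up to sign.\<close>

lemma card_mod_subset_sums_pairs:
  assumes "finite T" "\<And>s. s \<in> T \<Longrightarrow> \<not> int p dvd c s"
  shows "min p (card T + t + 1) \<le> card_mod (subset_sums c T) \<or>
    (\<exists>a. \<not> int p dvd a \<and> card {s \<in> T. \<not> int p dvd c s - a \<and> \<not> int p dvd c s + a} \<le> 2 * t)"
  using assms
proof (induction t arbitrary: T)
  case 0
  then show ?case using card_mod_subset_sums_ge[of T c] by simp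
next
  case (Suc t)
  let ?B = "\<lambda>T a. {s \<in> T. \<not> int p dvd c s - a \<and> \<not> int p dvd c s + a}"
  show ?case
  proof (cases "\<exists>s\<in>T. \<exists>u\<in>T. \<not> int p dvd c s - c u \<and> \<not> int p dvd c s + c u")
    case True
    then obtain s u where su: "s \<in> T" "u \<in> T" "\<not> int p dvd c s - c u" "\<not> int p dvd c s + c u"
      by blast
    then have "s \<noteq> u" by auto
    define T' where "T' = T - {s, u}"
    have T': "T = {s, u} \<union> T'" "{s, u} \<inter> T' = {}" "finite T'"
      using su Suc.prems by (auto simp: T'_def)
    have card_T: "card T = card T' + 2"
      using T' \<open>s \<noteq> u\<close> by (simp add: card_Un_disjoint)
    consider "min p (card T' + t + 1) \<le> card_mod (subset_sums c T')"
      | a where "\<not> int p dvd a" "card (?B T' a) \<le> 2 * t"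
      using Suc.IH[of T'] T' Suc.prems by auto
    then show ?thesis
    proof cases
      case 1
      have "min p (card_mod (subset_sums c {s, u}) + card_mod (subset_sums c T') - 1) \<le> card_mod (subset_sums c T)"
        unfolding T'(1) by (rule card_mod_subset_sums_Un) (use T' in auto)
      moreover have "4 \<le> card_mod (subset_sums c {s, u})" by (rule card_mod_subset_sums_pair) (use su Suc.prems in auto)
      ultimately have "min p (card T + Suc t + 1) \<le> card_mod (subset_sums c T)" using 1 card_T by linarith
      then show ?thesis ..
    next
      case 2
      have "?B T a \<subseteq> {s, u} \<union> ?B T' a" using T' by auto
      then have "card (?B T a) \<le> card ({s, u} \<union> ?B T' a)" by (rule card_mono[rotated]) (use T' in auto)
      also have "\<dots> \<le> card {s, u} + card (?B T' a)" by (rule card_Un_le)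
      finally have "card (?B T a) \<le> 2 * Suc t" using 2 \<open>s \<noteq> u\<close> by simp
      then show ?thesis using 2 by blast
    qed
  next
    case False
    show ?thesis
    proof (cases "T = {}")
      case True
      then show ?thesis using p_gt_1 by (intro disjI2 exI[of _ 1]) auto
    next
      case nonempty: False
      then obtain u where u: "u \<in> T" by auto
      have "?B T (c u) = {}" using False u by blast
      then have "card (?B T (c u)) \<le> 2 * Suc t" by (metis card.empty zero_le)
      then show ?thesis using u Suc.prems by blast
    qed
  qed
qed

text \<open>Keeping \<open>k - l\<close> elements outside \<open>X'\<close> fixed and varying the
  other \<open>l\<close> inside \<open>X'\<close> gives a translate of the sums of
  \<open>X'\<close>.\<close>

lemma card_mod_k_sums_subset:
  assumes "finite X" "X' \<subseteq> X" "l \<le> k" "k - l \<le> card X - card X'"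
  shows "card_mod (k_sums x l X') \<le> card_mod (k_sums x k X)"
proof -
  have "k - l \<le> card (X - X')"
    using assms by (simp add: card_Diff_subset finite_subset)
  then obtain J where J: "J \<subseteq> X - X'" "card J = k - l"
    by (meson obtain_subset_with_card_n)
  have "(\<lambda>y. y + sum x J) ` k_sums x l X' \<subseteq> k_sums x l X' + k_sums x (k - l) J"
    using J by (auto simp: k_sums_def)
  also have "\<dots> \<subseteq> k_sums x (l + (k - l)) (X' \<union> J)"
    by (rule k_sums_plus_subset) (use assms J in \<open>auto dest: finite_subset\<close>)
  also have "\<dots> \<subseteq> k_sums x k X" using assms J by (simp, intro k_sums_mono, auto)
  finally have "card_mod ((\<lambda>y. y + sum x J) ` k_sums x l X') \<le> card_mod (k_sums x k X)" by (rule card_mod_mono)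
  then show ?thesis by (simp add: card_mod_shift)
qed

lemma card_mod_k_sums_compl:
  assumes "finite X" "k \<le> card X"
  shows "card_mod (k_sums x (card X - k) X) = card_mod (k_sums x k X)"
  unfolding k_sums_compl[OF assms] by (rule card_mod_neg)

text \<open>The elements of \<open>S\<close> are abstract points with two coordinate functions, so
  that a change of linear forms replaces \<open>c\<close> and \<open>x\<close> and leaves
  \<open>S\<close> alone.\<close>

definition zero_sum_free :: "('a \<Rightarrow> int) \<Rightarrow> ('a \<Rightarrow> int) \<Rightarrow> 'a set \<Rightarrow> bool" where
  "zero_sum_free c x S \<longleftrightarrow>
    (\<forall>Z\<subseteq>S. Z \<noteq> {} \<longrightarrow> int p dvd sum c Z \<longrightarrow> \<not> int p dvd sum x Z)"

text \<open>In row \<open>v\<close> the \<open>x\<close>-sums of \<open>k\<close> elements are numerous for all \<open>k\<close> between \<open>\<beta> v\<close> and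
  \<open>\<beta> v + f v\<close>; this freedom is spent to make the \<open>c\<close>-sum vanish, after which the rows together
  reach every \<open>x\<close>-sum.\<close>

lemma zero_sum_from_rows:
  fixes c x :: "'a \<Rightarrow> int"
  assumes fin: "finite S"
    and rows: "\<And>v k. v \<in> c ` S \<Longrightarrow> \<beta> v \<le> k \<Longrightarrow> k \<le> \<beta> v + f v \<Longrightarrow>
      min p (g v + 1) \<le> card_mod (k_sums x k {s \<in> S. c s = v})"
    and gain: "p - 1 \<le> (\<Sum>v\<in>c ` S. g v)"
    and T: "T \<subseteq> S" "\<And>v. card {s \<in> T. c s = v} \<le> f v"
    and full: "p \<le> card_mod (subset_sums c T)"
  shows "\<not> zero_sum_free c x S"
proof -
  define row where "row = (\<lambda>v. {s \<in> S. c s = v})"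
  have finT: "finite T" using T fin finite_subset by blast
  obtain y where y: "y \<in> subset_sums c T" "int p dvd y - (- (\<Sum>v\<in>c ` S. int (\<beta> v) * v))"
    by (rule card_mod_full[OF full])
  then obtain T' where T': "T' \<subseteq> T" "y = sum c T'" by (auto simp: subset_sums_def)
  \<comment> \<open>Only the number of elements of \<open>T'\<close> in each row is kept. Elements
    of one row can be exchanged without affecting the \<open>c\<close>-sum, and they will be
    selected anew by their \<open>x\<close>-sums.\<close>
  define k where "k = (\<lambda>v. \<beta> v + card {s \<in> T'. c s = v})"
  have finT': "finite T'" using T' finT finite_subset by blast
  have k: "\<beta> v \<le> k v" "k v \<le> \<beta> v + f v" for v
  proof -
    have "card {s \<in> T'. c s = v} \<le> card {s \<in> T. c s = v}"
      by (rule card_mono) (use T' finT in auto)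
    then show "\<beta> v \<le> k v" "k v \<le> \<beta> v + f v" using T(2)[of v] by (simp_all add: k_def)
  qed
  have ksum: "int p dvd (\<Sum>v\<in>c ` S. int (k v) * v)"
  proof -
    have "sum c T' = (\<Sum>v\<in>c ` S. \<Sum>s\<in>{s \<in> T'. c s = v}. c s)"
      by (rule sum.group[symmetric]) (use finT' fin T' T in auto)
    also have "\<dots> = (\<Sum>v\<in>c ` S. int (card {s \<in> T'. c s = v}) * v)"
      by (rule sum.cong) simp_all
    finally have "(\<Sum>v\<in>c ` S. int (k v) * v) = y - (- (\<Sum>v\<in>c ` S. int (\<beta> v) * v))"
      using T'(2) by (simp add: k_def algebra_simps sum.distrib)
    then show ?thesis using y(2) by simp
  qed
  define F where "F = (\<lambda>v. k_sums x (k v) (row v))"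
  have Fcm: "min p (g v + 1) \<le> card_mod (F v)" if "v \<in> c ` S" for v
    using rows[OF that k] by (simp add: F_def row_def)
  have Fne: "F v \<noteq> {}" if "v \<in> c ` S" for v
    using Fcm[OF that] p_gt_1 by (auto simp: card_mod_def)
  have "p \<le> card_mod (sum F (c ` S))"
  proof -
    have "min p (1 + (\<Sum>v\<in>c ` S. card_mod (F v) - 1)) \<le> card_mod (sum F (c ` S))"
      by (rule cauchy_davenport_sum) (use fin Fne in auto)
    moreover have "p - 1 \<le> (\<Sum>v\<in>c ` S. card_mod (F v) - 1)"
    \<comment> \<open>The row bounds are truncated at \<open>p\<close>: either one row is already
      full, or no truncation takes place.\<close>
    proof (cases "\<exists>v\<in>c ` S. p - 1 \<le> card_mod (F v) - 1")
      case True
      then obtain v where v: "v \<in> c ` S" "p - 1 \<le> card_mod (F v) - 1" by blast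
      moreover have "card_mod (F v) - 1 \<le> (\<Sum>v\<in>c ` S. card_mod (F v) - 1)"
        by (rule member_le_sum) (use fin v in auto)
      ultimately show ?thesis by simp
    next
      case False
      have "g v \<le> card_mod (F v) - 1" if "v \<in> c ` S" for v
        using Fcm[OF that] False that by fastforce
      then have "(\<Sum>v\<in>c ` S. g v) \<le> (\<Sum>v\<in>c ` S. card_mod (F v) - 1)" by (rule sum_mono)
      then show ?thesis using gain by simp
    qed
    ultimately show ?thesis by simp
  qed
  then obtain z where "z \<in> sum F (c ` S)" "int p dvd z - 0" by (rule card_mod_full)
  then obtain u where u: "\<forall>v\<in>c ` S. u v \<in> F v" "int p dvd (\<Sum>v\<in>c ` S. u v)"
    using fin by (auto simp: set_sum_alt)
  have "\<forall>v\<in>c ` S. \<exists>I. I \<subseteq> row v \<and> card I = k v \<and> u v = sum x I"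
    using u(1) by (auto simp: F_def k_sums_def)
  then obtain I where I': "\<forall>v\<in>c ` S. I v \<subseteq> row v \<and> card (I v) = k v \<and> u v = sum x (I v)"
    by metis
  then have I: "I v \<subseteq> row v" "card (I v) = k v" "u v = sum x (I v)" if "v \<in> c ` S" for v
    using that by blast+
  define Z where "Z = (\<Union>v\<in>c ` S. I v)"
  have ZS: "Z \<subseteq> S" using I(1) by (force simp: Z_def row_def)
  have finI: "finite (I v)" if "v \<in> c ` S" for v
    using I(1)[OF that] fin finite_subset[of "I v" S] by (auto simp: row_def)
  have disj: "I v \<inter> I w = {}" if "v \<in> c ` S" "w \<in> c ` S" "v \<noteq> w" for v w
    using I(1)[OF that(1)] I(1)[OF that(2)] that(3) by (auto simp: row_def)
  have union: "sum h Z = (\<Sum>v\<in>c ` S. sum h (I v))" for h :: "'a \<Rightarrow> int"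
    unfolding Z_def by (rule sum.UNION_disjoint) (use fin finI disj in blast)+
  have "sum x Z = (\<Sum>v\<in>c ` S. u v)" unfolding union by (rule sum.cong) (simp_all only: I)
  moreover have "sum c Z = (\<Sum>v\<in>c ` S. int (k v) * v)"
    unfolding union
  proof (rule sum.cong)
    fix v assume v: "v \<in> c ` S"
    have "sum c (I v) = (\<Sum>s\<in>I v. v)"
      by (rule sum.cong) (use I(1)[OF v] in \<open>auto simp: row_def\<close>)
    then show "sum c (I v) = int (k v) * v" using I(2)[OF v] by simp
  qed simp
  moreover have "Z \<noteq> {}"
  proof
    assume "Z = {}"
    have empty: "k v = 0" if "v \<in> c ` S" for v
    proof -
      have "I v = {}" using that \<open>Z = {}\<close> unfolding Z_def by blast
      then show ?thesis using I(2)[OF that] by simp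
    qed
    \<comment> \<open>With \<open>k v = 0\<close> the row offers only the empty sum, so it has no
      gain, whereas the total gain is at least \<open>p - 1\<close>.\<close>
    have "g v = 0" if v: "v \<in> c ` S" for v
    proof -
      have "k_sums x 0 (row v) \<subseteq> {0}"
      proof
        fix y assume "y \<in> k_sums x 0 (row v)"
        then obtain J where J: "J \<subseteq> S" "card J = 0" "y = sum x J" by (auto simp: k_sums_def row_def)
        then show "y \<in> {0}" using finite_subset[OF J(1) fin] by simp
      qed
      then have "card_mod (F v) \<le> 1" using card_mod_mono[of _ "{0}"] by (fastforce simp: F_def empty[OF v] card_mod_def)
      then show ?thesis using Fcm[OF v] p_gt_1 by auto
    qed
    then show False using gain p_gt_1 by simp
  qed
  ultimately show ?thesis using ZS ksum u(2) unfolding zero_sum_free_def by metis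
qed

end

section \<open>A large row\<close>

context prime_modulus
begin

text \<open>Two disjoint blocks of \<open>20 + q\<close> elements, \<open>q\<close> about
  \<open>p / 40\<close>, each have at least \<open>20 * q + 1\<close> sums of \<open>20\<close>
  elements, and as many of \<open>q\<close> elements; together they reach all residues. The rest of
  the row brings the number of summands up to \<open>k\<close>. The combinations
  \<open>20 + 20\<close>, \<open>20 + q\<close> and \<open>q + q\<close> cover the whole range of
  \<open>k\<close> because the row has at least \<open>3 * q + 20\<close> elements.\<close>

lemma card_mod_k_sums_full_middle:
  assumes p: "6000 < p" and X: "finite X" "inj_mod x X" and big: "p \<le> 11 * card X"
    and k: "40 \<le> k" "k + 40 \<le> card X"
  shows "p \<le> card_mod (k_sums x k X)"
proof -
  define n where "n = card X"
  define q where "q = (p + 39) div 40"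
  have q: "p \<le> 40 * q" "40 * q \<le> p + 39" unfolding q_def by linarith+
  have n: "3 * q + 20 \<le> n" using q big p unfolding n_def by linarith
  have "20 + q \<le> card X" using n n_def by simp
  then obtain X1 where X1: "X1 \<subseteq> X" "card X1 = 20 + q" by (meson obtain_subset_with_card_n)
  then have finX1: "finite X1" using X finite_subset by blast
  have "20 + q \<le> card (X - X1)" using X1 finX1 n q p by (simp add: card_Diff_subset n_def)
  then obtain X2 where X2: "X2 \<subseteq> X - X1" "card X2 = 20 + q" by (meson obtain_subset_with_card_n)
  then have finX2: "finite X2" using X finite_subset by blast
  have half: "20 * q + 1 \<le> card_mod (k_sums x l Y)"
    if "Y \<subseteq> X" "card Y = 20 + q" "l = 20 \<or> l = q" for l Y
  proof -
    have "l * (card Y - l) = 20 * q" using that by auto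
    moreover have "l \<le> card Y" using that by auto
    moreover have "20 * q < p" using q p by linarith
    ultimately show ?thesis
      using dias_da_silva_hamidoune[of Y x l] that X finite_subset inj_mod_subset by metis
  qed
  have both: "p \<le> card_mod (k_sums x (l1 + l2) (X1 \<union> X2))"
    if l: "l1 = 20 \<or> l1 = q" "l2 = 20 \<or> l2 = q" for l1 l2
  proof -
    have "min p (card_mod (k_sums x l1 X1) + card_mod (k_sums x l2 X2) - 1) \<le> card_mod (k_sums x l1 X1 + k_sums x l2 X2)"
      by (rule cauchy_davenport; rule k_sums_nonempty) (use l X1 X2 finX1 finX2 in auto)
    also have "\<dots> \<le> card_mod (k_sums x (l1 + l2) (X1 \<union> X2))"
      by (rule card_mod_mono, rule k_sums_plus_subset) (use finX1 finX2 X2 in auto)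
    finally have "min p (card_mod (k_sums x l1 X1) + card_mod (k_sums x l2 X2) - 1) \<le> \<dots>" .
    moreover have "20 * q + 1 \<le> card_mod (k_sums x l1 X1)" using half[OF X1(1,2) l(1)] .
    moreover have "20 * q + 1 \<le> card_mod (k_sums x l2 X2)" using half[of X2 l2] X2 l by blast
    ultimately show ?thesis using q by linarith
  qed
  have cU: "card (X1 \<union> X2) = 40 + 2 * q"
    using X1 X2 finX1 finX2 by (subst card_Un_disjoint) auto
  have via: ?thesis if "l1 = 20 \<or> l1 = q" "l2 = 20 \<or> l2 = q" "l1 + l2 \<le> k"
    "k + (40 + 2 * q) \<le> n + (l1 + l2)" for l1 l2
  proof -
    have "card_mod (k_sums x (l1 + l2) (X1 \<union> X2)) \<le> card_mod (k_sums x k X)"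
      by (rule card_mod_k_sums_subset) (use X X1 X2 cU that in \<open>auto simp: n_def\<close>)
    then show ?thesis using both[OF that(1,2)] by simp
  qed
  consider "k + 2 * q \<le> n" | "n < k + 2 * q" "k < 2 * q" | "2 * q \<le> k" by linarith
  then show ?thesis
  proof cases
    case 1
    then show ?thesis using via[of 20 20] k by simp
  next
    case 2
    then show ?thesis using via[of 20 q] k n by simp
  next
    case 3
    then show ?thesis using via[of q q] k by (simp add: n_def)
  qed
qed

text \<open>For \<open>n = (p + 3) / 2\<close> elements the Dias da Silva--Hamidoune bound with
  \<open>k = 2\<close> is exactly \<open>2 * (n - 2) + 1 = p\<close>. Further fixed elements give
  the other small \<open>k\<close>, and complements the large ones.\<close>

lemma card_mod_k_sums_full:
  assumes p: "6000 < p" and X: "finite X" "inj_mod x X" and big: "p \<le> card X + 300"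
    and k: "2 \<le> k" "k + 2 \<le> card X"
  shows "p \<le> card_mod (k_sums x k X)"
proof (cases "40 \<le> k \<and> k + 40 \<le> card X")
  case True
  then show ?thesis using card_mod_k_sums_full_middle[OF p X] big p by simp
next
  case False
  define n where "n = (p + 3) div 2"
  have "odd p" using prime_p p prime_odd_nat by simp
  then have n: "2 * n = p + 3" unfolding n_def by simp
  obtain X' where X': "X' \<subseteq> X" "card X' = n"
    using obtain_subset_with_card_n[of n X] n big p by auto
  have fX': "finite X'" using X' X finite_subset by blast
  have "2 * (card X' - 2) + 1 \<le> card_mod (k_sums x 2 X')"
    by (rule dias_da_silva_hamidoune) (use X' fX' X n p inj_mod_subset in auto)
  then have two: "p \<le> card_mod (k_sums x 2 X')" using X' n by simp
  show ?thesis
  proof (cases "k < 40")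
    case True
    have "card_mod (k_sums x 2 X') \<le> card_mod (k_sums x k X)"
      by (rule card_mod_k_sums_subset) (use X X' True k n big p in auto)
    then show ?thesis using two by simp
  next
    case k40: False
    have "card_mod (k_sums x 2 X') \<le> card_mod (k_sums x (card X - k) X)"
      by (rule card_mod_k_sums_subset) (use X X' False k40 k n big p in auto)
    then show ?thesis using two card_mod_k_sums_compl[of X k x] X k by simp
  qed
qed

lemma residues_meet:
  assumes "finite X" "finite Y" "inj_mod x X" "inj_mod y Y" "p < card X + card Y"
  obtains u v where "u \<in> X" "v \<in> Y" "int p dvd x u - y v"
proof -
  define A where "A = (\<lambda>u. x u mod int p) ` X"
  define B where "B = (\<lambda>v. y v mod int p) ` Y"
  have "card A = card X" "card B = card Y"
    using inj_mod_card[OF assms(1,3)] inj_mod_card[OF assms(2,4)]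
    by (simp_all add: card_mod_def image_image A_def B_def)
  moreover have "A \<union> B \<subseteq> {0..<int p}" using p_pos by (auto simp: A_def B_def)
  then have "card (A \<union> B) \<le> p" using card_mono[of "{0..<int p}"] by force
  ultimately have "A \<inter> B \<noteq> {}"
    using assms card_Un_disjoint[of A B] by (auto simp: A_def B_def)
  then show ?thesis using that mod_eq_iff_dvd by (fastforce simp: A_def B_def)
qed

section \<open>Zero-sum free sets with a long row\<close>

lemma zero_sum_freeD:
  assumes "zero_sum_free c x S" "Z \<subseteq> S" "Z \<noteq> {}" "int p dvd sum c Z" "int p dvd sum x Z"
  shows False
  using assms by (auto simp: zero_sum_free_def)

text \<open>Contrapositive of \<open>zero_sum_from_rows\<close> with all the gain coming from a single row, at the
  price of \<open>2 * b\<close> of its elements.\<close>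

lemma zero_sum_free_majority:
  assumes fin: "finite S" and range: "\<And>s. s \<in> S \<Longrightarrow> c s \<in> {0..<int p}"
    and zsf: "zero_sum_free c x S"
    and v: "v \<noteq> 0" and b: "0 < b" "2 * b \<le> card {s \<in> S. c s = v}"
    and row: "\<And>k. b \<le> k \<Longrightarrow> k + b \<le> card {s \<in> S. c s = v} \<Longrightarrow>
      p \<le> card_mod (k_sums x k {s \<in> S. c s = v})"
    and many: "p \<le> card {s \<in> S. c s \<noteq> 0}"
  obtains U a where "U \<subseteq> {s \<in> S. c s = v}" "card U = 2 * b" "\<not> int p dvd a"
    "card {s \<in> S - U. c s \<noteq> 0 \<and> \<not> int p dvd c s - a \<and> \<not> int p dvd c s + a} \<le> 2 * (2 * b - 1)"
proof -
  define R where "R = (\<lambda>w. {s \<in> S. c s = w})"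
  have finR: "finite (R w)" for w using fin by (simp add: R_def)
  obtain U where U: "U \<subseteq> R v" "card U = 2 * b"
    using obtain_subset_with_card_n[OF b(2)] R_def by metis
  have finU: "finite U" using U finR finite_subset by blast
  define T where "T = {s \<in> S. c s \<noteq> 0} - U"
  have finT: "finite T" using fin by (simp add: T_def)
  have Tnd: "\<not> int p dvd c s" if "s \<in> T" for s
    using that range[of s] zdvd_not_zless[of "c s" "int p"] by (auto simp: T_def)
  have cT: "p \<le> card T + 2 * b"
  proof -
    have "U \<subseteq> {s \<in> S. c s \<noteq> 0}" using U v by (auto simp: R_def)
    then have "card T = card {s \<in> S. c s \<noteq> 0} - 2 * b"
      using finU U by (simp add: T_def card_Diff_subset)
    then show ?thesis using many by simp
  qed
  have notfull: "\<not> p \<le> card_mod (subset_sums c T)"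
  proof
    assume full: "p \<le> card_mod (subset_sums c T)"
    have "\<not> zero_sum_free c x S"
    \<comment> \<open>Row \<open>v\<close> alone supplies the gain \<open>p - 1\<close>, and leaving
      out \<open>U\<close> pays for the \<open>b\<close> elements kept at either end of its range.
      All other rows have gain \<open>0\<close> and may be used in any number.\<close>
    proof (rule zero_sum_from_rows[OF fin, where T = T
          and \<beta> = "\<lambda>w. if w = v then b else 0"
          and f = "\<lambda>w. card (R w) - (if w = v then 2 * b else 0)"
          and g = "\<lambda>w. if w = v then p - 1 else 0"])
      fix w k
      assume k: "(if w = v then b else 0) \<le> k"
        "k \<le> (if w = v then b else 0) + (card (R w) - (if w = v then 2 * b else 0))"
      show "min p ((if w = v then p - 1 else 0) + 1) \<le> card_mod (k_sums x k {s \<in> S. c s = w})"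
      proof (cases "w = v")
        case True
        then show ?thesis using row[of k] k b by (simp add: R_def)
      next
        case False
        then have "k_sums x k (R w) \<noteq> {}" using k finR by (intro k_sums_nonempty) auto
        then show ?thesis using False card_mod_pos[of "k_sums x k (R w)"] by (simp add: R_def)
      qed
    next
      have "{s \<in> S. c s = v} \<noteq> {}" using b by (metis card.empty le_zero_eq mult_is_0 not_gr0 zero_neq_numeral)
      then have "v \<in> c ` S" by auto
      then show "p - 1 \<le> (\<Sum>w\<in>c ` S. if w = v then p - 1 else 0)" using fin by simp
    next
      fix w
      show "card {s \<in> T. c s = w} \<le> card (R w) - (if w = v then 2 * b else 0)"
      proof (cases "w = v")
        case True
        have "card {s \<in> T. c s = v} \<le> card (R v - U)"
          by (rule card_mono) (auto simp: T_def R_def fin)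
        then show ?thesis using True U finU by (simp add: card_Diff_subset)
      next
        case False
        have "card {s \<in> T. c s = w} \<le> card (R w)"
          by (rule card_mono) (auto simp: T_def R_def fin)
        then show ?thesis using False by simp
      qed
    qed (use full in \<open>auto simp: T_def\<close>)
    then show False using zsf by simp
  qed
  \<comment> \<open>\<open>T\<close> has at least \<open>p - 2 * b\<close> elements, so
    \<open>2 * b - 1\<close> extra sums from disjoint pairs would make its subset sums full.\<close>
  have "min p (card T + (2 * b - 1) + 1) = p" using cT b by simp
  then have "p \<le> card_mod (subset_sums c T) \<or> (\<exists>a. \<not> int p dvd a \<and>
      card {s \<in> T. \<not> int p dvd c s - a \<and> \<not> int p dvd c s + a} \<le> 2 * (2 * b - 1))"
    using card_mod_subset_sums_pairs[where T = T and c = c and t = "2 * b - 1"] finT Tnd by presburger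
  then obtain a where a: "\<not> int p dvd a"
    "card {s \<in> T. \<not> int p dvd c s - a \<and> \<not> int p dvd c s + a} \<le> 2 * (2 * b - 1)"
    using notfull by blast
  have "{s \<in> T. \<not> int p dvd c s - a \<and> \<not> int p dvd c s + a}
      = {s \<in> S - U. c s \<noteq> 0 \<and> \<not> int p dvd c s - a \<and> \<not> int p dvd c s + a}"
    by (auto simp: T_def)
  then show ?thesis using that U a by (simp add: R_def)
qed


text \<open>Adding any \<open>k\<close> elements of row \<open>1\<close> to \<open>Y\<close> makes
  the \<open>c\<close>-sum divisible by \<open>p\<close>; if their \<open>x\<close>-sums took every
  value, one choice would cancel the \<open>x\<close>-sum of \<open>Y\<close>.\<close>

lemma zero_sum_free_row_sums:
  assumes fin: "finite S" and zsf: "zero_sum_free c x S"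
    and Y: "Y \<subseteq> S" "\<And>s. s \<in> Y \<Longrightarrow> c s \<noteq> 1" and k: "0 < k" "int p dvd sum c Y + int k"
  shows "card_mod (k_sums x k {s \<in> S. c s = 1}) < p"
proof (rule ccontr)
  assume "\<not> ?thesis"
  then have "p \<le> card_mod (k_sums x k {s \<in> S. c s = 1})" by simp
  then obtain y where y: "y \<in> k_sums x k {s \<in> S. c s = 1}" "int p dvd y - (- sum x Y)"
    by (rule card_mod_full)
  then obtain I where I: "I \<subseteq> {s \<in> S. c s = 1}" "card I = k" "y = sum x I"
    by (auto simp: k_sums_def)
  have fI: "finite I" "finite Y" using I Y fin by (auto dest: finite_subset)
  have disj: "I \<inter> Y = {}" using I Y(2) by auto
  have "sum c I = (\<Sum>s\<in>I. 1)" by (rule sum.cong) (use I in auto)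
  then have "int p dvd sum c (I \<union> Y)" using k I fI disj by (simp add: sum.union_disjoint add.commute)
  moreover have "int p dvd sum x (I \<union> Y)" using y I fI disj by (simp add: sum.union_disjoint)
  moreover have "I \<union> Y \<noteq> {}" "I \<union> Y \<subseteq> S" using I Y k by auto
  ultimately show False using zero_sum_freeD[OF zsf] by blast
qed

lemma sum_all_residues:
  assumes "odd p" "finite X" "inj_mod x X" "card X = p"
  shows "int p dvd sum x X"
proof -
  have inj: "inj_on (\<lambda>u. x u mod int p) X"
    using assms by (auto simp: inj_on_def inj_mod_def mod_eq_iff_dvd)
  have "(\<lambda>u. x u mod int p) ` X \<subseteq> {0..<int p}" using p_pos by auto
  moreover have "card ((\<lambda>u. x u mod int p) ` X) = card {0..<int p}"
    using inj assms by (simp add: card_image)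
  ultimately have "(\<lambda>u. x u mod int p) ` X = {0..<int p}"
    by (intro card_subset_eq) auto
  then have "(\<Sum>u\<in>X. x u mod int p) = \<Sum>{0..<int p}"
    using sum.reindex[OF inj, of "\<lambda>y. y"] by simp
  also have "\<dots> = (\<Sum>i<p. int i)"
    by (rule sum.reindex_bij_witness[of _ int nat]) auto
  also have "2 * \<dots> = int p * (int p - 1)"
    by (induction p) (simp_all add: algebra_simps)
  finally have "int p dvd 2 * (\<Sum>u\<in>X. x u mod int p)" by simp
  moreover have "coprime (int p) 2" using assms(1) by (simp add: coprime_right_2_iff_odd)
  ultimately have "int p dvd (\<Sum>u\<in>X. x u mod int p)" by (simp add: coprime_dvd_mult_right_iff)
  then show ?thesis by (simp add: dvd_eq_mod_eq_0 mod_sum_eq)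
qed

text \<open>The number 238 is \<open>80 + 2 * 79\<close>, the cost of
  \<open>zero_sum_free_majority\<close> for \<open>b = 40\<close>. Once row \<open>1\<close> is
  known to miss at most 277 residues, its \<open>k\<close>-sums are full for all \<open>k\<close>
  from \<open>2\<close> to \<open>n1 - 2\<close>, so the same lemma applies with
  \<open>b = 2\<close> and leaves at most six exceptions. The rest depends on the number
  \<open>d\<close> of residues missing from row \<open>1\<close>.\<close>

lemma zero_sum_free_endgame:
  assumes p: "6000 < p"
    and fin: "finite S" and range: "\<And>s. s \<in> S \<Longrightarrow> c s \<in> {0..<int p}"
    and inj: "\<And>v. inj_mod x {s \<in> S. c s = v}"
    and zsf: "zero_sum_free c x S"
    and many: "p \<le> card {s \<in> S. c s \<noteq> 0}" and cS: "p + 10 \<le> card S"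
    and few: "card {s \<in> S. c s \<notin> {0, 1, int p - 1}} \<le> 238"
    and le: "card {s \<in> S. c s = int p - 1} \<le> card {s \<in> S. c s = 1}"
  shows False
proof -
  define R where "R = (\<lambda>w. {s \<in> S. c s = w})"
  define W where "W = {s \<in> S. c s \<notin> {0, 1, int p - 1}}"
  have finR: "finite (R w)" for w using fin by (simp add: R_def)
  have finW: "finite W" using fin by (simp add: W_def)
  have injR: "inj_mod x (R w)" for w using inj by (simp add: R_def)
  define n1 where "n1 = card (R 1)"
  have odd: "odd p" using prime_p p prime_odd_nat by simp
  have nz: "{s \<in> S. c s \<noteq> 0} = R 1 \<union> R (int p - 1) \<union> W" using p by (auto simp: R_def W_def)
  have "card (R 1 \<union> R (int p - 1)) = n1 + card (R (int p - 1))"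
    unfolding n1_def by (rule card_Un_disjoint) (use finR p in \<open>auto simp: R_def\<close>)
  moreover have "card (R 1 \<union> R (int p - 1) \<union> W) = card (R 1 \<union> R (int p - 1)) + card W"
    by (rule card_Un_disjoint) (use finR finW p in \<open>auto simp: R_def W_def\<close>)
  ultimately have cnz: "card {s \<in> S. c s \<noteq> 0} = n1 + card (R (int p - 1)) + card W"
    unfolding nz by simp
  have "card S = card ({s \<in> S. c s \<noteq> 0} \<union> R 0)"
    by (rule arg_cong[of _ _ card]) (auto simp: R_def)
  also have "\<dots> = card {s \<in> S. c s \<noteq> 0} + card (R 0)"
    by (rule card_Un_disjoint) (use fin in \<open>auto simp: R_def\<close>)
  finally have cS': "card S = n1 + card (R (int p - 1)) + card W + card (R 0)" using cnz by simp
  have n1p: "n1 \<le> p" using inj_mod_card(2)[OF finR injR] by (simp add: n1_def)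
  have row: "card_mod (k_sums x k (R 1)) < p"
    if "Y \<subseteq> S" "\<And>s. s \<in> Y \<Longrightarrow> c s \<noteq> 1" "0 < k" "int p dvd sum c Y + int k" for Y k
    unfolding R_def using zero_sum_free_row_sums[OF fin zsf that] .

  \<comment> \<open>Forty elements of row \<open>-1\<close> would be balanced in \<open>c\<close> by
    any forty of row \<open>1\<close>, whose \<open>x\<close>-sums take every value.\<close>
  have "card (R (int p - 1)) < 40"
  proof (rule ccontr)
    assume "\<not> ?thesis"
    then obtain Y where Y: "Y \<subseteq> R (int p - 1)" "card Y = 40"
      by (metis not_less obtain_subset_with_card_n)
    have "sum c Y = (\<Sum>s\<in>Y. int p - 1)" by (rule sum.cong) (use Y in \<open>auto simp: R_def\<close>)
    then have "int p dvd sum c Y + int 40" using Y by simp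
    then have "card_mod (k_sums x 40 (R 1)) < p"
      by (intro row[of Y]) (use Y p in \<open>auto simp: R_def\<close>)
    moreover have "p \<le> card_mod (k_sums x 40 (R 1))"
      by (rule card_mod_k_sums_full_middle[OF p finR injR])
        (use many few le cnz p in \<open>simp_all add: n1_def R_def W_def\<close>)
    ultimately show False by simp
  qed
  then have big: "p \<le> n1 + 277" using many few cnz by (simp add: W_def)
  have full: "p \<le> card_mod (k_sums x k (R 1))" if "2 \<le> k" "k + 2 \<le> n1" for k
    by (rule card_mod_k_sums_full[OF p finR injR]) (use that big in \<open>auto simp: n1_def\<close>)

  have nm: "card (R (int p - 1)) \<le> 1"
  proof (rule ccontr)
    assume "\<not> ?thesis"
    then obtain Y where Y: "Y \<subseteq> R (int p - 1)" "card Y = 2"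
      by (metis Suc_1 not_less_eq_eq obtain_subset_with_card_n)
    have "sum c Y = (\<Sum>s\<in>Y. int p - 1)" by (rule sum.cong) (use Y in \<open>auto simp: R_def\<close>)
    then have "int p dvd sum c Y + int 2" using Y by simp
    then have "card_mod (k_sums x 2 (R 1)) < p"
      by (intro row[of Y]) (use Y p in \<open>auto simp: R_def\<close>)
    then show False using full[of 2] big p by simp
  qed

  have cW: "card W \<le> 6"
  proof -
    obtain U a where U: "U \<subseteq> {s \<in> S. c s = 1}" "card U = 2 * 2" "\<not> int p dvd a"
      "card {s \<in> S - U. c s \<noteq> 0 \<and> \<not> int p dvd c s - a \<and> \<not> int p dvd c s + a} \<le> 2 * (2 * 2 - 1)"
      by (rule zero_sum_free_majority[OF fin range zsf, of 1 2])
        (use big p full many in \<open>auto simp: R_def n1_def\<close>)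
    have finU: "finite U" using U fin finite_subset[of U S] by auto
    have a1: "int p dvd 1 - a \<or> int p dvd 1 + a"
    proof (rule ccontr)
      assume a: "\<not> ?thesis"
      have "card (R 1 - U) \<le> card {s \<in> S - U. c s \<noteq> 0 \<and> \<not> int p dvd c s - a \<and> \<not> int p dvd c s + a}"
        by (rule card_mono) (use fin a in \<open>auto simp: R_def\<close>)
      moreover have "card (R 1 - U) = n1 - 4"
        using finU U by (simp add: n1_def R_def card_Diff_subset)
      ultimately show False using U(4) big p by simp
    qed
    have "W \<subseteq> {s \<in> S - U. c s \<noteq> 0 \<and> \<not> int p dvd c s - a \<and> \<not> int p dvd c s + a}"
    proof
      fix s assume s: "s \<in> W"
      then have sr: "c s \<in> {0..<int p}" "c s \<noteq> 1" "c s \<noteq> int p - 1" "c s \<noteq> 0" "s \<in> S"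
        using range by (auto simp: W_def)
      have "\<not> int p dvd c s - 1" using residue_eqI[of "c s" 1] sr p by auto
      moreover have "\<not> int p dvd c s + 1"
      proof
        assume "int p dvd c s + 1"
        then have "int p dvd (c s + 1) - int p" by (rule dvd_diff) simp
        then have "c s = int p - 1" using sr p by (intro residue_eqI) (auto simp: algebra_simps)
        then show False using sr by simp
      qed
      moreover have "c s - 1 = (c s - a) - (1 - a)" "c s + 1 = (c s - a) + (1 + a)"
        "c s + 1 = (c s + a) + (1 - a)" "c s - 1 = (c s + a) - (1 + a)" by simp_all
      ultimately have "\<not> int p dvd c s - a" "\<not> int p dvd c s + a"
        using a1 by (metis dvd_add dvd_diff)+
      then show "s \<in> {s \<in> S - U. c s \<noteq> 0 \<and> \<not> int p dvd c s - a \<and> \<not> int p dvd c s + a}"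
        using sr U by auto
    qed
    then have "card W \<le> card {s \<in> S - U. c s \<noteq> 0 \<and> \<not> int p dvd c s - a \<and> \<not> int p dvd c s + a}"
      by (rule card_mono[rotated]) (use fin in auto)
    then show ?thesis using U(4) by simp
  qed

  define d where "d = p - n1"
  have n1d: "n1 + d = p" using n1p by (simp add: d_def)
  have d7: "d \<le> 7" using n1d cnz many nm cW by simp
  \<comment> \<open>Here \<open>p + 10 \<le> card S\<close> enters: at most one element of row
    \<open>-1\<close> and six of \<open>W\<close> leave \<open>d + 3\<close> for row
    \<open>0\<close>, so rows \<open>0\<close> and \<open>1\<close> together have more than
    \<open>p\<close> elements and \<open>residues_meet\<close> applies to them.\<close>
  have Z0: "d + 3 \<le> card (R 0)" using cS cS' nm cW n1d by simp

  have "R (int p - 1) = {}"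
  proof (rule ccontr)
    assume "\<not> ?thesis"
    then obtain y where y: "y \<in> S" "c y = int p - 1" by (auto simp: R_def)
    have "inj_mod (\<lambda>s. - x y - x s) (R 0)"
      using injR[of 0] by (auto simp: inj_mod_def dvd_diff_commute)
    then obtain u v where uv: "u \<in> R 1" "v \<in> R 0" "int p dvd x u - (- x y - x v)"
      by (rule residues_meet[OF finR finR injR, of "\<lambda>s. - x y - x s" 0 1]) (use Z0 n1d n1_def in auto)
    have ne: "y \<noteq> u" "y \<noteq> v" "u \<noteq> v" using uv y p by (auto simp: R_def)
    have "sum c {y, u, v} = int p" using ne uv y by (simp add: R_def)
    moreover have "int p dvd sum x {y, u, v}" using ne uv by (simp add: algebra_simps)
    ultimately show False
      using zero_sum_freeD[OF zsf, of "{y, u, v}"] uv y by (auto simp: R_def)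
  qed
  then have Wd: "d \<le> card W" using many cnz n1d by simp

  \<comment> \<open>For larger \<open>c w\<close>, the \<open>p - c w\<close> elements of row
    \<open>1\<close> that complement \<open>w\<close> are at most \<open>n1 - 2\<close> in number,
    so their \<open>x\<close>-sums take every value.\<close>
  have Wc: "2 \<le> c w \<and> c w \<le> int d + 1" if w: "w \<in> W" for w
  proof -
    have wr: "c w \<in> {0..<int p}" "c w \<noteq> 1" "c w \<noteq> int p - 1" "c w \<noteq> 0" "w \<in> S"
      using w range by (auto simp: W_def)
    have "c w \<le> int d + 1"
    proof (rule ccontr)
      assume big_c: "\<not> ?thesis"
      define k where "k = nat (int p - c w)"
      have k: "int k = int p - c w" using wr by (simp add: k_def)
      have "card_mod (k_sums x k (R 1)) < p" by (rule row[of "{w}"]) (use wr k in auto)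
      moreover have "p \<le> card_mod (k_sums x k (R 1))" by (rule full) (use wr k big_c n1d in auto)
      ultimately show False by simp
    qed
    then show ?thesis using wr by auto
  qed

  consider "d = 0" | "d = 1" | "2 \<le> d" by linarith
  then show False
  proof cases
    case 1
    have "int p dvd sum x (R 1)"
      by (rule sum_all_residues[OF odd finR injR]) (use 1 n1d n1_def in simp)
    moreover have "sum c (R 1) = (\<Sum>s\<in>R 1. 1)" by (rule sum.cong) (auto simp: R_def)
    then have "int p dvd sum c (R 1)" using 1 n1d n1_def by simp
    moreover have "R 1 \<noteq> {}" using 1 n1d n1_def p by auto
    moreover have "R 1 \<subseteq> S" by (auto simp: R_def)
    ultimately show False using zero_sum_freeD[OF zsf] by blast
  next
    case 2
    \<comment> \<open>Row \<open>1\<close> has \<open>p - 1\<close> elements, so dropping one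
      element \<open>u\<close> and adding \<open>w\<close> with \<open>c w = 2\<close> gives
      \<open>c\<close>-sum \<open>p\<close>. The choice of \<open>u\<close>, together with that of
      \<open>v\<close> in row \<open>0\<close>, adjusts the \<open>x\<close>-sum.\<close>
    then obtain w where w: "w \<in> W" using Wd by fastforce
    then have cw: "c w = 2" "w \<in> S" using Wc[OF w] 2 by (auto simp: W_def)
    let ?y = "\<lambda>a. sum x (R 1) + x w + x a"
    have "inj_mod ?y (R 0)" using injR[of 0] by (auto simp: inj_mod_def)
    then obtain u v where uv: "u \<in> R 1" "v \<in> R 0" "int p dvd x u - ?y v"
      by (rule residues_meet[OF finR finR injR, of ?y 0 1]) (use Z0 n1d n1_def in auto)
    define Z where "Z = (R 1 - {u}) \<union> {w, v}"
    have wv: "w \<noteq> v" using cw uv by (auto simp: R_def)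
    have disj: "(R 1 - {u}) \<inter> {w, v} = {}" using cw uv by (auto simp: R_def)
    have split: "sum h Z = sum h (R 1) - h u + (h w + h v)" for h :: "'a \<Rightarrow> int"
      unfolding Z_def using disj finR uv wv by (simp add: sum.union_disjoint sum_diff1)
    have "sum c (R 1) = (\<Sum>s\<in>R 1. 1)" by (rule sum.cong) (auto simp: R_def)
    then have "sum c Z = int p" using 2 n1d n1_def cw uv by (simp add: split R_def)
    moreover have "int p dvd sum x Z"
      using uv(3) dvd_minus_iff[of "int p" "x u - ?y v"] by (simp add: split algebra_simps)
    moreover have "Z \<subseteq> S" "Z \<noteq> {}" using cw uv by (auto simp: Z_def R_def)
    ultimately show False using zero_sum_freeD[OF zsf, of Z] by simp
  next
    case 3
    \<comment> \<open>Every element of \<open>W\<close> counts at least \<open>2\<close> in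
      \<open>c\<close>, so \<open>d\<close> of them leave at most \<open>p - 2 * d = n1 - d\<close>
      elements to take from row \<open>1\<close>, which is within the full range as
      \<open>d \<ge> 2\<close>.\<close>
    obtain Y where Y: "Y \<subseteq> W" "card Y = d" using Wd by (meson obtain_subset_with_card_n)
    then have Yc: "2 \<le> c s" "c s \<le> int d + 1" if "s \<in> Y" for s using Wc that by auto
    have lo: "int (card Y) * 2 \<le> sum c Y" by (rule sum_bounded_below) (use Yc in auto)
    have hi: "sum c Y \<le> int (card Y) * (int d + 1)" by (rule sum_bounded_above) (use Yc in auto)
    have "int d * (int d + 1) \<le> 7 * 8" by (rule mult_mono) (use d7 in auto)
    then have hi': "sum c Y \<le> 56" using hi Y by simp
    define k where "k = nat (int p - sum c Y)"
    have k: "int k = int p - sum c Y" using hi' p by (simp add: k_def)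
    have "card_mod (k_sums x k (R 1)) < p"
      by (rule row[of Y]) (use Y k hi' p in \<open>auto simp: W_def\<close>)
    moreover have "p \<le> card_mod (k_sums x k (R 1))"
      by (rule full) (use k hi' lo Y 3 n1d p in auto)
    ultimately show False by simp
  qed
qed


text \<open>Multiplying \<open>c\<close> by a unit \<open>e\<close> preserves all hypotheses. With
  \<open>e = 1\<close> the dominant class \<open>a\<close> is found up to sign; its inverse
  \<open>b\<close> moves the class to \<open>1\<close> and \<open>-1\<close>, and \<open>- b\<close>
  is used instead when row \<open>-1\<close> is the longer of the two.\<close>

lemma zero_sum_free_large_row:
  assumes p: "6000 < p" and fin: "finite S"
    and inj: "\<And>s t. s \<in> S \<Longrightarrow> t \<in> S \<Longrightarrow> int p dvd c s - c t \<Longrightarrow> int p dvd x s - x t \<Longrightarrow> s = t"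
    and zsf: "zero_sum_free c x S"
    and many: "p \<le> card {s \<in> S. \<not> int p dvd c s}" and cS: "p + 10 \<le> card S"
    and v: "\<not> int p dvd v" and big: "p \<le> 11 * card {s \<in> S. int p dvd c s - v}"
  shows False
proof -
  define cc where "cc = (\<lambda>e s. (e * c s) mod int p)"
  have range: "cc e s \<in> {0..<int p}" for e s using p_pos by (simp add: cc_def)
  have cc_eq: "cc e s = w mod int p \<longleftrightarrow> int p dvd e * c s - w" for e s w
    by (simp add: cc_def mod_eq_iff_dvd)
  have cc_dvd: "int p dvd cc e s - cc e t \<longleftrightarrow> int p dvd c s - c t" if "\<not> int p dvd e" for e s t
  proof -
    have "int p dvd cc e s - cc e t \<longleftrightarrow> int p dvd e * c s - e * c t"
      unfolding mod_eq_iff_dvd[symmetric] by (simp add: cc_def)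
    also have "e * c s - e * c t = e * (c s - c t)" by (simp add: algebra_simps)
    finally show ?thesis using that prime_dvd_mult_iff[OF prime_int_p] by simp
  qed
  have rowinj: "inj_mod x {s \<in> S. cc e s = w}" if "\<not> int p dvd e" for e w
    unfolding inj_mod_def using cc_dvd[OF that] inj by (auto, metis diff_self dvd_0_right)
  have zsfe: "zero_sum_free (cc e) x S" if e: "\<not> int p dvd e" for e
    unfolding zero_sum_free_def
  proof (intro allI impI)
    fix Z assume Z: "Z \<subseteq> S" "Z \<noteq> {}" "int p dvd sum (cc e) Z"
    have "sum (cc e) Z mod int p = (e * sum c Z) mod int p"
      by (simp add: cc_def mod_sum_eq sum_distrib_left)
    then have "int p dvd e * sum c Z" using Z(3) by (metis dvd_eq_mod_eq_0)
    then have "int p dvd sum c Z" using e prime_dvd_mult_iff[OF prime_int_p] by blast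
    then show "\<not> int p dvd sum x Z" using zsf Z by (simp add: zero_sum_free_def)
  qed
  have manye: "p \<le> card {s \<in> S. cc e s \<noteq> 0}" if e: "\<not> int p dvd e" for e
  proof -
    have "cc e s = 0 \<longleftrightarrow> int p dvd c s" for s
      using cc_eq[of e s 0] e prime_dvd_mult_iff[OF prime_int_p] by simp
    then show ?thesis using many by simp
  qed
  have one: "\<not> int p dvd 1" using p by simp

  define w where "w = v mod int p"
  have wrow: "{s \<in> S. cc 1 s = w} = {s \<in> S. int p dvd c s - v}"
    using cc_eq[of 1 _ v] by (simp add: w_def)
  have w0: "w \<noteq> 0" using v by (auto simp: w_def)
  obtain U a where U: "U \<subseteq> {s \<in> S. cc 1 s = w}" "card U = 2 * 40" "\<not> int p dvd a"
    "card {s \<in> S - U. cc 1 s \<noteq> 0 \<and> \<not> int p dvd cc 1 s - a \<and> \<not> int p dvd cc 1 s + a} \<le> 2 * (2 * 40 - 1)"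
  proof (rule zero_sum_free_majority[OF fin range zsfe[OF one] w0, of 40])
    show "2 * 40 \<le> card {s \<in> S. cc 1 s = w}" using big wrow p by simp
    fix k assume "40 \<le> k" "k + 40 \<le> card {s \<in> S. cc 1 s = w}"
    then show "p \<le> card_mod (k_sums x k {s \<in> S. cc 1 s = w})"
      using big fin rowinj[OF one, of w] unfolding wrow by (intro card_mod_k_sums_full_middle[OF p]) auto
  qed (use manye[OF one] in auto)
  obtain b where b: "int p dvd a * b - 1" using inverse_exists[OF U(3)] .
  have bnd: "\<not> int p dvd b"
  proof
    assume "int p dvd b"
    then have "int p dvd a * b - (a * b - 1)" by (intro dvd_diff[OF dvd_mult b])
    then show False using p by simp
  qed
  have m1: "(- 1) mod int p = int p - 1" "1 mod int p = (1 :: int)" using p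
    by (simp_all add: zmod_minus1)
  have e1: "cc e s = 1 \<longleftrightarrow> int p dvd e * c s - 1" "cc e s = int p - 1 \<longleftrightarrow> int p dvd e * c s + 1" for e s
    using cc_eq[of e s 1, unfolded m1] cc_eq[of e s "- 1", unfolded m1] by simp_all
  have few: "card {s \<in> S. cc e s \<notin> {0, 1, int p - 1}} \<le> 238" if e: "e = b \<or> e = - b" for e
  proof -
    have "{s \<in> S. cc e s \<notin> {0, 1, int p - 1}}
      \<subseteq> U \<union> {s \<in> S - U. cc 1 s \<noteq> 0 \<and> \<not> int p dvd cc 1 s - a \<and> \<not> int p dvd cc 1 s + a}"
    proof
      fix s assume "s \<in> {s \<in> S. cc e s \<notin> {0, 1, int p - 1}}"
      then have s: "s \<in> S" "cc e s \<noteq> 0" "\<not> int p dvd e * c s - 1" "\<not> int p dvd e * c s + 1"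
        using e1 by auto
      have "cc 1 s \<noteq> 0" using s(2) cc_eq[of 1 s 0] cc_eq[of e s 0] by auto
      moreover have "\<not> int p dvd cc 1 s - g * a" if g: "g = 1 \<or> g = - 1" for g
      proof
        assume "int p dvd cc 1 s - g * a"
        moreover have "int p dvd c s - cc 1 s" by (simp add: cc_def)
        ultimately have "int p dvd (c s - cc 1 s) + (cc 1 s - g * a)" by (rule dvd_add[rotated])
        then have "int p dvd c s - g * a" by simp
        then have d: "int p dvd b * (c s - g * a) + g * (a * b - 1)" using b by (intro dvd_add dvd_mult)
        have "b * (c s - g * a) + g * (a * b - 1) = b * c s - g" by (simp add: algebra_simps)
        with d have d': "int p dvd b * c s - g" by simp
        have "\<exists>h. (h = 1 \<or> h = - 1) \<and> int p dvd e * c s - h"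
          using e
        proof
          assume "e = - b"
          then have "e * c s - (- g) = - (b * c s - g)" by simp
          then show ?thesis using d' g by (metis dvd_minus_iff minus_minus)
        qed (use d' g in blast)
        then show False using s(3,4) by auto
      qed
      from this[of 1] this[of "- 1"] have "\<not> int p dvd cc 1 s - a" "\<not> int p dvd cc 1 s + a" by simp_all
      ultimately show "s \<in> U \<union> {s \<in> S - U. cc 1 s \<noteq> 0 \<and> \<not> int p dvd cc 1 s - a \<and> \<not> int p dvd cc 1 s + a}"
        using s(1) by auto
    qed
    then have "card {s \<in> S. cc e s \<notin> {0, 1, int p - 1}} \<le>
      card (U \<union> {s \<in> S - U. cc 1 s \<noteq> 0 \<and> \<not> int p dvd cc 1 s - a \<and> \<not> int p dvd cc 1 s + a})"
      by (rule card_mono[rotated]) (use fin U(1) finite_subset[of U S] in auto)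
    also have "\<dots> \<le> card U + card {s \<in> S - U. cc 1 s \<noteq> 0 \<and> \<not> int p dvd cc 1 s - a \<and> \<not> int p dvd cc 1 s + a}"
      by (rule card_Un_le)
    also have "\<dots> \<le> 80 + 158" using U(2,4) by simp
    finally show ?thesis by simp
  qed
  have swap: "{s \<in> S. cc (- b) s = 1} = {s \<in> S. cc b s = int p - 1}"
    "{s \<in> S. cc (- b) s = int p - 1} = {s \<in> S. cc b s = 1}"
  proof -
    have "- b * c s - 1 = - (b * c s + 1)" "- b * c s + 1 = - (b * c s - 1)" for s by simp_all
    then show "{s \<in> S. cc (- b) s = 1} = {s \<in> S. cc b s = int p - 1}"
      "{s \<in> S. cc (- b) s = int p - 1} = {s \<in> S. cc b s = 1}"
      unfolding e1 by (simp_all only: dvd_minus_iff)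
  qed
  have contra: False if e: "e = b \<or> e = - b" and le: "card {s \<in> S. cc e s = int p - 1} \<le> card {s \<in> S. cc e s = 1}" for e
  proof -
    have "\<not> int p dvd e" using e bnd dvd_minus_iff by blast
    then show False
      by (intro zero_sum_free_endgame[OF p fin range rowinj zsfe manye cS few[OF e] le])
  qed
  show False
  proof (cases "card {s \<in> S. cc b s = int p - 1} \<le> card {s \<in> S. cc b s = 1}")
    case True
    then show False using contra[of b] by simp
  next
    case False
    then show False using contra[of "- b"] by (simp add: swap)
  qed
qed

end

section \<open>Small rows\<close>

lemma subset_sums_mono: "A \<subseteq> B \<Longrightarrow> subset_sums c A \<subseteq> subset_sums c B"
  by (auto simp: subset_sums_def)

text \<open>Changing signs only translates the subset sums: the sum of |c| over \<open>J\<close> is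
  the \<open>c\<close>-sum of the symmetric difference of \<open>J\<close> and the negative
  elements, minus the sum over all negative elements.\<close>

lemma subset_sums_abs_subset:
  assumes "finite T"
  shows "subset_sums (\<lambda>s. \<bar>c s\<bar>) T \<subseteq> (\<lambda>y. y + - sum c {s \<in> T. c s < 0}) ` subset_sums c T"
proof
  fix y assume "y \<in> subset_sums (\<lambda>s. \<bar>c s\<bar>) T"
  then obtain J where J: "J \<subseteq> T" "y = (\<Sum>s\<in>J. \<bar>c s\<bar>)" by (auto simp: subset_sums_def)
  define N where "N = {s \<in> T. c s < 0}"
  have fin: "finite J" "finite N" using assms J finite_subset by (auto simp: N_def)
  have "(\<Sum>s\<in>J. \<bar>c s\<bar>) = (\<Sum>s\<in>J - N. \<bar>c s\<bar>) + (\<Sum>s\<in>J \<inter> N. \<bar>c s\<bar>)"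
    using sum.Int_Diff[OF fin(1), of "\<lambda>s. \<bar>c s\<bar>" N] by simp
  also have "(\<Sum>s\<in>J - N. \<bar>c s\<bar>) = sum c (J - N)"
    by (rule sum.cong) (use J in \<open>auto simp: N_def\<close>)
  also have "(\<Sum>s\<in>J \<inter> N. \<bar>c s\<bar>) = (\<Sum>s\<in>J \<inter> N. - c s)"
    by (rule sum.cong) (auto simp: N_def)
  also have "\<dots> = - sum c (J \<inter> N)" by (rule sum_negf)
  also have "sum c (J \<inter> N) = sum c N - sum c (N - J)"
    using sum.Int_Diff[OF fin(2), of c J] by (simp add: Int_commute)
  also have "sum c (J - N) + - (sum c N - sum c (N - J)) = sum c ((J - N) \<union> (N - J)) + - sum c N"
    using fin by (subst sum.union_disjoint) auto
  finally have "y = sum c ((J - N) \<union> (N - J)) + - sum c N" using J by simp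
  moreover have "(J - N) \<union> (N - J) \<subseteq> T" using J by (auto simp: N_def)
  ultimately show "y \<in> (\<lambda>y. y + - sum c {s \<in> T. c s < 0}) ` subset_sums c T"
    unfolding N_def subset_sums_def by blast
qed

context prime_modulus
begin

text \<open>Eleven subset sums of the absolute values form an increasing chain from \<open>0\<close>
  to their total, which is below \<open>4 * \<bar>c s4\<bar> < p\<close>, so they are
  incongruent.\<close>

lemma card_mod_subset_sums_four:
  assumes "0 < \<bar>c s1\<bar>" "\<bar>c s1\<bar> < \<bar>c s2\<bar>" "\<bar>c s2\<bar> < \<bar>c s3\<bar>" "\<bar>c s3\<bar> < \<bar>c s4\<bar>"
    "4 * \<bar>c s4\<bar> < int p"
  shows "11 \<le> card_mod (subset_sums c {s1, s2, s3, s4})"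
proof -
  define a b d e where "a = \<bar>c s1\<bar>" "b = \<bar>c s2\<bar>" "d = \<bar>c s3\<bar>" "e = \<bar>c s4\<bar>"
  note ab = assms[folded a_b_d_e_def]
  have ne: "s1 \<noteq> s2" "s1 \<noteq> s3" "s1 \<noteq> s4" "s2 \<noteq> s3" "s2 \<noteq> s4" "s3 \<noteq> s4" using assms by auto
  define B where "B = {0, a, b, d, e, a + e, b + e, d + e, a + d + e, b + d + e, a + b + d + e}"
  have sub: "B \<subseteq> subset_sums (\<lambda>s. \<bar>c s\<bar>) {s1, s2, s3, s4}"
  proof -
    have "sum (\<lambda>s. \<bar>c s\<bar>) Z \<in> subset_sums (\<lambda>s. \<bar>c s\<bar>) {s1, s2, s3, s4}" if "Z \<subseteq> {s1, s2, s3, s4}" for Z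
      using that by (auto simp: subset_sums_def)
    from this[of "{}"] this[of "{s1}"] this[of "{s2}"] this[of "{s3}"] this[of "{s4}"]
      this[of "{s1, s4}"] this[of "{s2, s4}"] this[of "{s3, s4}"] this[of "{s1, s3, s4}"]
      this[of "{s2, s3, s4}"] this[of "{s1, s2, s3, s4}"]
    show ?thesis using ne by (simp add: B_def a_b_d_e_def algebra_simps)
  qed
  have "card B = 11" using ab by (simp add: B_def)
  moreover have "card B \<le> card_mod (subset_sums (\<lambda>s. \<bar>c s\<bar>) {s1, s2, s3, s4})"
  proof (rule card_mod_ge_card[OF sub])
    have rng: "z \<in> {0..<int p}" if "z \<in> B" for z using that ab by (auto simp: B_def)
    fix x y assume "x \<in> B" "y \<in> B" "int p dvd x - y"
    then show "x = y" using rng residue_eqI by blast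
  qed (simp add: B_def)
  moreover have "card_mod (subset_sums (\<lambda>s. \<bar>c s\<bar>) {s1, s2, s3, s4})
      \<le> card_mod ((\<lambda>y. y + - sum c {s \<in> {s1, s2, s3, s4}. c s < 0}) ` subset_sums c {s1, s2, s3, s4})"
    by (rule card_mod_mono, rule subset_sums_abs_subset) simp
  ultimately show ?thesis by (simp add: card_mod_shift del: add_uminus_conv_diff)
qed

text \<open>Sorting \<open>T\<close> by absolute value and taking every \<open>t\<close>-th element splits it into \<open>t\<close> quadruples
  with distinct absolute values.\<close>

lemma card_mod_subset_sums_quadruples:
  assumes fin: "finite T" and mult: "\<And>v. card {s \<in> T. \<bar>c s\<bar> = v} \<le> t" and t: "4 * t \<le> card T"
    and small: "\<And>s. s \<in> T \<Longrightarrow> c s \<noteq> 0 \<and> 4 * \<bar>c s\<bar> < int p"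
  shows "min p (10 * t + 1) \<le> card_mod (subset_sums c T)"
proof -
  obtain ys where ys: "set ys = T" "distinct ys" using finite_distinct_list[OF fin] by blast
  define xs where "xs = sort_key (\<lambda>s. \<bar>c s\<bar>) ys"
  have xs: "set xs = T" "distinct xs" "sorted (map (\<lambda>s. \<bar>c s\<bar>) xs)" using ys by (simp_all add: xs_def)
  have len: "length xs = card T" using xs distinct_card by metis
  have mono: "\<bar>c (xs ! i)\<bar> \<le> \<bar>c (xs ! j)\<bar>" if "i \<le> j" "j < length xs" for i j
    using sorted_nth_mono[OF xs(3) that(1)] that by simp
  have less: "\<bar>c (xs ! i)\<bar> < \<bar>c (xs ! (i + t))\<bar>" if "i + t < length xs" for i
  proof (rule ccontr)
    assume "\<not> ?thesis"
    then have eq: "\<bar>c (xs ! j)\<bar> = \<bar>c (xs ! i)\<bar>" if "j \<in> {i..i + t}" for j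
      using mono[of i j] mono[of j "i + t"] that \<open>i + t < length xs\<close> by simp
    have "inj_on ((!) xs) {i..i + t}"
      using xs(2) that by (auto simp: inj_on_def nth_eq_iff_index_eq)
    then have "card ((!) xs ` {i..i + t}) = t + 1" by (simp add: card_image)
    moreover have "card ((!) xs ` {i..i + t}) \<le> card {s \<in> T. \<bar>c s\<bar> = \<bar>c (xs ! i)\<bar>}"
    proof (rule card_mono)
      have "xs ! j \<in> T" if "j \<in> {i..i + t}" for j
        using xs(1) that \<open>i + t < length xs\<close> by auto
      then show "(!) xs ` {i..i + t} \<subseteq> {s \<in> T. \<bar>c s\<bar> = \<bar>c (xs ! i)\<bar>}" using eq by blast
    qed (use fin in auto)
    ultimately show False using mult[of "\<bar>c (xs ! i)\<bar>"] by simp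
  qed
  define G where "G = (\<lambda>i. {xs ! i, xs ! (i + t), xs ! (i + t + t), xs ! (i + t + t + t)})"
  have GT: "G i \<subseteq> T" if "i < t" for i using that t len xs(1) by (auto simp: G_def)
  have Gcm: "11 \<le> card_mod (subset_sums c (G i))" if "i < t" for i
    unfolding G_def
  proof (rule card_mod_subset_sums_four)
    have "xs ! i \<in> T" "xs ! (i + t + t + t) \<in> T" using GT[OF that] by (auto simp: G_def)
    then show "0 < \<bar>c (xs ! i)\<bar>" "4 * \<bar>c (xs ! (i + t + t + t))\<bar> < int p" using small by auto
  qed (use less that t len in auto)
  have Gdisj: "G i \<inter> G j = {}" if "i < t" "j < t" "i \<noteq> j" for i j
    using that t len xs(2) by (auto simp: G_def nth_eq_iff_index_eq)
  have "min p (10 * j + 1) \<le> card_mod (subset_sums c (\<Union>i<j. G i))" if "j \<le> t" for j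
    using that
  proof (induction j)
    case 0
    then show ?case using card_mod_subset_sums_pos[of c "{}"] by simp
  next
    case (Suc j)
    have "min p (card_mod (subset_sums c (G j)) + card_mod (subset_sums c (\<Union>i<j. G i)) - 1) \<le> card_mod (subset_sums c (G j \<union> (\<Union>i<j. G i)))"
    proof (rule card_mod_subset_sums_Un)
      have "G j \<inter> G i = {}" if "i < j" for i using Gdisj[of j i] that Suc.prems by simp
      then show "G j \<inter> (\<Union>i<j. G i) = {}" by blast
    qed (auto simp: G_def)
    moreover have "11 \<le> card_mod (subset_sums c (G j))" using Gcm[of j] Suc.prems by simp
    moreover have "min p (10 * j + 1) \<le> card_mod (subset_sums c (\<Union>i<j. G i))" using Suc by simp
    ultimately have "min p (10 * Suc j + 1) \<le> card_mod (subset_sums c (G j \<union> (\<Union>i<j. G i)))" by simp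
    then show ?case by (simp add: lessThan_Suc)
  qed
  from this[of t] have "min p (10 * t + 1) \<le> card_mod (subset_sums c (\<Union>i<t. G i))" by simp
  also have "\<dots> \<le> card_mod (subset_sums c T)" by (intro card_mod_mono subset_sums_mono) (use GT in auto)
  finally show ?thesis .
qed

text \<open>Cutting the row down to at most \<open>M\<close> elements keeps
  \<open>l * (n - l) \<le> n * n / 4\<close> below \<open>p\<close>, as the Dias da Silva--Hamidoune
  inequality requires. Over the admissible \<open>l\<close> this product is smallest at the ends of
  the range.\<close>

lemma card_mod_k_sums_quarter:
  fixes M :: nat
  assumes X: "finite X" "inj_mod x X" and M: "M * M < 4 * p"
    and k: "min (card X) M div 4 \<le> k" "k + min (card X) M div 4 \<le> card X"
  shows "(min (card X) M div 4) * (min (card X) M - min (card X) M div 4) + 1 \<le> card_mod (k_sums x k X)"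
proof -
  define n where "n = min (card X) M"
  define \<beta> where "\<beta> = n div 4"
  obtain X' where X': "X' \<subseteq> X" "card X' = n"
    using obtain_subset_with_card_n[of n X] by (auto simp: n_def)
  have fX': "finite X'" using X' X finite_subset by blast
  \<comment> \<open>Only \<open>card X - n\<close> summands can be placed outside \<open>X'\<close>;
    \<open>l\<close> is the number taken inside.\<close>
  define l where "l = max \<beta> (k - (card X - n))"
  have \<beta>: "4 * \<beta> \<le> n" by (simp add: \<beta>_def)
  have nX: "n \<le> card X" by (simp add: n_def)
  have k': "\<beta> \<le> k" "k + \<beta> \<le> card X" using k by (simp_all add: n_def \<beta>_def)
  have l: "\<beta> \<le> l" "l + \<beta> \<le> n" "l \<le> k" "k - l \<le> card X - card X'"
    using \<beta> nX k' X' by (auto simp: l_def)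
  \<comment> \<open>In these parameters \<open>l * (n - l) - \<beta> * (n - \<beta>)\<close> is
    \<open>i * j\<close>.\<close>
  obtain i j where ij: "l = \<beta> + i" "n = l + \<beta> + j" using l(1,2) le_Suc_ex by metis
  have "\<beta> * (n - \<beta>) \<le> l * (n - l)" unfolding ij by (simp add: algebra_simps)
  moreover have "4 * (l * (n - l)) \<le> n * n"
  proof -
    have "0 \<le> (int (n - l) - int l) * (int (n - l) - int l)" by simp
    also have "\<dots> = int n * int n - 4 * (int l * int (n - l))"
      using l(2) by (simp add: of_nat_diff algebra_simps)
    finally have "int (4 * (l * (n - l))) \<le> int (n * n)" by simp
    then show ?thesis by linarith
  qed
  moreover have "n * n \<le> M * M" by (intro mult_le_mono) (simp_all add: n_def)
  ultimately have "l * (card X' - l) < p" "\<beta> * (n - \<beta>) \<le> l * (card X' - l)" using M X' by simp_all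
  then have "\<beta> * (n - \<beta>) + 1 \<le> card_mod (k_sums x l X')"
    using dias_da_silva_hamidoune[OF fX' inj_mod_subset[OF X(2) X'(1)], of l] l X' by simp
  also have "\<dots> \<le> card_mod (k_sums x k X)" by (rule card_mod_k_sums_subset[OF X(1) X'(1) l(3,4)])
  finally show ?thesis by (simp add: \<beta>_def n_def)
qed

end

section \<open>The total gain of rows with a small second moment\<close>

lemma sum_square_diff_squares:
  "(\<Sum>i=1..n. (K - (real i)\<^sup>2)\<^sup>2)
    = n * K\<^sup>2 - K * (n * (n + 1) * (2 * n + 1)) / 3 + real n * (n + 1) * (2 * n + 1) * (3 * (real n)\<^sup>2 + 3 * n - 1) / 30"
  by (induction n) (simp_all add: field_simps power2_eq_square)

text \<open>\<open>8 / 15\<close> is the integral of \<open>(1 - t\<^sup>2)\<^sup>2\<close> from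
  \<open>0\<close> to \<open>1\<close>; in the exact closed form both correction terms are
  negative.\<close>

lemma sum_parabolic_weights:
  "(\<Sum>i=1..R. (1 - (real i)\<^sup>2 / (real R)\<^sup>2)\<^sup>2) \<le> 8 / 15 * R"
proof (cases "R = 0")
  case False
  have "(\<Sum>i=1..R. (1 - (real i)\<^sup>2 / (real R)\<^sup>2)\<^sup>2) * (real R) ^ 4
      = (\<Sum>i=1..R. ((real R)\<^sup>2 - (real i)\<^sup>2)\<^sup>2)"
    unfolding sum_distrib_right
  proof (rule sum.cong[OF refl])
    fix i :: nat
    have "(1 - (real i)\<^sup>2 / (real R)\<^sup>2)\<^sup>2 * (real R) ^ 4 = ((1 - (real i)\<^sup>2 / (real R)\<^sup>2) * (real R)\<^sup>2)\<^sup>2"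
      by (simp only: power_mult_distrib power_even_eq[symmetric]) (simp add: power_mult[symmetric])
    also have "(1 - (real i)\<^sup>2 / (real R)\<^sup>2) * (real R)\<^sup>2 = (real R)\<^sup>2 - (real i)\<^sup>2"
      using False by (simp add: field_simps)
    finally show "(1 - (real i)\<^sup>2 / (real R)\<^sup>2)\<^sup>2 * (real R) ^ 4 = ((real R)\<^sup>2 - (real i)\<^sup>2)\<^sup>2" .
  qed
  also have "\<dots> = 8 / 15 * real R ^ 5 - real R ^ 4 / 2 - real R / 30"
    unfolding sum_square_diff_squares by (simp add: field_simps power2_eq_square eval_nat_numeral)
  also have "\<dots> \<le> 8 / 15 * real R ^ 5" using zero_le_power[of "real R" 4] by linarith
  also have "\<dots> = 8 / 15 * R * real R ^ 4" by (simp add: eval_nat_numeral)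
  finally show ?thesis using False by simp
qed simp

lemma sum_abs_int_le:
  fixes h :: "nat \<Rightarrow> real"
  assumes "finite V" "\<And>v. v \<in> V \<Longrightarrow> 1 \<le> \<bar>v\<bar> \<and> \<bar>v\<bar> \<le> int R" "\<And>i. 0 \<le> h i"
  shows "(\<Sum>v\<in>V. h (nat \<bar>v\<bar>)) \<le> 2 * (\<Sum>i=1..R. h i)"
proof -
  have "V \<subseteq> int ` {1..R} \<union> (\<lambda>i. - int i) ` {1..R}"
  proof
    fix v assume "v \<in> V"
    then have "1 \<le> \<bar>v\<bar>" "\<bar>v\<bar> \<le> int R" using assms by auto
    then have "nat \<bar>v\<bar> \<in> {1..R}" "v = int (nat \<bar>v\<bar>) \<or> v = - int (nat \<bar>v\<bar>)" by auto
    then show "v \<in> int ` {1..R} \<union> (\<lambda>i. - int i) ` {1..R}" by blast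
  qed
  then have "(\<Sum>v\<in>V. h (nat \<bar>v\<bar>)) \<le> (\<Sum>v\<in>int ` {1..R} \<union> (\<lambda>i. - int i) ` {1..R}. h (nat \<bar>v\<bar>))"
    by (rule sum_mono2[rotated]) (use assms in auto)
  also have "\<dots> = (\<Sum>v\<in>int ` {1..R}. h (nat \<bar>v\<bar>)) + (\<Sum>v\<in>(\<lambda>i. - int i) ` {1..R}. h (nat \<bar>v\<bar>))"
    by (rule sum.union_disjoint) auto
  also have "\<dots> = 2 * (\<Sum>i=1..R. h i)"
    by (subst (1 2) sum.reindex) (auto simp: inj_on_def)
  finally show ?thesis .
qed

text \<open>The tangent at row length \<open>w\<close> of the convex gain function. In the sum over all rows the choice
  \<open>w = 12 (1 - v\<^sup>2 / R\<^sup>2)\<close> turns it into a bound in terms of the first two moments of the rows.\<close>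

lemma quarter_gain:
  fixes n M p :: nat and w :: real
  assumes M: "M * M \<le> 3 * p" "3 * p < (M + 1) * (M + 1)" and p: "6000 < p" and n: "11 * n < p"
    and w: "0 \<le> w" "w \<le> 12"
  shows "6 * w * n - 3 * w\<^sup>2 - 6 * n - 9
    \<le> 16 * real ((min n M div 4) * (min n M - min n M div 4))"
proof -
  define m where "m = min n M"
  define j where "j = m div 4"
  define r where "r = m mod 4"
  have m: "m = 4 * j + r" by (simp add: j_def r_def)
  have "r < 4" by (simp add: r_def)
  then have "r = 0 \<or> r = 1 \<or> r = 2 \<or> r = 3" by linarith
  \<comment> \<open>Rounding to a quarter costs
    \<open>3 * m * m - 16 * j * (m - j) = 2 * r * m + r * r\<close>, at most
    \<open>6 * m + 9\<close>.\<close>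
  then have "3 * (real m)\<^sup>2 - 6 * m - 9 \<le> 16 * real (j * (m - j))"
    by (elim disjE) (simp_all add: m power2_eq_square algebra_simps)
  moreover have "6 * w * n - 3 * w\<^sup>2 - 6 * n - 9 \<le> 3 * (real m)\<^sup>2 - 6 * m - 9"
  proof (cases "n \<le> M")
    case True
    have "0 \<le> 3 * (real n - w)\<^sup>2" by simp
    then show ?thesis using True by (simp add: m_def power2_eq_square algebra_simps)
  next
    \<comment> \<open>Beyond \<open>M\<close> the gain stays constant, with \<open>3 * M * M\<close>
      close to \<open>9 * p\<close>, while \<open>w \<le> 12\<close> and \<open>11 * n < p\<close>
      keep the linear part \<open>(6 * w - 6) * n\<close> of the tangent below
      \<open>6 * p\<close>.\<close>
    case False
    have "13 < M"
    proof (rule ccontr)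
      assume "\<not> ?thesis"
      then have "(M + 1) * (M + 1) \<le> 14 * 14" by (intro mult_le_mono) auto
      then show False using M p by simp
    qed
    have "14 * M \<le> M * M" using \<open>13 < M\<close> by (intro mult_le_mono1) simp
    then have "12 * M + 9 \<le> 3 * p" using M \<open>13 < M\<close> by linarith
    moreover have "3 * p \<le> M * M + 2 * M" using M by simp
    ultimately have "6 * p + 6 * M + 9 \<le> 3 * (M * M)" by simp
    then have "6 * real p \<le> 3 * (real M)\<^sup>2 - 6 * M - 9"
      unfolding power2_eq_square of_nat_mult[symmetric] by linarith
    moreover have "6 * w * n \<le> 72 * real n" using w by (intro mult_right_mono) auto
    moreover have "66 * real n \<le> 6 * p" using n by simp
    moreover have "0 \<le> 3 * w\<^sup>2" by simp
    moreover have "m = M" using False by (simp add: m_def)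
    ultimately show ?thesis unfolding \<open>m = M\<close> by linarith
  qed
  ultimately show ?thesis by (simp add: m_def j_def)
qed

text \<open>A parabola minimises a sum of squares with given total and second moment. With height
  \<open>12\<close> and half-width \<open>R = p / 16\<close> it has total about \<open>p\<close> and
  second moment about \<open>p ^ 3 / 1280\<close>, slightly above the permitted
  \<open>3 * p ^ 3 / 4000\<close>, so the tangents are taken near the worst case. Beyond
  \<open>R\<close> the weight \<open>y\<close> is not positive and the row bound is trivial.\<close>

lemma quarter_gain_sum:
  fixes n :: "int \<Rightarrow> nat" and M p :: nat
  assumes p: "6000 < p" and M: "M * M \<le> 3 * p" "3 * p < (M + 1) * (M + 1)"
    and V: "finite V" "0 \<notin> V" and n: "\<And>v. v \<in> V \<Longrightarrow> 11 * n v < p"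
    and total: "p \<le> (\<Sum>v\<in>V. n v)"
    and sq: "4000 * (\<Sum>v\<in>V. int (n v) * v\<^sup>2) \<le> 3 * int p ^ 3"
  shows "p \<le> (\<Sum>v\<in>V. (min (n v) M div 4) * (min (n v) M - min (n v) M div 4))"
proof -
  define R where "R = p div 16"
  have R: "16 * R \<le> p" "p \<le> 16 * R + 15" unfolding R_def by linarith+
  have R0: "0 < real R" using R p by simp
  define g where "g = (\<lambda>v. real ((min (n v) M div 4) * (min (n v) M - min (n v) M div 4)))"
  define y where "y = (\<lambda>i. 1 - (real i)\<^sup>2 / (real R)\<^sup>2)"
  define \<omega> where "\<omega> = (\<lambda>i. 432 * (y i)\<^sup>2 + 9)"
  have row: "72 * y (nat \<bar>v\<bar>) * n v - 6 * n v - (if \<bar>v\<bar> \<le> int R then \<omega> (nat \<bar>v\<bar>) else 0) \<le> 16 * g v"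
    if v: "v \<in> V" for v
  proof (cases "\<bar>v\<bar> \<le> int R")
    case True
    have "(real (nat \<bar>v\<bar>))\<^sup>2 \<le> (real R)\<^sup>2" using True by (intro power_mono) auto
    then have "0 \<le> y (nat \<bar>v\<bar>)" "y (nat \<bar>v\<bar>) \<le> 1" using R0 by (simp_all add: y_def)
    then have "6 * (12 * y (nat \<bar>v\<bar>)) * n v - 3 * (12 * y (nat \<bar>v\<bar>))\<^sup>2 - 6 * n v - 9 \<le> 16 * g v"
      unfolding g_def by (intro quarter_gain[OF M p n[OF v]]) auto
    then show ?thesis using True by (simp add: \<omega>_def power_mult_distrib)
  next
    case False
    have "(real R)\<^sup>2 \<le> (real (nat \<bar>v\<bar>))\<^sup>2" using False by (intro power_mono) auto
    then have "y (nat \<bar>v\<bar>) \<le> 0" using R0 by (simp add: y_def)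
    then have "72 * y (nat \<bar>v\<bar>) * n v \<le> 0"
      using mult_nonpos_nonneg[of "72 * y (nat \<bar>v\<bar>)" "real (n v)"] by simp
    moreover have "0 \<le> g v" by (simp add: g_def)
    moreover have "(if \<bar>v\<bar> \<le> int R then \<omega> (nat \<bar>v\<bar>) else 0) = 0" using False by simp
    ultimately show ?thesis by linarith
  qed
  define Q where "Q = (\<Sum>v\<in>V. real (n v) * (real_of_int v)\<^sup>2)"
  define N where "N = (\<Sum>v\<in>V. real (n v))"
  have Np: "real p \<le> N" using total unfolding N_def of_nat_sum[symmetric] by (simp only: of_nat_le_iff)
  have Q: "4000 * Q \<le> 3 * real p ^ 3"
  proof -
    have "Q = real_of_int (\<Sum>v\<in>V. int (n v) * v\<^sup>2)" by (simp add: Q_def)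
    then have "4000 * Q = real_of_int (4000 * (\<Sum>v\<in>V. int (n v) * v\<^sup>2))" by simp
    also have "\<dots> \<le> real_of_int (3 * int p ^ 3)" using sq by (simp only: of_int_le_iff)
    finally show ?thesis by simp
  qed
  have "(\<Sum>v\<in>V. if \<bar>v\<bar> \<le> int R then \<omega> (nat \<bar>v\<bar>) else 0) = (\<Sum>v\<in>{v \<in> V. \<bar>v\<bar> \<le> int R}. \<omega> (nat \<bar>v\<bar>))"
    using V by (simp add: sum.If_cases Int_def)
  also have "\<dots> \<le> 2 * (\<Sum>i=1..R. \<omega> i)"
  proof (rule sum_abs_int_le)
    fix v assume "v \<in> {v \<in> V. \<bar>v\<bar> \<le> int R}"
    moreover from this have "v \<noteq> 0" using V by auto
    ultimately show "1 \<le> \<bar>v\<bar> \<and> \<bar>v\<bar> \<le> int R" by auto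
  qed (use V in \<open>auto simp: \<omega>_def\<close>)
  also have "(\<Sum>i=1..R. \<omega> i) = 432 * (\<Sum>i=1..R. (y i)\<^sup>2) + 9 * R"
    by (simp add: \<omega>_def sum.distrib sum_distrib_left)
  also have "\<dots> \<le> 432 * (8 / 15 * R) + 9 * R"
    using sum_parabolic_weights[of R] by (simp add: y_def)
  finally have \<omega>: "(\<Sum>v\<in>V. if \<bar>v\<bar> \<le> int R then \<omega> (nat \<bar>v\<bar>) else 0) \<le> 2 * (432 * (8 / 15 * R) + 9 * R)"
    by simp
  have "(\<Sum>v\<in>V. 72 * y (nat \<bar>v\<bar>) * n v - 6 * n v - (if \<bar>v\<bar> \<le> int R then \<omega> (nat \<bar>v\<bar>) else 0))
      \<le> (\<Sum>v\<in>V. 16 * g v)" by (rule sum_mono) (rule row)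
  also have "(\<Sum>v\<in>V. 72 * y (nat \<bar>v\<bar>) * n v - 6 * n v - (if \<bar>v\<bar> \<le> int R then \<omega> (nat \<bar>v\<bar>) else 0))
      = 72 * (\<Sum>v\<in>V. y (nat \<bar>v\<bar>) * n v) - 6 * N - (\<Sum>v\<in>V. if \<bar>v\<bar> \<le> int R then \<omega> (nat \<bar>v\<bar>) else 0)"
    by (simp only: sum_subtractf N_def sum_distrib_left mult.assoc of_nat_mult of_nat_numeral)
  also have "(\<Sum>v\<in>V. y (nat \<bar>v\<bar>) * n v) = N - Q / (real R)\<^sup>2"
    unfolding N_def Q_def sum_divide_distrib sum_subtractf[symmetric]
    by (rule sum.cong) (simp_all add: y_def algebra_simps)
  finally have "72 * (N - Q / (real R)\<^sup>2) - 6 * N - 2 * (432 * (8 / 15 * R) + 9 * R) \<le> 16 * (\<Sum>v\<in>V. g v)"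
    using \<omega> by (simp add: sum_distrib_left)
  moreover have "72 * (Q / (real R)\<^sup>2) \<le> 15 * p"
  proof -
    have "real p \<le> 16 * real R + 15" using R(2) by linarith
    then have "62 / 1000 * real p \<le> real R" using p by linarith
    then have "(62 / 1000 * real p)\<^sup>2 \<le> (real R)\<^sup>2" by (intro power_mono) auto
    moreover have "(62 / 1000 :: real)\<^sup>2 = 961 / 250000" by (simp add: power2_eq_square)
    ultimately have "961 / 250000 * (real p)\<^sup>2 \<le> (real R)\<^sup>2" by (simp only: power_mult_distrib)
    then have "54 / 1000 * (real p)\<^sup>2 \<le> 15 * (real R)\<^sup>2"
      using zero_le_power2[of "real p"] by linarith
    then have "real p * (54 / 1000 * (real p)\<^sup>2) \<le> real p * (15 * (real R)\<^sup>2)" by (intro mult_left_mono) auto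
    moreover have "72 * Q \<le> real p * (54 / 1000 * (real p)\<^sup>2)" using Q by (simp add: power2_eq_square power3_eq_cube)
    ultimately have "72 * Q \<le> 15 * p * (real R)\<^sup>2" by simp
    then show ?thesis using R0 by (simp add: field_simps)
  qed
  moreover have "16 * real R \<le> p" using R by linarith
  \<comment> \<open>The balance is \<open>66 * p - 15 * p - 478.8 * R\<close> with
    \<open>16 * R \<le> p\<close>, which exceeds \<open>16 * p\<close>.\<close>
  ultimately have "real p \<le> (\<Sum>v\<in>V. g v)" using Np by simp
  then show ?thesis unfolding g_def of_nat_sum[symmetric] by (simp only: of_nat_le_iff)
qed

lemma isqrt_exists:
  obtains M :: nat where "M * M \<le> N" "N < (M + 1) * (M + 1)"
proof -
  have "\<exists>M :: nat. M * M \<le> N \<and> N < (M + 1) * (M + 1)"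
  proof (induction N)
    case (Suc N)
    then obtain M where M: "M * M \<le> N" "N < (M + 1) * (M + 1)" by blast
    show ?case
    proof (cases "Suc N < (M + 1) * (M + 1)")
      case True
      then show ?thesis using M by (intro exI[of _ M]) simp
    next
      case False
      then show ?thesis using M by (intro exI[of _ "M + 1"]) simp
    qed
  qed simp
  then show ?thesis using that by blast
qed

section \<open>Zero-sum free sets without a long row\<close>

context prime_modulus
begin

lemma zero_sum_free_small_rows:
  assumes p: "6000 < p" and fin: "finite S"
    and inj: "\<And>v. inj_mod x {s \<in> S. c s = v}"
    and zsf: "zero_sum_free c x S"
    and many: "p \<le> card {s \<in> S. c s \<noteq> 0}"
    and sq: "4000 * (\<Sum>s\<in>S. (c s)\<^sup>2) \<le> 3 * int p ^ 3"
    and small: "\<And>v. v \<noteq> 0 \<Longrightarrow> 11 * card {s \<in> S. c s = v} < p"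
  shows False
proof -
  define R where "R = (\<lambda>v. {s \<in> S. c s = v})"
  define n where "n = (\<lambda>v. card (R v))"
  define V where "V = c ` S - {0}"
  have finR: "finite (R v)" for v using fin by (simp add: R_def)
  have injR: "inj_mod x (R v)" for v using inj by (simp add: R_def)
  have finV: "finite V" using fin by (simp add: V_def)
  obtain M where M: "M * M \<le> 3 * p" "3 * p < (M + 1) * (M + 1)" by (rule isqrt_exists)
  define \<beta> where "\<beta> = (\<lambda>v. if v = 0 then 0 else min (n v) M div 4)"
  define g where "g = (\<lambda>v. if v = 0 then 0 else (min (n v) M div 4) * (min (n v) M - min (n v) M div 4))"
  define f where "f = (\<lambda>v. if v = 0 then 0 else n v - 2 * \<beta> v)"

  have rows: "min p (g v + 1) \<le> card_mod (k_sums x k {s \<in> S. c s = v})"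
    if k: "\<beta> v \<le> k" "k \<le> \<beta> v + f v" for v k
  proof (cases "v = 0")
    case True
    then have "k = 0" using k by (simp add: \<beta>_def f_def)
    then have "k_sums x k {s \<in> S. c s = v} \<noteq> {}" using fin by (intro k_sums_nonempty) auto
    then have "0 < card_mod (k_sums x k {s \<in> S. c s = v})" by (rule card_mod_pos)
    then show ?thesis using True by (simp add: g_def)
  next
    case False
    have "M * M < 4 * p" using M p by simp
    moreover have "min (n v) M div 4 \<le> k" "k + min (n v) M div 4 \<le> n v"
      using k False by (auto simp: \<beta>_def f_def)
    ultimately have "g v + 1 \<le> card_mod (k_sums x k (R v))"
      using card_mod_k_sums_quarter[OF finR[of v] injR[of v], of M k] False by (simp add: g_def n_def)
    then show ?thesis by (simp add: R_def)
  qed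

  have group: "(\<Sum>v\<in>V. n v * h v) = (\<Sum>s\<in>{s \<in> S. c s \<noteq> 0}. h (c s))" for h :: "int \<Rightarrow> nat"
  proof -
    have "(\<Sum>s\<in>{s \<in> S. c s \<noteq> 0}. h (c s)) = (\<Sum>v\<in>V. \<Sum>s\<in>{s \<in> {s \<in> S. c s \<noteq> 0}. c s = v}. h (c s))"
      by (rule sum.group[symmetric]) (use fin finV in \<open>auto simp: V_def\<close>)
    also have "\<dots> = (\<Sum>v\<in>V. n v * h v)"
    proof (rule sum.cong[OF refl])
      fix v assume "v \<in> V"
      then have "{s \<in> {s \<in> S. c s \<noteq> 0}. c s = v} = R v" by (auto simp: R_def V_def)
      moreover have "(\<Sum>s\<in>R v. h (c s)) = (\<Sum>s\<in>R v. h v)" by (rule sum.cong) (auto simp: R_def)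
      ultimately show "(\<Sum>s\<in>{s \<in> {s \<in> S. c s \<noteq> 0}. c s = v}. h (c s)) = n v * h v" by (simp add: n_def)
    qed
    finally show ?thesis by simp
  qed

  have gain: "p - 1 \<le> (\<Sum>v\<in>c ` S. g v)"
  proof -
    have "p \<le> (\<Sum>v\<in>V. (min (n v) M div 4) * (min (n v) M - min (n v) M div 4))"
    proof (rule quarter_gain_sum[OF p M finV])
      show "0 \<notin> V" by (simp add: V_def)
      show "11 * n v < p" if "v \<in> V" for v using small[of v] that by (simp add: V_def n_def R_def)
      show "p \<le> (\<Sum>v\<in>V. n v)" using group[of "\<lambda>_. 1"] many by simp
      have "(\<Sum>v\<in>V. int (n v) * v\<^sup>2) = int (\<Sum>v\<in>V. n v * nat (v\<^sup>2))" by simp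
      also have "\<dots> = (\<Sum>s\<in>{s \<in> S. c s \<noteq> 0}. (c s)\<^sup>2)" unfolding group by simp
      also have "\<dots> \<le> (\<Sum>s\<in>S. (c s)\<^sup>2)" by (rule sum_mono2) (use fin in auto)
      finally show "4000 * (\<Sum>v\<in>V. int (n v) * v\<^sup>2) \<le> 3 * int p ^ 3" using sq by simp
    qed
    also have "\<dots> = (\<Sum>v\<in>V. g v)" by (rule sum.cong) (auto simp: g_def V_def)
    also have "\<dots> \<le> (\<Sum>v\<in>c ` S. g v)" by (rule sum_mono2) (use fin in \<open>auto simp: V_def\<close>)
    finally show ?thesis by simp
  qed

  \<comment> \<open>\<open>T\<close> receives half of each row, rounded up, which is free since at
    most a quarter is reserved at each end. Rows with \<open>4 * \<bar>v\<bar> \<ge> p\<close> are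
    left out because the quadruples require small absolute values.\<close>
  define V4 where "V4 = {v \<in> V. 4 * \<bar>v\<bar> < int p}"
  have finV4: "finite V4" using finV by (simp add: V4_def)
  have "\<forall>v. \<exists>A. A \<subseteq> R v \<and> card A = (n v + 1) div 2"
  proof
    fix v
    have "(n v + 1) div 2 \<le> card (R v)" unfolding n_def by linarith
    then show "\<exists>A. A \<subseteq> R v \<and> card A = (n v + 1) div 2" by (meson obtain_subset_with_card_n)
  qed
  then obtain A where A: "\<And>v. A v \<subseteq> R v" "\<And>v. card (A v) = (n v + 1) div 2" by metis
  have finA: "finite (A v)" for v using A(1) finR finite_subset by blast
  define T where "T = (\<Union>v\<in>V4. A v)"
  have TS: "T \<subseteq> S" using A(1) by (force simp: T_def R_def)
  have finT: "finite T" using TS fin finite_subset by blast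
  have Tc: "c s \<in> V4 \<and> s \<in> A (c s)" if "s \<in> T" for s
    using that A(1) by (force simp: T_def R_def)
  have Trow: "card {s \<in> T. c s = v} \<le> (n v + 1) div 2" for v
  proof -
    have "{s \<in> T. c s = v} \<subseteq> A v" using Tc by auto
    then show ?thesis using card_mono[OF finA] A(2) by metis
  qed
  have Tf: "card {s \<in> T. c s = v} \<le> f v" for v
  proof (cases "v = 0")
    case True
    then have "{s \<in> T. c s = v} = {}" using Tc by (auto simp: V4_def V_def)
    then show ?thesis by (simp only: card.empty le0)
  next
    case False
    have "(n v + 1) div 2 \<le> n v - 2 * (min (n v) M div 4)" by linarith
    then show ?thesis using Trow[of v] False by (simp add: f_def \<beta>_def)
  qed

  \<comment> \<open>The quadruples must satisfy \<open>10 * t + 1 \<ge> p\<close>. A value of |c|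
    comes from at most two rows, each contributing at most about \<open>p / 22\<close> elements to
    \<open>T\<close>, so \<open>t\<close> also bounds the multiplicities.\<close>
  define t where "t = p div 10 + 1"
  have mult: "card {s \<in> T. \<bar>c s\<bar> = v} \<le> t" for v
  proof -
    have half: "22 * card {s \<in> T. c s = w} \<le> p + 11" for w
    proof (cases "w = 0")
      case True
      then have "{s \<in> T. c s = w} = {}" using Tc by (auto simp: V4_def V_def)
      then show ?thesis by (simp only: card.empty)
    next
      case False
      then show ?thesis using Trow[of w] small[of w] by (simp add: n_def R_def)
    qed
    have "{s \<in> T. \<bar>c s\<bar> = v} \<subseteq> {s \<in> T. c s = v} \<union> {s \<in> T. c s = - v}" by auto
    then have "card {s \<in> T. \<bar>c s\<bar> = v} \<le> card ({s \<in> T. c s = v} \<union> {s \<in> T. c s = - v})"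
      by (rule card_mono[rotated]) (use finT in auto)
    also have "\<dots> \<le> card {s \<in> T. c s = v} + card {s \<in> T. c s = - v}" by (rule card_Un_le)
    finally have "22 * card {s \<in> T. \<bar>c s\<bar> = v} \<le> 2 * p + 22"
      using half[of v] half[of "- v"] by linarith
    then show ?thesis unfolding t_def using p by linarith
  qed

  have cT: "4 * t \<le> card T"
  proof -
    have "card T = (\<Sum>v\<in>V4. card (A v))"
      unfolding T_def
    proof (rule card_UN_disjoint[OF finV4])
      show "\<forall>i\<in>V4. \<forall>j\<in>V4. i \<noteq> j \<longrightarrow> A i \<inter> A j = {}" 
      proof (intro ballI impI)
        fix i j :: int assume "i \<noteq> j"
        then have "R i \<inter> R j = {}" by (auto simp: R_def)
        then show "A i \<inter> A j = {}" using A(1)[of i] A(1)[of j] by blast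
      qed
    qed (use finA in auto)
    then have "2 * card T = (\<Sum>v\<in>V4. 2 * ((n v + 1) div 2))" by (simp add: A sum_distrib_left)
    moreover have "(\<Sum>v\<in>V4. n v) \<le> (\<Sum>v\<in>V4. 2 * ((n v + 1) div 2))" by (rule sum_mono) linarith
    moreover have "(\<Sum>v\<in>V4. n v) = card {s \<in> S. c s \<noteq> 0 \<and> 4 * \<bar>c s\<bar> < int p}"
    proof -
      have "(\<Sum>v\<in>V4. n v) = (\<Sum>v\<in>V. n v * (if 4 * \<bar>v\<bar> < int p then 1 else 0))"
        unfolding V4_def using finV by (intro sum.mono_neutral_cong_left) auto
      also have "\<dots> = (\<Sum>s\<in>{s \<in> S. c s \<noteq> 0}. if 4 * \<bar>c s\<bar> < int p then 1 else 0)" by (rule group)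
      also have "\<dots> = card {s \<in> {s \<in> S. c s \<noteq> 0}. 4 * \<bar>c s\<bar> < int p}"
        using fin by (simp add: sum.If_cases Int_def)
      finally show ?thesis by (simp add: conj_assoc)
    qed
    moreover have "card {s \<in> S. c s \<noteq> 0} \<le> card {s \<in> S. c s \<noteq> 0 \<and> 4 * \<bar>c s\<bar> < int p} + card {s \<in> S. int p \<le> 4 * \<bar>c s\<bar>}"
    proof -
      have "{s \<in> S. c s \<noteq> 0} \<subseteq> {s \<in> S. c s \<noteq> 0 \<and> 4 * \<bar>c s\<bar> < int p} \<union> {s \<in> S. int p \<le> 4 * \<bar>c s\<bar>}" by auto
      then have "card {s \<in> S. c s \<noteq> 0} \<le> card ({s \<in> S. c s \<noteq> 0 \<and> 4 * \<bar>c s\<bar> < int p} \<union> {s \<in> S. int p \<le> 4 * \<bar>c s\<bar>})"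
        by (rule card_mono[rotated]) (use fin in auto)
      also have "\<dots> \<le> card {s \<in> S. c s \<noteq> 0 \<and> 4 * \<bar>c s\<bar> < int p} + card {s \<in> S. int p \<le> 4 * \<bar>c s\<bar>}" by (rule card_Un_le)
      finally show ?thesis .
    qed
    \<comment> \<open>Each such element contributes at least \<open>p * p / 16\<close> to the second
      moment, and \<open>16 * 3 = 48\<close>.\<close>
    moreover have "4000 * card {s \<in> S. int p \<le> 4 * \<bar>c s\<bar>} \<le> 48 * p"
    proof -
      define B where "B = {s \<in> S. int p \<le> 4 * \<bar>c s\<bar>}"
      have "(int p)\<^sup>2 \<le> 16 * (c s)\<^sup>2" if "s \<in> B" for s
      proof -
        have "(int p)\<^sup>2 \<le> (4 * \<bar>c s\<bar>)\<^sup>2" using that by (intro power_mono) (auto simp: B_def)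
        then show ?thesis by (simp add: power_mult_distrib)
      qed
      then have "(\<Sum>s\<in>B. (int p)\<^sup>2) \<le> (\<Sum>s\<in>B. 16 * (c s)\<^sup>2)" by (rule sum_mono)
      also have "\<dots> \<le> (\<Sum>s\<in>S. 16 * (c s)\<^sup>2)" by (rule sum_mono2) (use fin in \<open>auto simp: B_def\<close>)
      also have "\<dots> = 16 * (\<Sum>s\<in>S. (c s)\<^sup>2)" by (simp add: sum_distrib_left)
      finally have "int (card B) * (int p)\<^sup>2 \<le> 16 * (\<Sum>s\<in>S. (c s)\<^sup>2)" by simp
      then have "4000 * (int (card B) * (int p)\<^sup>2) \<le> 48 * int p ^ 3" using sq by linarith
      then have "4000 * int (card B) * (int p)\<^sup>2 \<le> 48 * int p * (int p)\<^sup>2"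
        by (simp add: power2_eq_square power3_eq_cube mult.assoc)
      then have "4000 * int (card B) \<le> 48 * int p" using p by (simp add: mult_le_cancel_right)
      then show ?thesis unfolding B_def by linarith
    qed
    ultimately have bound: "2000 * p \<le> 4000 * card T + 24 * p" using many by linarith
    have t10: "10 * t \<le> p + 10" by (simp add: t_def)
    show ?thesis
    proof (rule ccontr)
      assume "\<not> ?thesis"
      then have "card T < 4 * t" by simp
      then show False using bound t10 p by linarith
    qed
  qed

  have "min p (10 * t + 1) \<le> card_mod (subset_sums c T)"
    by (rule card_mod_subset_sums_quadruples[OF finT mult cT]) (use Tc in \<open>auto simp: V4_def V_def\<close>)
  moreover have "p \<le> 10 * t + 1" using dividend_less_times_div[of 10 p] by (simp add: t_def)
  ultimately have "p \<le> card_mod (subset_sums c T)" by simp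
  then have "\<not> zero_sum_free c x S"
    by (intro zero_sum_from_rows[OF fin rows gain TS Tf])
  then show False using zsf by simp
qed

end

section \<open>Concentration of zero-sum free sets\<close>

text \<open>The derivative of \<open>cos t * exp (t\<^sup>2 / 2)\<close> has the sign of
  \<open>t * cos t - sin t\<close>, which is not positive between \<open>0\<close> and
  \<open>pi / 2\<close>.\<close>

lemma cos_le_exp:
  fixes t :: real
  assumes "\<bar>t\<bar> \<le> pi / 2"
  shows "cos t \<le> exp (- t\<^sup>2 / 2)"
proof -
  define f where "f = (\<lambda>t :: real. cos t * exp (t\<^sup>2 / 2))"
  have tan: "x * cos x \<le> sin x" if "0 \<le> x" "x \<le> pi / 2" for x :: real
  proof -
    have "sin 0 - 0 * cos 0 \<le> sin x - x * cos x"
    proof (rule DERIV_nonneg_imp_nondecreasing[OF that(1)])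
      fix z assume z: "0 \<le> z" "z \<le> x"
      have "((\<lambda>z. sin z - z * cos z) has_real_derivative z * sin z) (at z)"
        by (auto intro!: derivative_eq_intros)
      moreover have "0 \<le> z * sin z" using z that by (intro mult_nonneg_nonneg sin_ge_zero) auto
      ultimately show "\<exists>y. ((\<lambda>z. sin z - z * cos z) has_real_derivative y) (at z) \<and> 0 \<le> y" by blast
    qed
    then show ?thesis by simp
  qed
  have "f \<bar>t\<bar> \<le> f 0"
  proof (rule DERIV_nonpos_imp_nonincreasing[where f = f and a = 0 and b = "\<bar>t\<bar>"])
    fix z assume z: "0 \<le> z" "z \<le> \<bar>t\<bar>"
    have "(f has_real_derivative (exp (z\<^sup>2 / 2) * (z * cos z - sin z))) (at z)"
      unfolding f_def by (auto intro!: derivative_eq_intros simp: algebra_simps)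
    moreover have "exp (z\<^sup>2 / 2) * (z * cos z - sin z) \<le> 0"
      using tan[of z] z assms by (intro mult_nonneg_nonpos) auto
    ultimately show "\<exists>y. (f has_real_derivative y) (at z) \<and> y \<le> 0" by blast
  qed simp
  then have "cos t * exp (t\<^sup>2 / 2) \<le> 1" by (simp add: f_def)
  then show ?thesis by (simp add: exp_minus field_simps)
qed

text \<open>Since \<open>exp 9 \<ge> 6000\<close>, the line through the origin and the point (6000,
  9) is above \<open>ln\<close> at 6000, and by concavity it stays above.\<close>

lemma ln_le_linear:
  fixes x :: real
  assumes "6000 \<le> x"
  shows "ln x \<le> 3 / 2000 * x"
proof -
  have "(13 / 8 :: real) \<le> exp (1 / 2)"
    using exp_lower_Taylor_quadratic[of "1 / 2"] by (simp add: power2_eq_square)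
  then have "(13 / 8 :: real) ^ 18 \<le> exp (1 / 2) ^ 18" by (intro power_mono) auto
  also have "exp (1 / 2) ^ 18 = exp (9 :: real)" by (simp add: exp_of_nat_mult[symmetric])
  finally have "(6000 :: real) \<le> exp 9" by (simp add: eval_nat_numeral)
  then have "ln 6000 \<le> ln (exp (9 :: real))" by (subst ln_le_cancel_iff) auto
  then have "ln 6000 \<le> (9 :: real)" by simp
  moreover have "ln (x / 6000) \<le> x / 6000 - 1" using assms by (intro ln_le_minus_one) simp
  moreover have "ln (x / 6000) = ln x - ln 6000" using assms by (simp add: ln_div)
  ultimately show ?thesis using assms by simp
qed

lemma one_plus_cis: "1 + cis t = of_real (2 * cos (t / 2)) * cis (t / 2)"
proof (rule complex_eqI)
  show "Re (1 + cis t) = Re (of_real (2 * cos (t / 2)) * cis (t / 2))"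
    using cos_double_cos[of "t / 2"] by (simp add: power2_eq_square)
  show "Im (1 + cis t) = Im (of_real (2 * cos (t / 2)) * cis (t / 2))"
    using sin_double[of "t / 2"] by simp
qed

lemma power4_less_two_power: "17 \<le> n \<Longrightarrow> n ^ 4 < (2 :: nat) ^ n"
proof (induction n rule: nat_induct_at_least)
  case (Suc n)
  have "Suc n ^ 4 = n ^ 4 + 4 * n ^ 3 + 6 * n ^ 2 + 4 * n + 1"
    by (simp add: eval_nat_numeral algebra_simps)
  moreover have "n ^ 4 = n * n ^ 3" "n ^ 3 = n * n ^ 2" "n ^ 2 = n * n"
    by (simp_all add: eval_nat_numeral)
  moreover have "17 * n ^ 3 \<le> n * n ^ 3" "17 * n ^ 2 \<le> n * n ^ 2" "17 * n \<le> n * n"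
    using Suc.hyps by (intro mult_le_mono1; simp)+
  ultimately have "Suc n ^ 4 \<le> 2 * n ^ 4" using Suc.hyps by linarith
  then show ?case using Suc.IH by simp
qed simp

section \<open>Characters modulo p and the large Fourier coefficient\<close>

context prime_modulus
begin

definition unity :: "int \<Rightarrow> complex" where
  "unity k = cis (2 * pi * real_of_int k / real p)"

lemma unity_add: "unity (k + l) = unity k * unity l"
  by (simp add: unity_def cis_mult add_divide_distrib ring_distribs)

lemma unity_sum: "unity (\<Sum>i\<in>A. h i) = (\<Prod>i\<in>A. unity (h i))"
proof (induction A rule: infinite_finite_induct)
  case (insert x F)
  then show ?case by (simp add: unity_add)
qed (simp_all add: unity_def)

lemma unity_eq_1_iff: "unity k = 1 \<longleftrightarrow> int p dvd k"
proof
  assume "unity k = 1"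
  then have "cos (2 * pi * real_of_int k / real p) = 1" by (simp add: unity_def complex_eq_iff)
  then obtain n :: int where "2 * pi * real_of_int k / real p = real_of_int n * 2 * pi"
    using cos_one_2pi_int by blast
  then have "real_of_int k = real_of_int (n * int p)" using p_pos by (simp add: field_simps)
  then have "k = n * int p" by (simp only: of_int_eq_iff)
  then show "int p dvd k" by simp
next
  assume "int p dvd k"
  then obtain n where "k = int p * n" by blast
  then have "2 * pi * real_of_int k / real p = 2 * pi * real_of_int n" using p_pos by simp
  then show "unity k = 1" by (simp only: unity_def cis_multiple_2pi Ints_of_int)
qed

lemma unity_mult_nat: "unity (int u * k) = unity k ^ u"
  by (induction u) (simp_all add: unity_add ring_distribs unity_eq_1_iff)

lemma sum_unity: "(\<Sum>u<p. unity (int u * k)) = (if int p dvd k then of_nat p else 0)"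
proof (cases "int p dvd k")
  case True
  then have "unity (int u * k) = 1" for u using unity_eq_1_iff by simp
  then show ?thesis using True by simp
next
  case False
  then have "unity k \<noteq> 1" using unity_eq_1_iff by simp
  moreover have "unity k ^ p = 1" unfolding unity_mult_nat[symmetric] unity_eq_1_iff by simp
  ultimately show ?thesis using False by (simp add: unity_mult_nat geometric_sum)
qed

lemma unity_cong: "int p dvd k - l \<Longrightarrow> unity k = unity l"
  using unity_add[of "k - l" l] unity_eq_1_iff[of "k - l"] by simp

text \<open>The norm is twice the cosine of \<open>pi * k / p\<close>; the constant \<open>4\<close>
  comes from \<open>pi \<ge> 3\<close>, which gives \<open>pi\<^sup>2 / 2 \<ge> 4\<close>.\<close>

lemma norm_one_plus_unity:
  assumes "2 * \<bar>k\<bar> < int p"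
  shows "norm (1 + unity k) \<le> 2 * exp (- 4 * (real_of_int k)\<^sup>2 / (real p)\<^sup>2)"
proof -
  define t where "t = pi * real_of_int k / real p"
  have pr: "0 < real p" using p_pos by simp
  have "2 * \<bar>real_of_int k\<bar> \<le> real p" using assms by linarith
  then have "pi * (2 * \<bar>real_of_int k\<bar>) \<le> pi * real p" by (intro mult_left_mono) auto
  then have t: "\<bar>t\<bar> \<le> pi / 2" using pr by (simp add: t_def abs_mult field_simps)
  have "norm (1 + unity k) = 2 * \<bar>cos t\<bar>"
    unfolding unity_def one_plus_cis by (simp add: t_def norm_mult)
  also have "\<bar>cos t\<bar> = cos t" using t by (intro abs_of_nonneg cos_ge_zero) auto
  also have "cos t \<le> exp (- t\<^sup>2 / 2)" by (rule cos_le_exp[OF t])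
  also have "exp (- t\<^sup>2 / 2) \<le> exp (- 4 * (real_of_int k)\<^sup>2 / (real p)\<^sup>2)"
  proof -
    have "3 \<le> pi" using sin_x_le_x[of "pi / 6"] sin_30 by simp
    then have "(3 :: real)\<^sup>2 \<le> pi\<^sup>2" by (intro power_mono) auto
    then have "8 * ((real_of_int k)\<^sup>2 / (real p)\<^sup>2) \<le> pi\<^sup>2 * ((real_of_int k)\<^sup>2 / (real p)\<^sup>2)"
      by (intro mult_right_mono) auto
    moreover have "t\<^sup>2 = pi\<^sup>2 * ((real_of_int k)\<^sup>2 / (real p)\<^sup>2)"
      by (simp add: t_def power_mult_distrib power_divide)
    ultimately have "- t\<^sup>2 / 2 \<le> - 4 * ((real_of_int k)\<^sup>2 / (real p)\<^sup>2)" by linarith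
    then show ?thesis by simp
  qed
  finally show ?thesis by simp
qed

text \<open>The product expands over the subsets of \<open>S\<close>, and summing over
  \<open>u\<close> and \<open>w\<close> retains those with both sums divisible by \<open>p\<close>.
  Only the empty set is left.\<close>

lemma sum_prod_unity:
  assumes fin: "finite S" and zsf: "zero_sum_free f g S"
  shows "(\<Sum>(u, w)\<in>{..<p} \<times> {..<p}. \<Prod>s\<in>S. 1 + unity (int u * f s + int w * g s)) = of_nat (p * p)"
proof -
  have "(\<Prod>s\<in>S. 1 + unity (int u * f s + int w * g s))
      = (\<Sum>X\<in>Pow S. unity (int u * sum f X) * unity (int w * sum g X))" for u w
  proof -
    have "(\<Prod>s\<in>S. unity (int u * f s + int w * g s) + 1)
        = (\<Sum>X\<in>Pow S. (\<Prod>s\<in>X. unity (int u * f s + int w * g s)) * (\<Prod>s\<in>S - X. 1))"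
      by (rule prod_add[OF fin])
    also have "\<dots> = (\<Sum>X\<in>Pow S. unity (int u * sum f X) * unity (int w * sum g X))"
      by (simp add: unity_sum[symmetric] unity_add[symmetric] sum.distrib sum_distrib_left)
    finally show ?thesis by (simp add: add.commute)
  qed
  then have "(\<Sum>(u, w)\<in>{..<p} \<times> {..<p}. \<Prod>s\<in>S. 1 + unity (int u * f s + int w * g s))
      = (\<Sum>u<p. \<Sum>w<p. \<Sum>X\<in>Pow S. unity (int u * sum f X) * unity (int w * sum g X))"
    unfolding sum.cartesian_product[symmetric] by simp
  also have "\<dots> = (\<Sum>u<p. \<Sum>X\<in>Pow S. \<Sum>w<p. unity (int u * sum f X) * unity (int w * sum g X))"
    by (intro sum.cong refl sum.swap)
  also have "\<dots> = (\<Sum>X\<in>Pow S. \<Sum>u<p. \<Sum>w<p. unity (int u * sum f X) * unity (int w * sum g X))"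
    by (rule sum.swap)
  also have "\<dots> = (\<Sum>X\<in>Pow S. (\<Sum>u<p. unity (int u * sum f X)) * (\<Sum>w<p. unity (int w * sum g X)))"
    by (simp add: sum_product)
  also have "\<dots> = (\<Sum>X\<in>Pow S. if X = {} then of_nat (p * p) else 0)"
  proof (rule sum.cong[OF refl])
    fix X assume "X \<in> Pow S"
    then show "(\<Sum>u<p. unity (int u * sum f X)) * (\<Sum>w<p. unity (int w * sum g X))
        = (if X = {} then of_nat (p * p) else 0)"
      using zsf by (auto simp: sum_unity zero_sum_free_def)
  qed
  also have "\<dots> = of_nat (p * p)" using fin by simp
  finally show ?thesis .
qed

text \<open>The term at \<open>(0, 0)\<close> is \<open>2 ^ card S\<close>, far more than the total
  \<open>p * p\<close>, so the other \<open>p * p - 1\<close> terms must nearly cancel it. If all of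
  them were small, \<open>2 ^ card S \<le> p ^ 4\<close> would follow.\<close>

lemma large_fourier_coefficient:
  assumes p: "17 \<le> p" and fin: "finite S" and cS: "p \<le> card S" and zsf: "zero_sum_free f g S"
  obtains u w where "u < p" "w < p" "(u, w) \<noteq> (0, 0)"
    "2 ^ card S / (real p)\<^sup>2 \<le> (\<Prod>s\<in>S. norm (1 + unity (int u * f s + int w * g s)))"
proof -
  define F where "F = (\<lambda>(u, w). \<Prod>s\<in>S. 1 + unity (int u * f s + int w * g s))"
  define P where "P = {..<p} \<times> {..<p}"
  have P0: "(0, 0) \<in> P" "finite P" using p by (auto simp: P_def)
  have F0: "F (0, 0) = 2 ^ card S" by (simp add: F_def unity_def)
  have "\<exists>q\<in>P - {(0, 0)}. 2 ^ card S / (real p)\<^sup>2 \<le> norm (F q)"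
  proof (rule ccontr)
    assume "\<not> ?thesis"
    then have small: "norm (F q) \<le> 2 ^ card S / (real p)\<^sup>2" if "q \<in> P - {(0, 0)}" for q
      using that by force
    have "(\<Sum>q\<in>P. F q) = of_nat (p * p)" using sum_prod_unity[OF fin zsf] by (simp add: P_def F_def)
    then have "F (0, 0) = of_nat (p * p) - (\<Sum>q\<in>P - {(0, 0)}. F q)"
      using P0 by (simp add: sum.remove eq_diff_eq)
    then have "norm (F (0, 0)) \<le> norm (of_nat (p * p) :: complex) + norm (\<Sum>q\<in>P - {(0, 0)}. F q)"
      by (simp only: norm_triangle_ineq4)
    also have "norm (\<Sum>q\<in>P - {(0, 0)}. F q) \<le> (\<Sum>q\<in>P - {(0, 0)}. 2 ^ card S / (real p)\<^sup>2)"
      by (rule sum_norm_le) (rule small)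
    also have "\<dots> = real (p * p - 1) * (2 ^ card S / (real p)\<^sup>2)"
      using P0 by (simp add: card_Diff_subset P_def card_cartesian_product)
    finally have "2 ^ card S \<le> real (p * p) + real (p * p - 1) * (2 ^ card S / (real p)\<^sup>2)"
      by (simp add: F0 norm_power norm_mult)
    also have "real (p * p - 1) = (real p)\<^sup>2 - 1"
      using p by (simp add: of_nat_diff power2_eq_square)
    finally have "2 ^ card S / (real p)\<^sup>2 \<le> (real p)\<^sup>2"
      using p by (simp add: field_simps power2_eq_square)
    then have "2 ^ card S \<le> (real p) ^ 4" using p by (simp add: field_simps eval_nat_numeral)
    then have "real (2 ^ card S) \<le> real (p ^ 4)" by simp
    then have "2 ^ card S \<le> p ^ 4" by (simp only: of_nat_le_iff)
    moreover have "(2 :: nat) ^ p \<le> 2 ^ card S" using cS by (intro power_increasing) auto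
    ultimately show False using power4_less_two_power[OF p] by simp
  qed
  then obtain q where q: "q \<in> P - {(0, 0)}" "2 ^ card S / (real p)\<^sup>2 \<le> norm (F q)" by blast
  obtain u w where "q = (u, w)" by (cases q)
  then show ?thesis using that[of u w] q by (simp add: P_def F_def prod_norm)
qed

lemma zero_sum_free_concentrated:
  assumes p: "6000 < p" and fin: "finite S" and cS: "p \<le> card S" and zsf: "zero_sum_free f g S"
  obtains u w c where "\<not> (int p dvd u \<and> int p dvd w)"
    "\<And>s. int p dvd c s - (u * f s + w * g s)" "\<And>s. 2 * \<bar>c s\<bar> < int p"
    "4000 * (\<Sum>s\<in>S. (c s)\<^sup>2) \<le> 3 * int p ^ 3"
proof -
  obtain u w where uw: "u < p" "w < p" "(u, w) \<noteq> (0, 0)"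
    "2 ^ card S / (real p)\<^sup>2 \<le> (\<Prod>s\<in>S. norm (1 + unity (int u * f s + int w * g s)))"
    using large_fourier_coefficient[OF _ fin cS zsf] p by auto
  define h where "h = (int p - 1) div 2"
  have "odd p" using prime_p p prime_odd_nat by simp
  then have h: "2 * h = int p - 1" by (simp add: h_def)
  \<comment> \<open>The shift by \<open>h\<close> takes residues in the symmetric interval from
    \<open>- h\<close> to \<open>h\<close>, where the Gaussian bound for the factors is
    valid.\<close>
  define c where "c = (\<lambda>s. (int u * f s + int w * g s + h) mod int p - h)"
  have cd: "int p dvd c s - (int u * f s + int w * g s)" for s
  proof -
    let ?y = "int u * f s + int w * g s + h"
    have "int p dvd ?y mod int p - ?y" unfolding mod_eq_iff_dvd[symmetric] by simp
    then show ?thesis by (simp add: c_def algebra_simps)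
  qed
  have cb: "2 * \<bar>c s\<bar> < int p" for s
  proof -
    have "0 \<le> (int u * f s + int w * g s + h) mod int p" "(int u * f s + int w * g s + h) mod int p < int p"
      using p_pos by auto
    moreover have "2 * \<bar>z - h\<bar> < int p" if "0 \<le> z" "z < int p" for z
      using that h by (simp add: abs_if)
    ultimately show ?thesis by (simp add: c_def)
  qed
  define Q where "Q = (\<Sum>s\<in>S. (real_of_int (c s))\<^sup>2)"
  have "(\<Prod>s\<in>S. norm (1 + unity (int u * f s + int w * g s))) = (\<Prod>s\<in>S. norm (1 + unity (c s)))"
    using unity_cong[OF cd] by simp
  also have "\<dots> \<le> (\<Prod>s\<in>S. 2 * exp (- 4 * (real_of_int (c s))\<^sup>2 / (real p)\<^sup>2))"
    by (intro prod_mono) (use norm_one_plus_unity[OF cb] in auto)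
  also have "\<dots> = 2 ^ card S * exp (\<Sum>s\<in>S. - 4 * (real_of_int (c s))\<^sup>2 / (real p)\<^sup>2)"
    using fin by (simp add: prod.distrib exp_sum)
  also have "(\<Sum>s\<in>S. - 4 * (real_of_int (c s))\<^sup>2 / (real p)\<^sup>2) = - 4 * Q / (real p)\<^sup>2"
    by (simp add: Q_def sum_distrib_left sum_divide_distrib sum_negf)
  finally have "2 ^ card S / (real p)\<^sup>2 \<le> 2 ^ card S * exp (- 4 * Q / (real p)\<^sup>2)" using uw(4) by linarith
  then have "1 / (real p)\<^sup>2 \<le> exp (- 4 * Q / (real p)\<^sup>2)" by (simp add: divide_inverse)
  then have "ln (1 / (real p)\<^sup>2) \<le> ln (exp (- 4 * Q / (real p)\<^sup>2))"
    using p by (subst ln_le_cancel_iff) auto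
  then have "ln (1 / (real p)\<^sup>2) \<le> - 4 * Q / (real p)\<^sup>2" by simp
  then have "4 * Q / (real p)\<^sup>2 \<le> 2 * ln (real p)" using p by (simp add: ln_div ln_realpow)
  also have "\<dots> \<le> 2 * (3 / 2000 * real p)" using ln_le_linear[of "real p"] p by simp
  finally have "4000 * Q \<le> 3 * real p ^ 3" using p by (simp add: field_simps power2_eq_square power3_eq_cube)
  moreover have "real_of_int (4000 * (\<Sum>s\<in>S. (c s)\<^sup>2)) = 4000 * Q" by (simp add: Q_def)
  ultimately have "real_of_int (4000 * (\<Sum>s\<in>S. (c s)\<^sup>2)) \<le> real_of_int (3 * int p ^ 3)" by simp
  then have "4000 * (\<Sum>s\<in>S. (c s)\<^sup>2) \<le> 3 * int p ^ 3" by (simp only: of_int_le_iff)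
  moreover have "\<not> (int p dvd int u \<and> int p dvd int w)"
    using uw by (auto dest: dvd_imp_le)
  ultimately show ?thesis using that cd cb by blast
qed

end

section \<open>The Olson constant\<close>

context prime_modulus
begin

lemma zero_sum_free_card_less:
  fixes f g :: "'a \<Rightarrow> int"
  assumes p: "6000 < p" and fin: "finite S"
    and inj: "\<And>s t. s \<in> S \<Longrightarrow> t \<in> S \<Longrightarrow> int p dvd f s - f t \<Longrightarrow> int p dvd g s - g t \<Longrightarrow> s = t"
    and zsf: "zero_sum_free f g S"
    and m: "11 \<le> m" "\<And>(X :: 'a set) x. finite X \<Longrightarrow> inj_mod x X \<Longrightarrow> card X = m \<Longrightarrow>
      \<exists>Z\<subseteq>X. Z \<noteq> {} \<and> int p dvd sum x Z"
    and cS: "card S = p - 1 + m"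
  shows False
proof -
  have "p \<le> card S" using cS m by simp
  then obtain u w c where uw: "\<not> (int p dvd u \<and> int p dvd w)"
    and c: "\<And>s. int p dvd c s - (u * f s + w * g s)" "\<And>s. 2 * \<bar>c s\<bar> < int p"
    and sq: "4000 * (\<Sum>s\<in>S. (c s)\<^sup>2) \<le> 3 * int p ^ 3"
    by (rule zero_sum_free_concentrated[OF p fin _ zsf]) blast
  \<comment> \<open>\<open>x\<close> completes \<open>c\<close>, which is
    \<open>u * f + w * g\<close> modulo \<open>p\<close>, to a pair of coordinates: if
    \<open>p\<close> divides \<open>u\<close>, then \<open>c\<close> determines \<open>g\<close> and
    \<open>f\<close> is added; otherwise \<open>c\<close> and \<open>g\<close> determine
    \<open>f\<close>.\<close>
  define x where "x = (if int p dvd u then f else g)"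
  have solve: "int p dvd a" "int p dvd b" if "int p dvd u * a + w * b" "int p dvd (if int p dvd u then a else b)" for a b
  proof -
    have "int p dvd a \<and> int p dvd b"
    proof (cases "int p dvd u")
      case True
      then have "int p dvd a" "int p dvd w * b" using that by (simp_all add: dvd_add_right_iff)
      then show ?thesis using uw True prime_dvd_mult_iff[OF prime_int_p] by blast
    next
      case False
      then have "int p dvd b" "int p dvd u * a" using that by (simp_all add: dvd_add_left_iff)
      then show ?thesis using False prime_dvd_mult_iff[OF prime_int_p] by blast
    qed
    then show "int p dvd a" "int p dvd b" by auto
  qed
  have csum: "int p dvd sum c Z \<longleftrightarrow> int p dvd u * sum f Z + w * sum g Z" for Z
  proof -
    have "int p dvd (\<Sum>s\<in>Z. c s - (u * f s + w * g s))" by (rule dvd_sum) (rule c(1))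
    then have "int p dvd sum c Z - (u * sum f Z + w * sum g Z)"
      by (simp add: sum_subtractf sum.distrib sum_distrib_left)
    then have "sum c Z mod int p = (u * sum f Z + w * sum g Z) mod int p"
      using mod_eq_iff_dvd by blast
    then show ?thesis by (simp only: dvd_eq_mod_eq_0)
  qed
  have injcx: "s = t" if st: "s \<in> S" "t \<in> S" "int p dvd c s - c t" "int p dvd x s - x t" for s t
  proof -
    have "int p dvd (c s - c t) - (c s - (u * f s + w * g s)) + (c t - (u * f t + w * g t))"
      by (rule dvd_add[OF dvd_diff[OF st(3) c(1)] c(1)])
    also have "(c s - c t) - (c s - (u * f s + w * g s)) + (c t - (u * f t + w * g t))
      = u * (f s - f t) + w * (g s - g t)" by (simp add: algebra_simps)
    finally have "int p dvd f s - f t" "int p dvd g s - g t"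
      using solve[of "f s - f t" "g s - g t"] st(4) by (auto simp: x_def split: if_splits)
    then show ?thesis using inj st by blast
  qed
  have zsfcx: "zero_sum_free c x S"
    unfolding zero_sum_free_def
  proof (intro allI impI notI)
    fix Z assume Z: "Z \<subseteq> S" "Z \<noteq> {}" "int p dvd sum c Z" "int p dvd sum x Z"
    then have "int p dvd sum f Z" "int p dvd sum g Z"
      using solve[of "sum f Z" "sum g Z"] csum by (auto simp: x_def split: if_splits)
    then show False using zsf Z by (simp add: zero_sum_free_def)
  qed
  \<comment> \<open>Numbers of absolute value below \<open>p / 2\<close> are congruent only if
    equal, so rows modulo \<open>p\<close> are rows of the integer-valued \<open>c\<close>.\<close>
  have zero: "int p dvd c s - v \<longleftrightarrow> c s = v" if "2 * \<bar>v\<bar> < int p" for s v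
  proof
    assume "int p dvd c s - v"
    moreover have "\<bar>c s - v\<bar> < int p" using c(2)[of s] that by linarith
    ultimately show "c s = v" using dvd_imp_le_int[of "c s - v" "int p"] by fastforce
  qed simp
  have row: "inj_mod x {s \<in> S. c s = v}" for v
    using injcx by (auto simp: inj_mod_def)
  \<comment> \<open>On row \<open>0\<close> the \<open>c\<close>-sums vanish, so the one-dimensional
    hypothesis on \<open>m\<close> would yield a zero-sum subset there.\<close>
  have "card {s \<in> S. c s = 0} < m"
  proof (rule ccontr)
    assume "\<not> ?thesis"
    then obtain X where X: "X \<subseteq> {s \<in> S. c s = 0}" "card X = m"
      by (meson not_less obtain_subset_with_card_n)
    have finX: "finite X" using X fin finite_subset[of X S] by auto
    obtain Z where Z: "Z \<subseteq> X" "Z \<noteq> {}" "int p dvd sum x Z"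
      using m(2)[OF finX inj_mod_subset[OF row X(1)] X(2)] by blast
    then have "sum c Z = 0" using X(1) by (intro sum.neutral) auto
    moreover have "Z \<subseteq> S" using Z(1) X(1) by blast
    ultimately show False using zero_sum_freeD[OF zsfcx _ Z(2) _ Z(3)] by simp
  qed
  moreover have "card S = card {s \<in> S. c s = 0} + card {s \<in> S. c s \<noteq> 0}"
    using fin by (subst card_Un_disjoint[symmetric]) (auto intro: arg_cong[of _ _ card])
  ultimately have many: "p \<le> card {s \<in> S. c s \<noteq> 0}" using cS p by simp
  show False
  proof (cases "\<exists>v. v \<noteq> 0 \<and> p \<le> 11 * card {s \<in> S. c s = v}")
    case True
    then obtain v where v: "v \<noteq> 0" "p \<le> 11 * card {s \<in> S. c s = v}" by blast
    have "{s \<in> S. c s = v} \<noteq> {}"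
    proof
      assume "{s \<in> S. c s = v} = {}"
      then have "card {s \<in> S. c s = v} = 0" by (simp only: card.empty)
      then show False using v p by linarith
    qed
    then obtain s where s: "c s = v" by blast
    have v2: "2 * \<bar>v\<bar> < int p" using c(2)[of s] s by simp
    show False
    proof (rule zero_sum_free_large_row[OF p fin injcx zsfcx])
      show "p \<le> card {s \<in> S. \<not> int p dvd c s}" using many zero[of 0] p by simp
      show "p + 10 \<le> card S" using cS m p by simp
      show "\<not> int p dvd v" using zero[of 0 s] s v p by simp
      show "p \<le> 11 * card {s \<in> S. int p dvd c s - v}" using v zero[OF v2] by simp
    qed
  next
    case False
    then show False
      by (intro zero_sum_free_small_rows[OF p fin row zsfcx many sq]) (auto simp: not_le)
  qed
qed

section \<open>From the groups to residues\<close>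

lemma comm_group_prod: "comm_group (integer_mod_group p \<times>\<times> integer_mod_group p)"
  by (rule group.group_comm_groupI[OF DirProd_group[OF group_integer_mod_group group_integer_mod_group]])
    (auto simp: add.commute)

lemma carrier_mod: "carrier (integer_mod_group p) = {0..<int p}"
  using p_pos by (simp add: carrier_integer_mod_group)

lemma finprod_integer_mod_group:
  assumes "finite T" "T \<subseteq> {0..<int p}"
  shows "finprod (integer_mod_group p) (\<lambda>x. x) T = \<Sum>T mod int p"
proof -
  interpret comm_group "integer_mod_group p" by (rule abelian_integer_mod_group)
  show ?thesis using assms
  proof (induction T rule: finite_induct)
    case (insert x T)
    then have "finprod (integer_mod_group p) (\<lambda>x. x) (insert x T) = (x + \<Sum>T mod int p) mod int p"
      by (subst finprod_insert) (auto simp: carrier_mod)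
    then show ?case using insert by (simp add: mod_simps)
  qed simp
qed

lemma finprod_integer_mod_group_prod:
  assumes "finite T" "T \<subseteq> {0..<int p} \<times> {0..<int p}"
  shows "finprod (integer_mod_group p \<times>\<times> integer_mod_group p) (\<lambda>x. x) T
    = (sum fst T mod int p, sum snd T mod int p)"
proof -
  interpret comm_group "integer_mod_group p \<times>\<times> integer_mod_group p" by (rule comm_group_prod)
  show ?thesis using assms
  proof (induction T rule: finite_induct)
    case (insert x T)
    then have "finprod (integer_mod_group p \<times>\<times> integer_mod_group p) (\<lambda>x. x) (insert x T)
      = x \<otimes>\<^bsub>integer_mod_group p \<times>\<times> integer_mod_group p\<^esub> (sum fst T mod int p, sum snd T mod int p)"
      by (subst finprod_insert) (auto simp: carrier_mod)
    then show ?case using insert by (cases x) (simp add: mod_simps)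
  qed simp
qed

lemma zero_sum_set_iff:
  assumes "finite T" "T \<subseteq> {0..<int p}"
  shows "zero_sum_set (integer_mod_group p) T \<longleftrightarrow> int p dvd \<Sum>T"
  by (simp add: zero_sum_set_def finprod_integer_mod_group[OF assms] dvd_eq_mod_eq_0)

lemma zero_sum_set_prod_iff:
  assumes "finite T" "T \<subseteq> {0..<int p} \<times> {0..<int p}"
  shows "zero_sum_set (integer_mod_group p \<times>\<times> integer_mod_group p) T \<longleftrightarrow>
    int p dvd sum fst T \<and> int p dvd sum snd T"
  by (simp add: zero_sum_set_def finprod_integer_mod_group_prod[OF assms] dvd_eq_mod_eq_0)

abbreviation olson_bound :: "nat \<Rightarrow> bool" where
  "olson_bound k \<equiv> \<forall>S. S \<subseteq> {0..<int p} \<and> card S = k \<longrightarrow> (\<exists>T\<subseteq>S. T \<noteq> {} \<and> int p dvd \<Sum>T)"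

lemma olson_eq: "olson (integer_mod_group p) = (LEAST k. olson_bound k)"
  unfolding olson_def
proof (intro arg_cong[of _ _ Least] ext)
  fix k
  have fin: "finite S" if "S \<subseteq> {0..<int p}" for S using that finite_subset by auto
  have "(\<exists>T. T \<subseteq> S \<and> T \<noteq> {} \<and> zero_sum_set (integer_mod_group p) T)
      \<longleftrightarrow> (\<exists>T\<subseteq>S. T \<noteq> {} \<and> int p dvd \<Sum>T)" if "S \<subseteq> {0..<int p}" for S
    using zero_sum_set_iff[OF fin] that by (metis subset_trans)
  then show "(\<forall>S. S \<subseteq> carrier (integer_mod_group p) \<and> finite S \<and> card S = k \<longrightarrow>
      (\<exists>T. T \<subseteq> S \<and> T \<noteq> {} \<and> zero_sum_set (integer_mod_group p) T)) \<longleftrightarrow> olson_bound k"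
    unfolding carrier_mod using fin by (simp cong: conj_cong imp_cong)
qed

lemma olson_bound_olson: "olson_bound (olson (integer_mod_group p))"
  unfolding olson_eq
\<comment> \<open>A set of \<open>p\<close> residues is the whole group and contains
  \<open>0\<close>, so the least number exists.\<close>
proof (rule LeastI_ex, rule exI[of _ p], intro allI impI)
  fix S assume S: "S \<subseteq> {0..<int p} \<and> card S = p"
  then have "S = {0..<int p}" by (intro card_subset_eq) auto
  then have "{0} \<subseteq> S" using p_pos by simp
  then show "\<exists>T\<subseteq>S. T \<noteq> {} \<and> int p dvd \<Sum>T" by (intro exI[of _ "{0}"]) simp
qed

text \<open>Nonempty subsets of \<open>{1..10}\<close> have positive sums of at most
  \<open>100\<close>, too small to be multiples of \<open>p\<close>.\<close>

lemma olson_gt_10: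
  assumes "6000 < p"
  shows "10 < olson (integer_mod_group p)"
proof (rule ccontr)
  assume le: "\<not> ?thesis"
  define k where "k = olson (integer_mod_group p)"
  have "{1..int k} \<subseteq> {0..<int p}" "card {1..int k} = k" using le assms by (auto simp: k_def)
  moreover have "olson_bound k" unfolding k_def by (rule olson_bound_olson)
  ultimately have "\<exists>T\<subseteq>{1..int k}. T \<noteq> {} \<and> int p dvd \<Sum>T" by (simp only: simp_thms)
  then obtain T where T: "T \<subseteq> {1..int k}" "T \<noteq> {}" "int p dvd \<Sum>T" by blast
  have "finite T" using T finite_subset by auto
  then have "0 < \<Sum>T" using T by (intro sum_pos) auto
  moreover have "\<Sum>T \<le> int (card T) * 10"
    by (rule sum_bounded_above) (use T le in \<open>auto simp: k_def\<close>)
  moreover have "card T \<le> card {1..int k}" using T by (intro card_mono) auto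
  then have "card T \<le> 10" using le by (simp add: k_def)
  ultimately have "\<Sum>T < int p" using assms by linarith
  then show False using \<open>0 < \<Sum>T\<close> T(3) zdvd_not_zless by blast
qed

lemma olson_transfer:
  assumes "finite X" "inj_mod x X" "card X = olson (integer_mod_group p)"
  shows "\<exists>Z\<subseteq>X. Z \<noteq> {} \<and> int p dvd sum x Z"
proof -
  define h where "h = (\<lambda>s. x s mod int p)"
  have inj: "inj_on h X" using assms(2) by (auto simp: inj_on_def inj_mod_def h_def mod_eq_iff_dvd)
  have "h ` X \<subseteq> {0..<int p}" "card (h ` X) = olson (integer_mod_group p)"
    using p_pos assms(3) inj by (auto simp: h_def card_image)
  then have "\<exists>T\<subseteq>h ` X. T \<noteq> {} \<and> int p dvd \<Sum>T" using olson_bound_olson by (simp only: simp_thms)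
  then obtain T where T: "T \<subseteq> h ` X" "T \<noteq> {}" "int p dvd \<Sum>T" by blast
  then obtain Z where Z: "Z \<subseteq> X" "T = h ` Z" by (meson subset_imageE)
  have "\<Sum>T = (\<Sum>s\<in>Z. x s mod int p)"
    using sum.reindex[OF inj_on_subset[OF inj Z(1)], of "\<lambda>y. y"] Z(2) by (simp add: h_def)
  then have "int p dvd sum x Z" using T(3) by (simp add: dvd_eq_mod_eq_0 mod_sum_eq)
  then show ?thesis using Z T by blast
qed

section \<open>The two bounds for the product group\<close>

lemma olson_prod_upper:
  assumes p: "6000 < p" and S: "S \<subseteq> carrier (integer_mod_group p \<times>\<times> integer_mod_group p)" "finite S"
    "card S = p - 1 + olson (integer_mod_group p)"
  shows "\<exists>T. T \<subseteq> S \<and> T \<noteq> {} \<and> zero_sum_set (integer_mod_group p \<times>\<times> integer_mod_group p) T"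
proof (rule ccontr)
  assume none: "\<not> ?thesis"
  have S': "S \<subseteq> {0..<int p} \<times> {0..<int p}" using S(1) by (simp add: carrier_mod)
  show False
  proof (rule zero_sum_free_card_less[where f = fst and g = snd, OF p S(2)])
    fix s t assume st: "s \<in> S" "t \<in> S" "int p dvd fst s - fst t" "int p dvd snd s - snd t"
    then have "fst s = fst t" "snd s = snd t" using S' by (intro residue_eqI; force)+
    then show "s = t" by (rule prod_eqI)
  next
    show "zero_sum_free fst snd S"
      unfolding zero_sum_free_def
    proof (intro allI impI notI)
      fix Z assume Z: "Z \<subseteq> S" "Z \<noteq> {}" "int p dvd sum fst Z" "int p dvd sum snd Z"
      have "finite Z" "Z \<subseteq> {0..<int p} \<times> {0..<int p}" using Z(1) S(2) S' finite_subset by auto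
      then have "zero_sum_set (integer_mod_group p \<times>\<times> integer_mod_group p) Z"
        using Z by (simp add: zero_sum_set_prod_iff)
      then show False using none Z by blast
    qed
  next
    show "11 \<le> olson (integer_mod_group p)" using olson_gt_10[OF p] by simp
  qed (use olson_transfer S(3) in auto)
qed

text \<open>The extremal example has a largest zero-sum free set \<open>A\<close> on the line
  \<open>snd = 0\<close> and \<open>p - 1\<close> points on the line \<open>snd = 1\<close>. A
  zero-sum subset must take a multiple of \<open>p\<close> points of the second line, hence none,
  and then lies in \<open>A\<close>. Subsets of the example handle every smaller \<open>k\<close>,
  since minimality demands failure at each of them.\<close>

lemma olson_prod_lower:
  assumes k: "k < p - 1 + olson (integer_mod_group p)"
  obtains S where "S \<subseteq> carrier (integer_mod_group p \<times>\<times> integer_mod_group p)" "finite S" "card S = k"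
    "\<And>T. T \<subseteq> S \<Longrightarrow> T \<noteq> {} \<Longrightarrow> \<not> zero_sum_set (integer_mod_group p \<times>\<times> integer_mod_group p) T"
proof -
  define m where "m = olson (integer_mod_group p)"
  have "m \<noteq> 0"
  proof
    assume "m = 0"
    then have "olson_bound 0" using olson_bound_olson by (simp only: m_def[symmetric])
    then show False by auto
  qed
  then have "\<not> olson_bound (m - 1)"
    using not_less_Least[of "m - 1" olson_bound] by (simp only: olson_eq m_def) simp
  then obtain A where A: "A \<subseteq> {0..<int p}" "card A = m - 1"
    "\<And>T. T \<subseteq> A \<Longrightarrow> T \<noteq> {} \<Longrightarrow> \<not> int p dvd \<Sum>T" by blast
  have finA: "finite A" using A(1) finite_subset by auto
  define S0 where "S0 = A \<times> {0 :: int} \<union> {0..<int p - 1} \<times> {1}"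
  have "card S0 = card (A \<times> {0 :: int}) + card ({0..<int p - 1} \<times> {1 :: int})"
    unfolding S0_def by (rule card_Un_disjoint) (use finA in auto)
  then have "k \<le> card S0" using A(2) k \<open>m \<noteq> 0\<close> p_gt_1 by (simp add: card_cartesian_product m_def)
  then obtain S where S: "S \<subseteq> S0" "card S = k" by (meson obtain_subset_with_card_n)
  have S0: "finite S0" "S0 \<subseteq> {0..<int p} \<times> {0..<int p}" using finA A(1) p_gt_1 by (auto simp: S0_def)
  show ?thesis
  proof (rule that)
    show "S \<subseteq> carrier (integer_mod_group p \<times>\<times> integer_mod_group p)" "finite S" "card S = k"
      using S S0 finite_subset by (auto simp: carrier_mod)
    fix T assume T: "T \<subseteq> S" "T \<noteq> {}"
    have fT: "finite T" "T \<subseteq> S0" "T \<subseteq> {0..<int p} \<times> {0..<int p}"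
      using T S S0 finite_subset[of T S0] by auto
    show "\<not> zero_sum_set (integer_mod_group p \<times>\<times> integer_mod_group p) T"
      unfolding zero_sum_set_prod_iff[OF fT(1,3)]
    proof
      assume zs: "int p dvd sum fst T \<and> int p dvd sum snd T"
      define U where "U = {s \<in> T. snd s = 1}"
      have "sum snd T = (\<Sum>s\<in>T. if snd s = 1 then 1 else 0)"
        by (rule sum.cong) (use fT(2) in \<open>auto simp: S0_def\<close>)
      also have "\<dots> = int (card U)" using fT(1) by (simp add: sum.If_cases Int_def U_def)
      finally have sU: "sum snd T = int (card U)" .
      have "card U \<le> card ({0..<int p - 1} \<times> {1 :: int})"
        by (rule card_mono) (use fT(2) in \<open>auto simp: U_def S0_def\<close>)
      then have "card U < p" using p_gt_1 by (simp add: card_cartesian_product)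
      moreover have "p dvd card U" using zs unfolding sU by simp
      ultimately have "card U = 0" using dvd_imp_le[of p "card U"] by fastforce
      then have "U = {}" using fT(1) by (simp add: U_def)
      then have TA: "T \<subseteq> A \<times> {0}" using fT(2) by (auto simp: U_def S0_def)
      then have "inj_on fst T" by (auto simp: inj_on_def)
      then have "sum fst T = \<Sum>(fst ` T)" by (simp add: sum.reindex)
      moreover have "fst ` T \<subseteq> A" "fst ` T \<noteq> {}" using TA T by auto
      ultimately show False using A(3) zs by metis
    qed
  qed
qed

end

theorem theorem1:
  fixes p :: nat
  assumes "prime p" and "p > 6000"
  shows "olson (integer_mod_group p \<times>\<times> integer_mod_group p)
           = p - 1 + olson (integer_mod_group p)"
proof -
  interpret prime_modulus p by unfold_locales (rule assms(1))
  show ?thesis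
    unfolding olson_def[of "integer_mod_group p \<times>\<times> integer_mod_group p"]
  proof (rule Least_equality)
    show "\<forall>S. S \<subseteq> carrier (integer_mod_group p \<times>\<times> integer_mod_group p) \<and> finite S
        \<and> card S = p - 1 + olson (integer_mod_group p) \<longrightarrow>
      (\<exists>T. T \<subseteq> S \<and> T \<noteq> {} \<and> zero_sum_set (integer_mod_group p \<times>\<times> integer_mod_group p) T)"
      using olson_prod_upper assms(2) by blast
  next
    fix k
    assume *: "\<forall>S. S \<subseteq> carrier (integer_mod_group p \<times>\<times> integer_mod_group p) \<and> finite S \<and> card S = k \<longrightarrow>
      (\<exists>T. T \<subseteq> S \<and> T \<noteq> {} \<and> zero_sum_set (integer_mod_group p \<times>\<times> integer_mod_group p) T)"
    show "p - 1 + olson (integer_mod_group p) \<le> k"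
    proof (rule ccontr)
      assume "\<not> ?thesis"
      then have "k < p - 1 + olson (integer_mod_group p)" by simp
      then obtain S where "S \<subseteq> carrier (integer_mod_group p \<times>\<times> integer_mod_group p)" "finite S" "card S = k"
        "\<And>T. T \<subseteq> S \<Longrightarrow> T \<noteq> {} \<Longrightarrow> \<not> zero_sum_set (integer_mod_group p \<times>\<times> integer_mod_group p) T"
        by (rule olson_prod_lower) blast
      then show False using * by blast
    qed
  qed
qed

end
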